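(* Let $p,q\ge1$ be integers and consider the NBIN-GARCH$(p,q)$ model with compact parameter set $\Theta\subset(0,\infty)\times[0,\infty)^{p+q}\times(0,\infty)$, $\theta=(\omega,a_1,\dots,a_p,b_1,\dots,b_q,r)$ (see context). Suppose that for all $\theta=(\omega,a_{1:p},b_{1:q},r)\in\Theta$, $$\sum_{k=1}^pa_k+r\sum_{k=1}^qb_k<1 .$$ Then: (i) For all $\theta\in\Theta$, there exists a unique (in law) stationary solution to the model equations. Moreover, for all $\theta\in\Theta$, $\int x\,\pi^\theta_{\mathsf X}(\mathrm{d}x)<\infty$, where $\pi^\theta_{\mathsf X}$ is the law of $X_0$ under the stationary distribution. (ii) For any $x_1^{(i)}\in(0,\infty)$ and $y_1^{(i)}\in\mathbb{Z}_{\ge0}$, setting $z^{(i)}=(x_1^{(i)},\dots,x_1^{(i)},y_1^{(i)},\dots,y_1^{(i)})\in[0,\infty)^p\times\mathbb{Z}_{\ge0}^{q-1}$, the conditional maximum likelihood estimator $\hat\theta_{z^{(i)},n}$ is equivalence-class consistent: for any $\theta_\star\in\Theta$, $$\lim_{n\to\infty}\Delta(\hat\theta_{z^{(i)},n},[\theta_\star])=0\quad\tilde{\mathbb{P}}^{\theta_\star}\text{-a.s.}$$ (iii) If moreover the true parameter $\theta_\star=(\omega^\star,a^\star_{1:p},b^\star_{1:q},r^\star)\in\Theta$ is such that the polynomials $\mathrm{P}_p(z;a^\star_{1:p})=z^p-\sum_{k=1}^pa^\star_kz^{p-k}$ and $\mathrm{Q}_q(z;b^\star_{1:q})=\sum_{k=0}^{q-1}b^\star_{k+1}z^{q-1-k}$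 have no common complex roots, then $\hat\theta_{z^{(i)},n}$ is consistent, that is, $\lim_{n\to\infty}\Delta(\hat\theta_{z^{(i)},n},\theta_\star)=0$, $\tilde{\mathbb{P}}^{\theta_\star}$-a.s.
   Context: Model: for a parameter $\theta=(\omega,a_{1:p},b_{1:q},r)$, a process $(X_k)_{k>-p}$ valued in $[0,\infty)$ and $(Y_k)_{k>-q}$ valued in $\mathbb{Z}_{\ge0}$ satisfies the NBIN-GARCH$(p,q)$ model if for all $k\ge0$, conditionally on $\mathcal{F}_k=\sigma(X_{-p+1},\dots,X_k,Y_{-q+1},\dots,Y_{k-1})$, $Y_k$ has the negative binomial distribution with shape $r$ and mean $rX_k$, i.e. with probability mass function $g^\theta(X_k;\cdot)$ where $$g^\theta(x;y)=\frac{\Gamma(r+y)}{y!\,\Gamma(r)}\Big(\frac1{1+x}\Big)^r\Big(\frac{x}{1+x}\Big)^y,\qquad y\in\mathbb{Z}_{\ge0}\ (\text{with }0^0=1),$$ and $$X_{k+1}=\omega+\sum_{i=1}^pa_iX_{k+1-i}+\sum_{i=1}^qb_iY_{k+1-i}.$$ $\Theta$ is a compact set endowed with a metric $\Delta$ (inducing the usual topology). Stationary solution: when it exists and is unique in law, $\mathbb{P}^\theta$ denotes the law of the stationary process $\{(X_k,Y_k):k\in\mathbb{Z}\}$ such that, for all $k\in\mathbb{Z}$, conditionally on $\mathcal{F}_k=\sigma(X_j,j\le k;\,Y_j,j\le k-1)$, $Y_k$ has probability mass function $g^\theta(X_k;\cdot)$ (negative binomial with shape $r$ and mean $rX_k$),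 and $X_{k+1}=\omega+\sum_{i=1}^pa_iX_{k+1-i}+\sum_{i=1}^qb_iY_{k+1-i}$; $\tilde{\mathbb{P}}^\theta$ denotes the induced law of $\{Y_k:k\in\mathbb{Z}\}$. Write $[\theta]=\{\theta'\in\Theta:\tilde{\mathbb{P}}^{\theta'}=\tilde{\mathbb{P}}^{\theta}\}$, and $\Delta(\theta,A)=\inf_{\theta'\in A}\Delta(\theta,\theta')$. Conditional MLE: given $z=(x_{-p+1},\dots,x_0,u_{-q+1},\dots,u_{-1})\in[0,\infty)^p\times\mathbb{Z}_{\ge0}^{q-1}$ and observations $Y_0,\dots,Y_n$, put $u_k=Y_k$ for $k\ge0$ and, for $k\ge1$, $x_k=x_k(\theta)=\omega+\sum_{i=1}^pa_ix_{k-i}+\sum_{i=1}^qb_iu_{k-i}$. Then $\mathsf{L}^\theta_{z,n}=n^{-1}\sum_{k=1}^n\ln g^\theta(x_k(\theta);Y_k)$ and $\hat\theta_{z,n}\in\operatorname{argmax}_{\theta\in\Theta}\mathsf{L}^\theta_{z,n}$. *)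

theory Defs
  imports "HOL-Probability.Probability"
begin

text \<open>
  A parameter is \<open>(\<omega>, a, b, r)\<close>. The vectors \<open>a\<^sub>1,\<dots>,a\<^sub>p\<close> and \<open>b\<^sub>1,\<dots>,b\<^sub>q\<close> are functions on
  \<open>nat\<close> that are extensional outside \<open>{1..p}\<close> and \<open>{1..q}\<close>, so that on \<open>param_space p q\<close> the
  topology of the type (product topology on functions) is the Euclidean topology of
  \<open>\<real>\<^sup>1\<^sup>+\<^sup>p\<^sup>+\<^sup>q\<^sup>+\<^sup>1\<close>.
\<close>

type_synonym param = "real \<times> (nat \<Rightarrow> real) \<times> (nat \<Rightarrow> real) \<times> real"

definition param_space :: "nat \<Rightarrow> nat \<Rightarrow> param set" where
  "param_space p q = {0<..} \<times> ({1..p} \<rightarrow>\<^sub>E {0..}) \<times> ({1..q} \<rightarrow>\<^sub>E {0..}) \<times> {0<..}"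

definition nbin_pmf :: "param \<Rightarrow> real \<Rightarrow> nat \<Rightarrow> real" where
  "nbin_pmf = (\<lambda>(\<omega>, a, b, r) x y.
     Gamma (r + real y) / (fact y * Gamma r) * (1 / (1 + x)) powr r * (x / (1 + x)) ^ y)"

text \<open>
  The right-hand side of the recursion for \<open>X\<^sub>k\<close>: applied to \<open>k + 1\<close> it reads
  \<open>\<omega> + \<Sum>\<^sub>i a\<^sub>i X\<^sub>k\<^sub>+\<^sub>1\<^sub>-\<^sub>i + \<Sum>\<^sub>i b\<^sub>i Y\<^sub>k\<^sub>+\<^sub>1\<^sub>-\<^sub>i\<close>.
\<close>

definition garch_step ::
    "nat \<Rightarrow> nat \<Rightarrow> param \<Rightarrow> (int \<Rightarrow> real) \<Rightarrow> (int \<Rightarrow> nat) \<Rightarrow> int \<Rightarrow> real" where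
  "garch_step p q = (\<lambda>(\<omega>, a, b, r) x u k.
     \<omega> + (\<Sum>i=1..p. a i * x (k - int i)) + (\<Sum>i=1..q. b i * real (u (k - int i))))"

text \<open>The \<open>\<sigma>\<close>-algebra generated by \<open>X\<^sub>j\<close>, \<open>j \<le> k\<close>, and \<open>Y\<^sub>j\<close>, \<open>j \<le> k - 1\<close>.\<close>

definition past_algebra ::
    "'w measure \<Rightarrow> (int \<Rightarrow> 'w \<Rightarrow> real) \<Rightarrow> (int \<Rightarrow> 'w \<Rightarrow> nat) \<Rightarrow> int \<Rightarrow> 'w measure" where
  "past_algebra M X Y k = sigma (space M)
     ({X j -` A \<inter> space M | j A. j \<le> k \<and> A \<in> sets borel} \<union>
      {Y j -` B \<inter> space M | j B. j \<le> k - 1})"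

definition nbin_garch_process ::
    "nat \<Rightarrow> nat \<Rightarrow> param \<Rightarrow> 'w measure \<Rightarrow> (int \<Rightarrow> 'w \<Rightarrow> real) \<Rightarrow> (int \<Rightarrow> 'w \<Rightarrow> nat) \<Rightarrow> bool" where
  "nbin_garch_process p q \<theta> M X Y \<longleftrightarrow>
     prob_space M \<and>
     (\<forall>k. X k \<in> borel_measurable M) \<and>
     (\<forall>k. Y k \<in> measurable M (count_space UNIV)) \<and>
     (\<forall>k. AE w in M. 0 \<le> X k w) \<and>
     (\<forall>k y. AE w in M.
        real_cond_exp M (past_algebra M X Y k) (indicator {v \<in> space M. Y k v = y}) w
          = nbin_pmf \<theta> (X k w) y) \<and>
     (\<forall>k. AE w in M.
        X (k + 1) w = garch_step p q \<theta> (\<lambda>j. X j w) (\<lambda>j. Y j w) (k + 1))"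

definition path_space :: "(int \<Rightarrow> real \<times> nat) measure" where
  "path_space = Pi\<^sub>M UNIV (\<lambda>_. borel \<Otimes>\<^sub>M count_space UNIV)"

text \<open>
  Laws of stationary solutions, i.e. shift-invariant probability measures on path space under
  which the coordinate process solves the model equations.
\<close>

definition stationary_solution ::
    "nat \<Rightarrow> nat \<Rightarrow> param \<Rightarrow> (int \<Rightarrow> real \<times> nat) measure \<Rightarrow> bool" where
  "stationary_solution p q \<theta> P \<longleftrightarrow>
     sets P = sets path_space \<and>
     (\<forall>h::int. distr P path_space (\<lambda>w k. w (k + h)) = P) \<and>
     nbin_garch_process p q \<theta> P (\<lambda>k w. fst (w k)) (\<lambda>k w. snd (w k))"

text \<open>Meaningful only when the stationary solution exists and is unique.\<close>

definition stat_law :: "nat \<Rightarrow> nat \<Rightarrow> param \<Rightarrow> (int \<Rightarrow> real \<times> nat) measure" where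
  "stat_law p q \<theta> = (THE P. stationary_solution p q \<theta> P)"

definition stat_law_Y :: "nat \<Rightarrow> nat \<Rightarrow> param \<Rightarrow> (int \<Rightarrow> nat) measure" where
  "stat_law_Y p q \<theta> =
     distr (stat_law p q \<theta>) (Pi\<^sub>M UNIV (\<lambda>_. count_space UNIV)) (\<lambda>w k. snd (w k))"

definition stat_marginal_X :: "nat \<Rightarrow> nat \<Rightarrow> param \<Rightarrow> real measure" where
  "stat_marginal_X p q \<theta> = distr (stat_law p q \<theta>) borel (\<lambda>w. fst (w 0))"

definition param_class :: "nat \<Rightarrow> nat \<Rightarrow> param set \<Rightarrow> param \<Rightarrow> param set" where
  "param_class p q \<Theta> \<theta> = {\<theta>' \<in> \<Theta>. stat_law_Y p q \<theta>' = stat_law_Y p q \<theta>}"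

definition dist_to_set :: "(param \<Rightarrow> param \<Rightarrow> real) \<Rightarrow> param \<Rightarrow> param set \<Rightarrow> real" where
  "dist_to_set \<Delta> \<theta> A = (INF \<theta>'\<in>A. \<Delta> \<theta> \<theta>')"

text \<open>
  The initial condition \<open>z = (x\<^sub>-\<^sub>p\<^sub>+\<^sub>1,\<dots>,x\<^sub>0,u\<^sub>-\<^sub>q\<^sub>+\<^sub>1,\<dots>,u\<^sub>-\<^sub>1)\<close> is given by two functions on the integers,
  of which only the values at \<open>-p+1,\<dots>,0\<close> and at \<open>-q+1,\<dots>,-1\<close>, respectively, are ever used.
\<close>

definition extend_obs :: "(int \<Rightarrow> nat) \<Rightarrow> (int \<Rightarrow> nat) \<Rightarrow> int \<Rightarrow> nat" where
  "extend_obs u0 Y k = (if k < 0 then u0 k else Y k)"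

lemma garch_step_cong [fundef_cong]:
  assumes "p = p'" "q = q'" "\<theta> = \<theta>'" "u = u'" "k = k'" "\<And>j. j < k' \<Longrightarrow> x j = x' j"
  shows "garch_step p q \<theta> x u k = garch_step p' q' \<theta>' x' u' k'"
  using assms by (auto simp: garch_step_def split: prod.splits intro!: sum.cong)

function cond_X ::
    "nat \<Rightarrow> nat \<Rightarrow> param \<Rightarrow> (int \<Rightarrow> real) \<Rightarrow> (int \<Rightarrow> nat) \<Rightarrow> int \<Rightarrow> real" where
  "cond_X p q \<theta> x0 u k =
     (if k \<le> 0 then x0 k else garch_step p q \<theta> (\<lambda>j. cond_X p q \<theta> x0 u j) u k)"
  by pat_completeness auto
termination
  by (relation "Wellfounded.measure (\<lambda>(p, q, \<theta>, x0, u, k). nat k)") auto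

declare cond_X.simps [simp del]

definition cond_loglik ::
    "nat \<Rightarrow> nat \<Rightarrow> (int \<Rightarrow> real) \<Rightarrow> (int \<Rightarrow> nat) \<Rightarrow> nat \<Rightarrow> (int \<Rightarrow> nat) \<Rightarrow> param \<Rightarrow> real" where
  "cond_loglik p q x0 u0 n Y \<theta> =
     (\<Sum>k=1..n. ln (nbin_pmf \<theta> (cond_X p q \<theta> x0 (extend_obs u0 Y) (int k)) (Y (int k)))) / real n"

text \<open>
  A conditional maximum likelihood estimator is any selection of maximisers over \<open>\<Theta>\<close>, one for
  each sample size and each observed path.
\<close>

definition cond_mle ::
    "nat \<Rightarrow> nat \<Rightarrow> param set \<Rightarrow> (int \<Rightarrow> real) \<Rightarrow> (int \<Rightarrow> nat)
      \<Rightarrow> (nat \<Rightarrow> (int \<Rightarrow> nat) \<Rightarrow> param) \<Rightarrow> bool" where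
  "cond_mle p q \<Theta> x0 u0 \<theta>hat \<longleftrightarrow>
     (\<forall>n\<ge>1. \<forall>Y. is_arg_max (cond_loglik p q x0 u0 n Y) (\<lambda>\<theta>. \<theta> \<in> \<Theta>) (\<theta>hat n Y))"

definition P_poly :: "nat \<Rightarrow> (nat \<Rightarrow> real) \<Rightarrow> complex poly" where
  "P_poly p a = monom 1 p - (\<Sum>k=1..p. monom (complex_of_real (a k)) (p - k))"

definition Q_poly :: "nat \<Rightarrow> (nat \<Rightarrow> real) \<Rightarrow> complex poly" where
  "Q_poly q b = (\<Sum>k=0..q-1. monom (complex_of_real (b (k + 1))) (q - 1 - k))"

end

theory Submission
  imports Defs "HOL-Computational_Algebra.Fundamental_Theorem_Algebra"
begin

text \<open>
  The quantile coupling \<open>Y\<^sub>k = Q(X\<^sub>k, u\<^sub>k)\<close> with independent uniform \<open>u\<^sub>k\<close> is monotone in \<open>X\<^sub>k\<close> and satisfies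
  \<open>E \<bar>Q(x, u) - Q(x', u)\<bar> = r * \<bar>x - x'\<bar>\<close>. Starting from zero in the remote past gives paths that increase to a
  stationary solution of finite mean; running two solutions with the same noise shows that the law of any
  stationary solution is the limit of one and the same sequence, hence unique.

  The stationary law is thus a factor of independent noise and satisfies a strong law of large numbers, which
  follows from the maximal ergodic lemma, since bounded coboundaries and \<open>L\<^sup>1\<close>-limits preserve it. The
  normalised log-likelihood therefore converges to \<open>E ln g\<^sup>\<theta>(X\<^sup>\<theta>\<^sub>0; Y\<^sub>0)\<close>, where \<open>X\<^sup>\<theta>\<^sub>0\<close> is the value that \<open>\<theta>\<close> assigns
  to the observed past. By \<open>ln t \<le> t - 1\<close> this limit is maximal exactly if the two conditional laws agree, and
  then \<open>(X\<^sup>\<theta>, Y)\<close> is itself a stationary solution for \<open>\<theta>\<close>, so that uniqueness puts \<open>\<theta>\<close> into the class of the true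
  parameter. Wald's compactness argument concludes; only first moments are available, but the derivative of
  \<open>ln g\<^sup>\<theta>\<close> in \<open>x\<close> is tamed by the lower bound \<open>X \<ge> \<omega>\<close>.

  If the class contains \<open>\<theta>\<close>, eliminating \<open>X\<close> from the difference of the two recursions leaves a finite linear
  relation among the observations. It is trivial because each \<open>Y\<^sub>k\<close> is nondegenerate given its past, which reads
  \<open>A * Q + B * P = 0\<close> with \<open>deg A < deg P\<close>; without common roots this forces \<open>A = B = 0\<close>.
\<close>

section \<open>The negative binomial distribution\<close>

text \<open>The contraction hypothesis controls means only, and this shapes everything. An arbitrary
  stationary solution is not known to have a finite mean, so the coupling is applied conditionally
  on its past and the resulting bounds are truncated at 1 before they are integrated. In the
  likelihood, products of \<open>Y\<close> with \<open>X\<close> may fail to be integrable, which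
  rules out a plain Lipschitz estimate.

  Recursions with several lags are not turned into Markov chains on a larger state space. Geometric
  weights in the lags make one comparison principle (\<open>dominate\<close>) yield forgetting of
  initial values, growth bounds and continuity in the parameter.

  The joint law is recovered from the law of the observations, because \<open>X\<close> is a
  function of past values of \<open>Y\<close>. Uniqueness thus concerns integer sequences only, for
  which a small mean distance already forces equality with high probability.

  The estimator ranges over an uncountable set. Pathwise estimates therefore hold on one event
  (\<open>good\<close>) that involves no parameter.\<close>

definition nb :: "real \<Rightarrow> real \<Rightarrow> nat \<Rightarrow> real" where
  "nb r x y = pochhammer r y / fact y * (1 / (1 + x)) powr r * (x / (1 + x)) ^ y"

text \<open>Rising factorials give recursions in \<open>y\<close> without identities for Gamma; the
  two forms agree since \<open>r > 0\<close> is no pole.\<close>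

lemma nbin_pmf_eq_nb: "0 < r \<Longrightarrow> nbin_pmf (\<omega>, a, b, r) x y = nb r x y"
  by (subst nb_def, subst pochhammer_Gamma)
     (auto simp: nbin_pmf_def elim!: nonpos_Ints_cases)

lemma nb_nonneg: "0 < r \<Longrightarrow> 0 \<le> x \<Longrightarrow> 0 \<le> nb r x y"
  by (auto simp: nb_def intro!: mult_nonneg_nonneg divide_nonneg_nonneg pochhammer_nonneg)

lemma nb_pos: "0 < r \<Longrightarrow> 0 < x \<Longrightarrow> 0 < nb r x y"
  by (auto simp: nb_def intro!: mult_pos_pos divide_pos_pos pochhammer_pos)

lemma nb_measurable [measurable]: "(\<lambda>x. nb r x y) \<in> borel_measurable borel"
  unfolding nb_def by measurable

text \<open>Binomial series of \<open>(1 - t) powr (-r)\<close> at \<open>t = x / (1 + x)\<close>,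
  where \<open>1 - t = 1 / (1 + x)\<close>.\<close>

lemma nb_sums:
  assumes r: "0 < r" and x: "0 \<le> x" shows "nb r x sums 1"
proof -
  define t where "t = x / (1 + x)"
  have t: "0 \<le> t" "t < 1" using x by (auto simp: t_def field_simps)
  have "(\<lambda>n. ((-r) gchoose n) * (-t) ^ n) sums (1 + (-t)) powr (-r)"
    using t by (intro gen_binomial_real) auto
  also have "(\<lambda>n. ((-r) gchoose n) * (-t) ^ n) = (\<lambda>n. pochhammer r n / fact n * t ^ n)"
  proof
    fix n
    have "(-1) ^ n * (-t) ^ n = t ^ n" by (simp flip: power_mult_distrib)
    then show "((-r) gchoose n) * (-t) ^ n = pochhammer r n / fact n * t ^ n"
      by (simp add: gbinomial_pochhammer mult_ac)
  qed
  finally have "(\<lambda>n. (1 / (1 + x)) powr r * (pochhammer r n / fact n * t ^ n)) sums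
      ((1 / (1 + x)) powr r * (1 + (-t)) powr (-r))"
    by (rule sums_mult)
  moreover have "1 + (-t) = 1 / (1 + x)" using x by (simp add: t_def field_simps)
  ultimately show ?thesis
    using x by (simp add: nb_def[abs_def] t_def mult_ac flip: powr_add)
qed

lemma nb_le_1: assumes "0 < r" "0 \<le> x" shows "nb r x y \<le> 1"
  using sums_le[OF _ sums_If_finite_set[of "{y}" "nb r x"] nb_sums[OF assms]] nb_nonneg[OF assms]
  by auto

text \<open>Size biasing raises the shape by one, so the mean reduces to the normalisation at shape
  \<open>r + 1\<close>.\<close>

lemma nb_Suc_size_bias:
  assumes "0 < r" "0 \<le> x"
  shows "real (Suc y) * nb r x (Suc y) = r * x * nb (r + 1) x y"
proof -
  have "(1 / (1 + x)) powr (r + 1) = (1 / (1 + x)) powr r / (1 + x)"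
    using assms by (simp add: powr_add)
  moreover have "real (Suc y) * (pochhammer r (Suc y) / fact (Suc y)) = r * pochhammer (r + 1) y / fact y"
    by (simp add: pochhammer_rec del: of_nat_Suc)
  moreover have "real (Suc y) * nb r x (Suc y) =
      real (Suc y) * (pochhammer r (Suc y) / fact (Suc y)) * (1 / (1 + x)) powr r * (x / (1 + x)) ^ Suc y"
    by (simp add: nb_def)
  ultimately show ?thesis by (simp add: nb_def mult_ac)
qed

lemma nb_mean_sums:
  assumes "0 < r" "0 \<le> x" shows "(\<lambda>y. real y * nb r x y) sums (r * x)"
proof -
  have "(\<lambda>y. r * x * nb (r + 1) x y) sums (r * x * 1)"
    using assms by (intro sums_mult nb_sums) auto
  then have "(\<lambda>y. real (Suc y) * nb r x (Suc y)) sums (r * x)"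
    unfolding nb_Suc_size_bias[OF assms] by simp
  then show ?thesis by (subst (asm) sums_Suc_iff) simp
qed

lemma nb_nn_sum: "0 < r \<Longrightarrow> 0 \<le> x \<Longrightarrow> (\<Sum>y. ennreal (nb r x y)) = 1"
  by (subst suminf_ennreal2)
     (auto simp: nb_nonneg simp flip: sums_unique[OF nb_sums] intro: sums_summable[OF nb_sums])

lemma nb_nn_mean: "0 < r \<Longrightarrow> 0 \<le> x \<Longrightarrow> (\<Sum>y. ennreal (nb r x y) * of_nat y) = ennreal (r * x)"
proof -
  assume a: "0 < r" "0 \<le> x"
  have "(\<Sum>y. ennreal (nb r x y) * of_nat y) = (\<Sum>y. ennreal (real y * nb r x y))"
    by (intro suminf_cong) (simp add: ennreal_mult nb_nonneg a mult.commute ennreal_of_nat_eq_real_of_nat)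
  also have "\<dots> = ennreal (r * x)"
    by (subst suminf_ennreal2)
       (auto simp: nb_nonneg a sums_summable[OF nb_mean_sums] simp flip: sums_unique[OF nb_mean_sums])
  finally show ?thesis .
qed

text \<open>Two values of the ratio of consecutive probabilities already determine \<open>r\<close> and \<open>x / (1 + x)\<close>.\<close>

lemma nb_inject:
  assumes r: "0 < r" "0 < r'" and x: "0 < x" "0 < x'" and eq: "\<And>y. nb r x y = nb r' x' y"
  shows "r = r'" "x = x'"
proof -
  define t t' where "t = x / (1 + x)" and "t' = x' / (1 + x')"
  have tpos: "0 < t" "0 < t'" using x by (auto simp: t_def t'_def)
  define c c' where "c = (1 / (1 + x)) powr r" and "c' = (1 / (1 + x')) powr r'"
  have c: "c = c'" using eq[of 0] by (simp add: nb_def c_def c'_def)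
  have cpos: "c > 0" using x by (simp add: c_def)
  have "r * c * t = r' * c' * t'" using eq[of 1] by (simp add: nb_def c_def c'_def t_def t'_def)
  then have 1: "r * t = r' * t'" using c cpos by simp
  have "pochhammer r 2 * c * t^2 = pochhammer r' 2 * c' * t'^2"
    using eq[of 2] by (simp add: nb_def c_def c'_def t_def t'_def)
  then have "r * (r + 1) * t^2 = r' * (r' + 1) * t'^2"
    using c cpos by (simp add: numeral_2_eq_2 pochhammer_Suc)
  then have "(r * t) * ((r + 1) * t) = (r' * t') * ((r' + 1) * t')"
    by (simp add: power2_eq_square algebra_simps)
  then have "(r + 1) * t = (r' + 1) * t'"
    using 1 r tpos by (metis mult_left_cancel mult_pos_pos less_irrefl)
  then have 2: "t = t'" using 1 by (simp add: algebra_simps)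
  then show "r = r'" using 1 tpos by simp
  show "x = x'" using 2 x by (simp add: t_def t'_def field_simps)
qed

text \<open>The product form of the rising factorial turns the dependence on \<open>r\<close> into
  \<open>y\<close> logarithms, each Lipschitz in \<open>r\<close> on its own; no digamma function
  enters.\<close>

lemma ln_nb:
  assumes "0 < r" "0 < x"
  shows "ln (nb r x y) = (\<Sum>j<y. ln ((r + real j) / (1 + real j))) - r * ln (1 + x) - real y * ln (1 + 1 / x)"
proof -
  have pf: "pochhammer r y / fact y = (\<Prod>j<y. (r + real j) / (1 + real j))"
  proof (induction y)
    case (Suc y)
    have "pochhammer r (Suc y) / fact (Suc y) = (pochhammer r y / fact y) * ((r + real y) / (1 + real y))"
      by (simp add: pochhammer_Suc)
    then show ?case using Suc by simp
  qed simp
  have "ln (nb r x y) = ln (\<Prod>j<y. (r + real j) / (1 + real j)) + ln ((1 / (1 + x)) powr r) + ln ((x / (1 + x)) ^ y)"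
    unfolding nb_def pf using assms
    by (subst ln_mult_pos, (auto intro!: mult_pos_pos prod_pos divide_pos_pos)[2],
        subst ln_mult_pos) (auto intro!: mult_pos_pos prod_pos divide_pos_pos)
  moreover have "ln (\<Prod>j<y. (r + real j) / (1 + real j)) = (\<Sum>j<y. ln ((r + real j) / (1 + real j)))"
    using assms by (intro ln_prod) (auto intro!: divide_pos_pos)
  moreover have "1 + 1 / x = inverse (x / (1 + x))" using assms by (simp add: field_simps)
  then have "ln (1 + 1 / x) = - ln (x / (1 + x))"
    using assms by (metis ln_inverse add_pos_pos divide_pos_pos zero_less_one)
  ultimately show ?thesis
    using assms by (simp add: ln_powr ln_realpow ln_div right_diff_distrib)
qed

text \<open>Both directions come from \<open>ln a - ln b \<le> (a - b) / b\<close> with a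
  denominator of at least \<open>c\<close>.\<close>

lemma ln_diff_bound:
  fixes a b c :: real
  assumes "0 < c" "c \<le> a" "c \<le> b" shows "\<bar>ln a - ln b\<bar> \<le> \<bar>a - b\<bar> / c"
proof -
  have *: "ln a - ln b \<le> \<bar>a - b\<bar> / c" if "c \<le> a" "c \<le> b" for a b :: real
  proof -
    have "ln a - ln b \<le> (a - b) / b" using that assms(1) by (intro ln_diff_le) auto
    also have "\<dots> \<le> \<bar>a - b\<bar> / b" using that assms(1) by (intro divide_right_mono) auto
    also have "\<dots> \<le> \<bar>a - b\<bar> / c" using that assms(1) by (intro divide_left_mono mult_pos_pos) auto
    finally show ?thesis .
  qed
  show ?thesis using *[of a b] *[of b a] assms by (auto simp: abs_minus_commute abs_le_iff)
qed

text \<open>Growth is only linear in \<open>x\<close> and \<open>y\<close>, so first moments make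
  the log-likelihood integrable. Each of the \<open>y\<close> summands compares \<open>r + j\<close>
  with \<open>1 + j\<close>, both at least \<open>min r 1\<close>.\<close>

lemma abs_ln_nb_le:
  assumes "0 < r" "0 < c" "c \<le> x"
  shows "\<bar>ln (nb r x y)\<bar> \<le> (\<bar>r - 1\<bar> / min r 1 + 1 / c) * real y + r * x"
proof -
  have 1: "\<bar>ln ((r + real j) / (1 + real j))\<bar> \<le> \<bar>r - 1\<bar> / min r 1" for j
    using ln_diff_bound[of "min r 1" "r + real j" "1 + real j"] assms by (simp add: ln_div)
  have "\<bar>\<Sum>j<y. ln ((r + real j) / (1 + real j))\<bar> \<le> (\<Sum>j<y. \<bar>r - 1\<bar> / min r 1)"
    by (rule order_trans[OF sum_abs]) (intro sum_mono 1)
  then have "\<bar>\<Sum>j<y. ln ((r + real j) / (1 + real j))\<bar> \<le> \<bar>r - 1\<bar> / min r 1 * real y" by (simp add: mult.commute)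
  moreover have "0 \<le> ln (1 + x)" "ln (1 + x) \<le> x" using assms by (auto intro: ln_add_one_self_le_self)
  then have "0 \<le> r * ln (1 + x)" "r * ln (1 + x) \<le> r * x" using assms by auto
  moreover have "0 \<le> ln (1 + 1 / x)" "ln (1 + 1 / x) \<le> 1 / x"
    using assms by (auto intro: ln_add_one_self_le_self)
  moreover have "1 / x \<le> 1 / c" using assms by (intro divide_left_mono) auto
  ultimately have l: "0 \<le> real y * ln (1 + 1 / x)" "ln (1 + 1 / x) \<le> 1 / c" by auto
  then have "real y * ln (1 + 1 / x) \<le> 1 / c * real y"
    using mult_left_mono[OF l(2), of "real y"] by (simp only: mult.commute of_nat_0_le_iff)
  moreover have "0 < x" using assms by simp
  ultimately show ?thesis
    unfolding ln_nb[OF assms(1) \<open>0 < x\<close>] distrib_right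
    using l(1) \<open>0 \<le> r * ln (1 + x)\<close> \<open>r * ln (1 + x) \<le> r * x\<close>
      \<open>\<bar>\<Sum>j<y. ln ((r + real j) / (1 + real j))\<bar> \<le> \<bar>r - 1\<bar> / min r 1 * real y\<close>
    by linarith
qed

text \<open>
  The \<open>min\<close> matters: \<open>ln (1 + 1 / x)\<close> is bounded on \<open>[c, \<infinity>)\<close>, and only this keeps the right-hand side
  integrable when \<open>y\<close> and \<open>x\<close> have no more than a first moment.
\<close>

lemma ln_nb_diff_le:
  assumes s: "0 < s" "s \<le> r" "s \<le> r'" and c: "0 < c" "c \<le> x" "c \<le> x'"
  shows "\<bar>ln (nb r x y) - ln (nb r' x' y)\<bar> \<le>
    real y * (\<bar>r - r'\<bar> / s) + \<bar>r - r'\<bar> * x + r' * \<bar>x - x'\<bar> + real y * min (1 / c) (\<bar>x - x'\<bar> / c\<^sup>2)"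
proof -
  have 1: "\<bar>ln ((r + real j) / (1 + real j)) - ln ((r' + real j) / (1 + real j))\<bar> \<le> \<bar>r - r'\<bar> / s" for j
    using ln_diff_bound[of s "r + real j" "r' + real j"] s by (simp add: ln_div)
  have "\<bar>\<Sum>j<y. ln ((r + real j) / (1 + real j)) - ln ((r' + real j) / (1 + real j))\<bar> \<le> (\<Sum>j<y. \<bar>r - r'\<bar> / s)"
    by (rule order_trans[OF sum_abs]) (intro sum_mono 1)
  then have A: "\<bar>(\<Sum>j<y. ln ((r + real j) / (1 + real j))) - (\<Sum>j<y. ln ((r' + real j) / (1 + real j)))\<bar>
      \<le> real y * (\<bar>r - r'\<bar> / s)" by (simp add: sum_subtractf)
  have l: "0 \<le> ln (1 + x)" "ln (1 + x) \<le> x" using c by (auto intro: ln_add_one_self_le_self)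
  have "\<bar>ln (1 + x) - ln (1 + x')\<bar> \<le> \<bar>x - x'\<bar>"
    using ln_diff_bound[of 1 "1 + x" "1 + x'"] c by simp
  then have "\<bar>(r - r') * ln (1 + x)\<bar> \<le> \<bar>r - r'\<bar> * x" "\<bar>r' * (ln (1 + x) - ln (1 + x'))\<bar> \<le> r' * \<bar>x - x'\<bar>"
    using l s by (auto simp: abs_mult intro!: mult_left_mono)
  moreover have "r * ln (1 + x) - r' * ln (1 + x') = (r - r') * ln (1 + x) + r' * (ln (1 + x) - ln (1 + x'))"
    by (simp add: algebra_simps)
  ultimately have B: "\<bar>r * ln (1 + x) - r' * ln (1 + x')\<bar> \<le> \<bar>r - r'\<bar> * x + r' * \<bar>x - x'\<bar>" by linarith
  have g: "0 \<le> ln (1 + 1 / z) \<and> ln (1 + 1 / z) \<le> 1 / c" if "c \<le> z" for z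
  proof -
    have "ln (1 + 1 / z) \<le> 1 / z" using that c by (intro ln_add_one_self_le_self) auto
    also have "1 / z \<le> 1 / c" using that c by (intro divide_left_mono) auto
    finally show ?thesis using that c by auto
  qed
  have "\<bar>ln (1 + 1 / x) - ln (1 + 1 / x')\<bar> \<le> \<bar>1 / x - 1 / x'\<bar>"
    using ln_diff_bound[of 1 "1 + 1 / x" "1 + 1 / x'"] c by simp
  also have "1 / x - 1 / x' = (x' - x) / (x * x')" using c by (simp add: field_simps)
  also have "\<bar>(x' - x) / (x * x')\<bar> = \<bar>x - x'\<bar> / (x * x')" using c by (simp add: abs_minus_commute)
  also have "\<dots> \<le> \<bar>x - x'\<bar> / (c * c)" using c by (intro divide_left_mono mult_mono mult_pos_pos) auto
  finally have "\<bar>ln (1 + 1 / x) - ln (1 + 1 / x')\<bar> \<le> min (1 / c) (\<bar>x - x'\<bar> / c\<^sup>2)"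
    using g[OF c(2)] g[OF c(3)] by (auto simp: power2_eq_square)
  then have "\<bar>real y * (ln (1 + 1 / x) - ln (1 + 1 / x'))\<bar> \<le> real y * min (1 / c) (\<bar>x - x'\<bar> / c\<^sup>2)"
    unfolding abs_mult by (intro mult_mono) auto
  moreover have "0 < r" "0 < r'" "0 < x" "0 < x'" using s c by auto
  ultimately show ?thesis
    unfolding ln_nb[OF \<open>0 < r\<close> \<open>0 < x\<close>] ln_nb[OF \<open>0 < r'\<close> \<open>0 < x'\<close>] right_diff_distrib[of "real y"]
    using A B by linarith
qed

section \<open>Quantile coupling of negative binomial laws\<close>

definition nb_cdf :: "real \<Rightarrow> real \<Rightarrow> nat \<Rightarrow> real" where
  "nb_cdf r x y = (\<Sum>k\<le>y. nb r x k)"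

lemma nb_cdf_measurable [measurable]: "(\<lambda>x. nb_cdf r x y) \<in> borel_measurable borel"
  unfolding nb_cdf_def by measurable

lemma nb_cdf_mono: "0 < r \<Longrightarrow> 0 \<le> x \<Longrightarrow> y \<le> y' \<Longrightarrow> nb_cdf r x y \<le> nb_cdf r x y'"
  unfolding nb_cdf_def by (rule sum_mono2) (auto simp: nb_nonneg)

lemma nb_cdf_nonneg: "0 < r \<Longrightarrow> 0 \<le> x \<Longrightarrow> 0 \<le> nb_cdf r x y"
  unfolding nb_cdf_def by (rule sum_nonneg) (auto simp: nb_nonneg)

lemma nb_cdf_le_1: "0 < r \<Longrightarrow> 0 \<le> x \<Longrightarrow> nb_cdf r x y \<le> 1"
  using sum_le_suminf[OF sums_summable[OF nb_sums], of r x "{..y}"]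
  by (auto simp: nb_cdf_def nb_nonneg simp flip: sums_unique[OF nb_sums])

lemma nb_cdf_tendsto: "0 < r \<Longrightarrow> 0 \<le> x \<Longrightarrow> nb_cdf r x \<longlonglongrightarrow> 1"
  unfolding nb_cdf_def[abs_def] using nb_sums[of r x] by (simp add: sums_def_le)

lemma nb_cdf_Suc: "nb_cdf r x (Suc y) = nb_cdf r x y + nb r x (Suc y)"
  by (simp add: nb_cdf_def)

text \<open>In this form the derivatives telescope when summed over \<open>y\<close>, which leaves a
  single term of one sign for the distribution function.\<close>

lemma nb_has_derivative:
  assumes r: "0 < r" and x: "0 < x"
  shows "((\<lambda>x. nb r x y) has_real_derivative
     (r * (case y of 0 \<Rightarrow> 0 | Suc k \<Rightarrow> nb (r + 1) x k) - r * nb (r + 1) x y)) (at x)"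
proof -
  \<comment> \<open>A negative power of \<open>1 + x\<close>, to which the derivative rules apply
    directly, replaces the power of \<open>1 / (1 + x)\<close>; the two agree on the open
    half-line.\<close>
  define f where "f x = pochhammer r y / fact y * ((1 + x) powr (- r) * (x / (1 + x)) ^ y)" for x
  have fe: "nb r z y = f z" if "0 < z" for z
    using that by (simp add: nb_def f_def powr_divide powr_minus field_simps)
  have pr: "(1 / (1 + x)) powr (r + 1) = (1 + x) powr (-r) / (1 + x)"
    using x by (simp add: powr_add powr_divide powr_minus field_simps)
  have d: "(f has_real_derivative (pochhammer r y / fact y * ((1 + x) powr (- r) *
       (of_nat y * ((x / (1 + x)) ^ (y - 1) * (1 / (1 + x)^2))) + (- r) * (1 + x) powr (- r - 1) * (x / (1 + x)) ^ y))) (at x)"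
  proof -
    have dT: "((\<lambda>x. x / (1 + x)) has_real_derivative 1 / (1 + x)^2) (at x)"
      using x by (auto intro!: derivative_eq_intros simp: power2_eq_square field_simps)
    have dP: "((\<lambda>x. (x / (1 + x)) ^ y) has_real_derivative (of_nat y * ((x / (1 + x)) ^ (y - 1) * (1 / (1 + x)^2)))) (at x)"
      using DERIV_power[OF dT, of y] by (simp add: mult_ac)
    have dW: "((\<lambda>x. (1 + x) powr (-r)) has_real_derivative (- r) * (1 + x) powr (- r - 1)) (at x)"
      using x by (auto intro!: derivative_eq_intros)
    show ?thesis unfolding f_def
      using DERIV_cmult[OF DERIV_mult[OF dW dP], of "pochhammer r y / fact y"] by (simp add: algebra_simps)
  qed
  have pm: "(1 + x) powr (- r - 1) = (1 + x) powr (-r) / (1 + x)"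
    using x by (simp add: powr_diff)
  have "pochhammer r y / fact y * ((1 + x) powr (- r) *
       (of_nat y * ((x / (1 + x)) ^ (y - 1) * (1 / (1 + x)^2))) + (- r) * (1 + x) powr (- r - 1) * (x / (1 + x)) ^ y)
     = r * (case y of 0 \<Rightarrow> 0 | Suc k \<Rightarrow> nb (r + 1) x k) - r * nb (r + 1) x y"
  proof (cases y)
    case 0
    then show ?thesis using pr pm x by (simp add: nb_def)
  next
    case (Suc k)
    define T where "T = x / (1 + x)"
    define W where "W = (1 + x) powr (-r) / (1 + x)"
    have p1: "pochhammer r (Suc k) / fact (Suc k) * real (Suc k) = r * pochhammer (r + 1) k / fact k"
      by (simp add: pochhammer_rec del: of_nat_Suc)
    have p2: "r * (pochhammer (r + 1) (Suc k) / fact (Suc k)) = pochhammer r (Suc k) / fact (Suc k) * (r + real (Suc k))"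
    proof -
      have "r * pochhammer (r + 1) (Suc k) = pochhammer r (Suc (Suc k))"
        by (simp only: pochhammer_rec[of r "Suc k"])
      also have "\<dots> = pochhammer r (Suc k) * (r + real (Suc k))"
        by (simp only: pochhammer_Suc[of r "Suc k"])
      finally show ?thesis by simp
    qed
    have W': "(1 + x) powr (-r) = W * (1 + x)" using x by (simp add: W_def)
    have iT: "1 / (1 + x) = 1 - T" using x by (simp add: T_def field_simps)
    have iT2: "W * (1 + x) * (c * (T ^ k * (1 / (1 + x)\<^sup>2))) = W * c * T ^ k * (1 - T)" for c
    proof -
      have "(1 + x) * (1 / (1 + x)\<^sup>2) = 1 - T" using iT x by (simp add: power2_eq_square)
      moreover have "W * (1 + x) * (c * (T ^ k * (1 / (1 + x)\<^sup>2))) = W * c * T ^ k * ((1 + x) * (1 / (1 + x)\<^sup>2))"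
        by (simp only: mult_ac)
      ultimately show ?thesis by simp
    qed
    have "pochhammer r y / fact y * ((1 + x) powr (- r) *
       (of_nat y * ((x / (1 + x)) ^ (y - 1) * (1 / (1 + x)^2))) + (- r) * (1 + x) powr (- r - 1) * (x / (1 + x)) ^ y)
      = pochhammer r (Suc k) / fact (Suc k) * (W * real (Suc k) * T ^ k * (1 - T) - r * W * T ^ Suc k)"
    proof -
      have e1: "(1 + x) powr (- r) * (real (Suc k) * ((x / (1 + x)) ^ k * (1 / (1 + x)\<^sup>2)))
          = W * real (Suc k) * T ^ k * (1 - T)"
        unfolding T_def[symmetric] W' by (rule iT2)
      have e2: "(- r) * ((1 + x) powr (- r) / (1 + x)) * (x / (1 + x)) ^ Suc k = - (r * W * T ^ Suc k)"
        unfolding W_def T_def by simp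
      show ?thesis unfolding Suc pm diff_Suc_1 e1 e2 by simp
    qed
    also have "\<dots> = pochhammer r (Suc k) / fact (Suc k) * real (Suc k) * W * T ^ k
        - pochhammer r (Suc k) / fact (Suc k) * (r + real (Suc k)) * W * T ^ Suc k"
      by (simp add: algebra_simps add_divide_distrib del: of_nat_Suc pochhammer_Suc fact_Suc)
    also have "\<dots> = r * (pochhammer (r + 1) k / fact k) * W * T ^ k
        - r * (pochhammer (r + 1) (Suc k) / fact (Suc k)) * W * T ^ Suc k"
      unfolding p1 p2 by simp
    finally show ?thesis unfolding Suc by (simp add: nb_def pr W_def T_def mult_ac)
  qed
  with d have "(f has_real_derivative (r * (case y of 0 \<Rightarrow> 0 | Suc k \<Rightarrow> nb (r + 1) x k) - r * nb (r + 1) x y)) (at x)"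
    by simp
  then show ?thesis
    by (rule has_field_derivative_transform_within_open[of _ _ _ "{0<..}"]) (use x fe in auto)
qed

lemma nb_cdf_has_derivative:
  assumes r: "0 < r" and x: "0 < x"
  shows "((\<lambda>x. nb_cdf r x y) has_real_derivative (- r * nb (r + 1) x y)) (at x)"
proof (induction y)
  case 0
  then show ?case using nb_has_derivative[OF assms, of 0] by (simp add: nb_cdf_def)
next
  case (Suc y)
  show ?case unfolding nb_cdf_Suc
    using DERIV_add[OF Suc nb_has_derivative[OF assms, of "Suc y"]] by simp
qed

lemma nb_continuous: "continuous_on {0..} (\<lambda>x. nb r x y)"
  unfolding nb_def by (intro continuous_intros) auto

lemma nb_cdf_continuous: "continuous_on {0..} (\<lambda>x. nb_cdf r x y)"
  unfolding nb_cdf_def by (intro continuous_intros nb_continuous)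

text \<open>Stochastic monotonicity in \<open>x\<close>: the derivative is nonpositive inside the
  interval, and continuity takes care of the end point \<open>x = 0\<close>, which the derivative
  formula does not cover.\<close>

lemma nb_cdf_antimono:
  assumes r: "0 < r" and x: "0 \<le> x" "x \<le> x'"
  shows "nb_cdf r x' y \<le> nb_cdf r x y"
proof (cases "x = x'")
  case False
  then have lt: "x < x'" using x by simp
  have "- nb_cdf r x y \<le> - nb_cdf r x' y"
  proof (rule DERIV_nonneg_imp_increasing_open[of x x' "\<lambda>x. - nb_cdf r x y"])
    show "continuous_on {x..x'} (\<lambda>x. - nb_cdf r x y)"
      using x by (intro continuous_intros continuous_on_subset[OF nb_cdf_continuous]) auto
    fix z assume z: "x < z" "z < x'"
    have "((\<lambda>x. - nb_cdf r x y) has_real_derivative (r * nb (r + 1) z y)) (at z)"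
      using DERIV_minus[OF nb_cdf_has_derivative[of r z y]] z x r by simp
    then show "\<exists>d. ((\<lambda>x. - nb_cdf r x y) has_real_derivative d) (at z) \<and> 0 \<le> d"
      using z x r nb_nonneg[of "r + 1" z y] by (intro exI[of _ "r * nb (r + 1) z y"]) auto
  qed (use lt in auto)
  then show ?thesis by simp
qed simp

text \<open>For \<open>u < 1\<close> the minimum exists because the distribution function tends to
  1. The default 0 for the other \<open>u\<close> is constant in \<open>x\<close>, so monotonicity
  and left continuity hold for every \<open>u\<close> rather than almost every
  \<open>u\<close>.\<close>

definition nb_quantile :: "real \<Rightarrow> real \<Rightarrow> real \<Rightarrow> nat" where
  "nb_quantile r x u = (if u < 1 then LEAST y. u \<le> nb_cdf r x y else 0)"

lemma nb_quantile_measurable [measurable]: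
  assumes [measurable]: "f \<in> borel_measurable M" "g \<in> borel_measurable M"
  shows "(\<lambda>w. nb_quantile r (f w) (g w)) \<in> measurable M (count_space UNIV)"
  unfolding nb_quantile_def by measurable

lemma nb_quantile_le_iff:
  assumes "0 < r" "0 \<le> x" "u < 1"
  shows "nb_quantile r x u \<le> y \<longleftrightarrow> u \<le> nb_cdf r x y"
proof -
  have "\<exists>y. u \<le> nb_cdf r x y"
    using order_tendstoD(1)[OF nb_cdf_tendsto[OF assms(1,2)] assms(3)]
    by (auto simp: eventually_sequentially intro: less_imp_le)
  then have L: "u \<le> nb_cdf r x (nb_quantile r x u)"
    using assms by (auto simp: nb_quantile_def intro: LeastI_ex)
  show ?thesis
  proof
    assume "nb_quantile r x u \<le> y"
    then show "u \<le> nb_cdf r x y" using L nb_cdf_mono[OF assms(1,2)] by (meson order_trans)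
  next
    assume "u \<le> nb_cdf r x y"
    then show "nb_quantile r x u \<le> y" using assms by (auto simp: nb_quantile_def intro: Least_le)
  qed
qed

lemma nb_quantile_mono:
  assumes "0 < r" "0 \<le> x" "x \<le> x'" shows "nb_quantile r x u \<le> nb_quantile r x' u"
proof (cases "u < 1")
  case True
  have "u \<le> nb_cdf r x' (nb_quantile r x' u)"
    using nb_quantile_le_iff[of r x' u] assms True by auto
  also have "\<dots> \<le> nb_cdf r x (nb_quantile r x' u)" using assms by (rule nb_cdf_antimono)
  finally show ?thesis using nb_quantile_le_iff[of r x u] assms True by auto
qed (simp add: nb_quantile_def)

text \<open>For integer values, left continuity means eventual equality. The strict inequality
  \<open>nb_cdf r x y < u\<close> at the value \<open>y\<close> just below the quantile survives
  small changes of \<open>x\<close>, and monotonicity gives the other bound.\<close>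

lemma nb_quantile_left_continuous:
  assumes r: "0 < r" and f: "\<And>n. 0 \<le> f n" "\<And>n. f n \<le> x" "f \<longlonglongrightarrow> x"
  shows "eventually (\<lambda>n. nb_quantile r (f n) u = nb_quantile r x u) sequentially"
proof (cases "u < 1 \<and> 0 < nb_quantile r x u")
  case False
  show ?thesis
  proof (cases "u < 1")
    case True
    then have "nb_quantile r x u = 0" using False by simp
    then show ?thesis using nb_quantile_mono[OF r f(1,2), of _ u] by simp
  qed (simp add: nb_quantile_def)
next
  case True
  have x: "0 \<le> x" using f order_trans by blast
  define y where "y = nb_quantile r x u - 1"
  have "\<not> nb_quantile r x u \<le> y" using True by (auto simp: y_def)
  then have lt: "nb_cdf r x y < u" using nb_quantile_le_iff[OF r x] True by auto
  have "(\<lambda>n. nb_cdf r (f n) y) \<longlonglongrightarrow> nb_cdf r x y"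
    by (rule continuous_on_tendsto_compose[OF nb_cdf_continuous f(3)]) (use x f in auto)
  then have "eventually (\<lambda>n. nb_cdf r (f n) y < u) sequentially" using lt by (rule order_tendstoD)
  then show ?thesis
  proof eventually_elim
    case (elim n)
    then have "\<not> nb_quantile r (f n) u \<le> y" using nb_quantile_le_iff[OF r f(1)] True by auto
    with nb_quantile_mono[OF r f(1,2), of n u] show ?case by (auto simp: y_def)
  qed
qed

section \<open>Uniform noise and the inverse transform\<close>

definition U01 :: "real measure" where "U01 = uniform_measure lborel {0<..<1}"

lemma prob_space_U01: "prob_space U01"
  unfolding U01_def by (intro prob_space_uniform_measure) auto

lemma sets_U01 [simp, measurable_cong]: "sets U01 = sets borel"
  by (simp add: U01_def)

lemma space_U01 [simp]: "space U01 = UNIV"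
  by (simp add: U01_def)

lemma emeasure_U01: "A \<in> sets borel \<Longrightarrow> emeasure U01 A = emeasure lborel ({0<..<1} \<inter> A)"
  by (simp add: U01_def emeasure_uniform_measure divide_ennreal_def)

text \<open>The level set is the interval between consecutive values of the distribution function,
  of length \<open>nb r x y\<close>.\<close>

lemma emeasure_U01_quantile:
  assumes r: "0 < r" and x: "0 \<le> x"
  shows "emeasure U01 {u. nb_quantile r x u = y} = ennreal (nb r x y)"
proof -
  have meas: "{u. nb_quantile r x u = y} \<in> sets borel" by measurable
  have le: "nb_quantile r x u \<le> y \<longleftrightarrow> u \<le> nb_cdf r x y" if "u < 1" for u y
    by (rule nb_quantile_le_iff[OF r x that])
  have "{0<..<1} \<inter> {u. nb_quantile r x u = y} =
      {u. (case y of 0 \<Rightarrow> 0 | Suc k \<Rightarrow> nb_cdf r x k) < u \<and> u \<le> nb_cdf r x y \<and> u < 1}" (is "?A = ?B")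
  proof (cases y)
    case 0
    show ?thesis unfolding 0 using le[of _ 0] by auto
  next
    case (Suc k)
    have "nb_quantile r x u = Suc k \<longleftrightarrow> nb_cdf r x k < u \<and> u \<le> nb_cdf r x (Suc k)" if "u < 1" for u
      using le[OF that, of k] le[OF that, of "Suc k"] by auto
    then show ?thesis unfolding Suc using nb_cdf_nonneg[OF r x, of k] by (auto intro: le_less_trans)
  qed
  moreover have "emeasure lborel ?B = ennreal (nb r x y)"
  proof -
    define l where "l = (case y of 0 \<Rightarrow> 0 | Suc k \<Rightarrow> nb_cdf r x k)"
    have h: "nb_cdf r x y - l = nb r x y" by (auto simp: l_def nb_cdf_def split: nat.split)
    have lh: "l \<le> nb_cdf r x y" using h nb_nonneg[OF r x, of y] by linarith
    \<comment> \<open>The two sets differ at most in the null points \<open>l\<close> and 1.\<close>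
    have "emeasure lborel ?B = emeasure lborel {l..nb_cdf r x y}"
      unfolding l_def[symmetric] using nb_cdf_le_1[OF r x, of y]
    proof (intro emeasure_eq_AE)
      show "AE u in lborel. (u \<in> {u. l < u \<and> u \<le> nb_cdf r x y \<and> u < 1}) = (u \<in> {l..nb_cdf r x y})"
        using AE_lborel_singleton[of l] AE_lborel_singleton[of 1]
        by eventually_elim (use nb_cdf_le_1[OF r x, of y] in auto)
    qed auto
    then show ?thesis using lh h by simp
  qed
  ultimately show ?thesis using emeasure_U01[OF meas] by simp
qed

lemma nn_integral_nat_partition:
  assumes [measurable]: "Y \<in> measurable M (count_space UNIV)" and [measurable]: "\<And>y::nat. H y \<in> borel_measurable M"
  shows "(\<integral>\<^sup>+ w. H (Y w) w \<partial>M) = (\<Sum>y. \<integral>\<^sup>+ w. H y w * indicator {w. Y w = y} w \<partial>M)"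
proof -
  have "H (Y w) w = (\<Sum>y. H y w * indicator {w. Y w = y} w)" for w
    by (subst suminf_finite[of "{Y w}"]) auto
  then show ?thesis by (subst nn_integral_suminf[symmetric]) auto
qed

lemma nn_integral_U01_quantile:
  fixes h :: "nat \<Rightarrow> ennreal"
  assumes r: "0 < r" and x: "0 \<le> x"
  shows "(\<integral>\<^sup>+ u. h (nb_quantile r x u) \<partial>U01) = (\<Sum>y. ennreal (nb r x y) * h y)"
proof -
  have "(\<integral>\<^sup>+ u. h (nb_quantile r x u) \<partial>U01) = (\<Sum>y. \<integral>\<^sup>+ u. h y * indicator {u. nb_quantile r x u = y} u \<partial>U01)"
    by (rule nn_integral_nat_partition[where H = "\<lambda>y w. h y"]) measurable
  also have "\<dots> = (\<Sum>y. h y * ennreal (nb r x y))"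
    by (subst nn_integral_cmult_indicator) (auto simp: emeasure_U01_quantile[OF r x])
  finally show ?thesis by (simp add: mult.commute)
qed

lemma nn_integral_quantile_mean:
  assumes "0 < r" "0 \<le> x"
  shows "(\<integral>\<^sup>+ u. ennreal (real (nb_quantile r x u)) \<partial>U01) = ennreal (r * x)"
  using nn_integral_U01_quantile[OF assms, of "of_nat"] nb_nn_mean[OF assms]
  by (simp add: ennreal_of_nat_eq_real_of_nat)

text \<open>For \<open>x \<le> x'\<close> the two quantiles are ordered for every \<open>u\<close>,
  so their mean distance is the difference of their means. This identity carries the
  contraction.\<close>

lemma nn_integral_quantile_diff:
  assumes r: "0 < r" and x: "0 \<le> x" "0 \<le> x'"
  shows "(\<integral>\<^sup>+ u. ennreal \<bar>real (nb_quantile r x u) - real (nb_quantile r x' u)\<bar> \<partial>U01) = ennreal (r * \<bar>x - x'\<bar>)"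
proof -
  have *: "(\<integral>\<^sup>+ u. ennreal \<bar>real (nb_quantile r x u) - real (nb_quantile r x' u)\<bar> \<partial>U01) = ennreal (r * \<bar>x - x'\<bar>)"
    if x: "0 \<le> x" "x \<le> x'" for x x'
  proof -
    have "ennreal (r * x') = (\<integral>\<^sup>+ u. ennreal (real (nb_quantile r x' u)) \<partial>U01)"
      using x r by (simp add: nn_integral_quantile_mean)
    also have "\<dots> = (\<integral>\<^sup>+ u. ennreal \<bar>real (nb_quantile r x u) - real (nb_quantile r x' u)\<bar> + ennreal (real (nb_quantile r x u)) \<partial>U01)"
    proof (intro nn_integral_cong)
      fix u
      have "real (nb_quantile r x u) \<le> real (nb_quantile r x' u)" using nb_quantile_mono[OF r x] by simp
      then show "ennreal (real (nb_quantile r x' u)) =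
          ennreal \<bar>real (nb_quantile r x u) - real (nb_quantile r x' u)\<bar> + ennreal (real (nb_quantile r x u))"
        by (subst ennreal_plus[symmetric]) auto
    qed
    also have "\<dots> = (\<integral>\<^sup>+ u. ennreal \<bar>real (nb_quantile r x u) - real (nb_quantile r x' u)\<bar> \<partial>U01) + ennreal (r * x)"
      using x r by (subst nn_integral_add) (auto simp: nn_integral_quantile_mean)
    finally have e: "ennreal (r * x') = (\<integral>\<^sup>+ u. ennreal \<bar>real (nb_quantile r x u) - real (nb_quantile r x' u)\<bar> \<partial>U01) + ennreal (r * x)" .
    have "(\<integral>\<^sup>+ u. ennreal \<bar>real (nb_quantile r x u) - real (nb_quantile r x' u)\<bar> \<partial>U01) = ennreal (r * x') - ennreal (r * x)"
      unfolding e by simp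
    also have "\<dots> = ennreal (r * \<bar>x - x'\<bar>)" using x r by (subst ennreal_minus) (auto simp: algebra_simps)
    finally show ?thesis .
  qed
  show ?thesis
  proof (cases "x \<le> x'")
    case True then show ?thesis using *[of x x'] x by simp
  next
    case False then show ?thesis using *[of x' x] x by (simp add: abs_minus_commute)
  qed
qed

section \<open>The recursion for \<open>X\<close>\<close>

abbreviation "om (\<theta>::param) \<equiv> fst \<theta>"
abbreviation "ca (\<theta>::param) \<equiv> fst (snd \<theta>)"
abbreviation "cb (\<theta>::param) \<equiv> fst (snd (snd \<theta>))"
abbreviation "cr (\<theta>::param) \<equiv> snd (snd (snd \<theta>))"

lemma garch_step_eq:
  "garch_step p q \<theta> x u k =
    om \<theta> + (\<Sum>i=1..p. ca \<theta> i * x (k - int i)) + (\<Sum>i=1..q. cb \<theta> i * real (u (k - int i)))"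
  by (cases \<theta>) (simp add: garch_step_def)

lemma nbin_pmf_nb: "0 < cr \<theta> \<Longrightarrow> nbin_pmf \<theta> x y = nb (cr \<theta>) x y"
  by (cases \<theta>) (simp add: nbin_pmf_eq_nb)

text \<open>Paths are prescribed on a whole half-line up to \<open>m\<close>, so there are
  infinitely many base cases, and the step may look back by arbitrary lags.\<close>

lemma int_induct_from [case_names base step]:
  fixes m k :: int
  assumes base: "\<And>k. k \<le> m \<Longrightarrow> P k" and step: "\<And>k. m < k \<Longrightarrow> (\<And>j. j < k \<Longrightarrow> P j) \<Longrightarrow> P k"
  shows "P k"
proof (induction "nat (k - m)" arbitrary: k rule: less_induct)
  case less
  show ?case
  proof (cases "k \<le> m")
    case False
    have all: "P j" if "j < k" for j
    proof (cases "j \<le> m")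
      case False
      then show ?thesis using that by (intro less) auto
    qed (rule base)
    show ?thesis by (rule step) (use False all in auto)
  qed (rule base)
qed

text \<open>
  \<open>Yf j x\<close> is the value of \<open>Y\<^sub>j\<close> when \<open>X\<^sub>j = x\<close>. Observed paths use a \<open>Yf\<close> that ignores \<open>x\<close>, paths driven
  by uniform noise one that applies the quantile function.
\<close>

function path_X :: "nat \<Rightarrow> nat \<Rightarrow> param \<Rightarrow> (int \<Rightarrow> real) \<Rightarrow> (int \<Rightarrow> real \<Rightarrow> nat) \<Rightarrow> int \<Rightarrow> int \<Rightarrow> real" where
  "path_X p q \<theta> x0 Yf m k = (if k \<le> m then x0 k else
     om \<theta> + (\<Sum>i=1..p. ca \<theta> i * path_X p q \<theta> x0 Yf m (k - int i))
       + (\<Sum>i=1..q. cb \<theta> i * real (Yf (k - int i) (path_X p q \<theta> x0 Yf m (k - int i)))))"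
  by pat_completeness auto
termination
  by (relation "Wellfounded.measure (\<lambda>(p, q, \<theta>, x0, Yf, m, k). nat (k - m))") auto

declare path_X.simps [simp del]

lemma path_X_init: "k \<le> m \<Longrightarrow> path_X p q \<theta> x0 Yf m k = x0 k"
  by (subst path_X.simps) simp

lemma path_X_step: "m < k \<Longrightarrow> path_X p q \<theta> x0 Yf m k =
  garch_step p q \<theta> (path_X p q \<theta> x0 Yf m) (\<lambda>j. Yf j (path_X p q \<theta> x0 Yf m j)) k"
  by (subst path_X.simps) (simp add: garch_step_eq)

lemma cond_X_eq_path_X: "cond_X p q \<theta> x0 u k = path_X p q \<theta> x0 (\<lambda>j _. u j) 0 k"
proof (induction k rule: int_induct_from[where m = 0])
  case (base k)
  then show ?case by (simp add: cond_X.simps path_X_init)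
next
  case (step k)
  then show ?case
    by (subst cond_X.simps, subst path_X_step)
       (auto simp: garch_step_eq intro!: sum.cong)
qed

lemma path_X_shift:
  "path_X p q \<theta> (\<lambda>j. x0 (j + h)) (\<lambda>j. Yf (j + h)) m k = path_X p q \<theta> x0 Yf (m + h) (k + h)"
proof (induction k rule: int_induct_from[where m = m])
  case (base k)
  then show ?case by (simp add: path_X_init)
next
  case (step k)
  then show ?case
    by (auto simp: path_X_step garch_step_eq algebra_simps intro!: sum.cong)
qed

lemma path_X_cong:
  assumes "\<And>j. j \<le> m \<Longrightarrow> x0 j = x0' j" "\<And>j x. j < k \<Longrightarrow> Yf j x = Yf' j x"
  shows "path_X p q \<theta> x0 Yf m k = path_X p q \<theta> x0' Yf' m k"
  using assms(2)
proof (induction k rule: int_induct_from[where m = m])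
  case (base k)
  then show ?case using assms by (simp add: path_X_init)
next
  case (step k)
  have "path_X p q \<theta> x0 Yf m (k - int i) = path_X p q \<theta> x0' Yf' m (k - int i)" if "1 \<le> i" for i
    using that step.prems by (intro step.IH) auto
  then show ?case using step
    by (auto simp: path_X_step garch_step_eq intro!: sum.cong)
qed

lemma path_X_measurable:
  assumes x0: "\<And>j. j \<le> m \<Longrightarrow> (\<lambda>w. x0 w j) \<in> borel_measurable M"
    and Yf: "\<And>j f. j < k \<Longrightarrow> f \<in> borel_measurable M \<Longrightarrow> (\<lambda>w. Yf w j (f w)) \<in> measurable M (count_space UNIV)"
  shows "(\<lambda>w. path_X p q \<theta> (x0 w) (Yf w) m k) \<in> borel_measurable M"
  using assms
proof (induction k rule: int_induct_from[where m = m])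
  case (base k)
  then show ?case by (simp add: path_X_init)
next
  case (step k)
  have X [measurable]: "(\<lambda>w. path_X p q \<theta> (x0 w) (Yf w) m (k - int i)) \<in> borel_measurable M" if "1 \<le> i" for i
    using that step.prems by (intro step.IH) auto
  have [measurable]: "(\<lambda>w. Yf w (k - int i) (path_X p q \<theta> (x0 w) (Yf w) m (k - int i))) \<in> measurable M (count_space UNIV)"
    if "1 \<le> i" for i
    using that X by (intro step.prems(2)) auto
  show ?case using step.hyps
    by (simp add: path_X_step garch_step_eq)
qed

text \<open>Where the supremum is infinite, \<open>enn2real\<close> gives the junk value \<open>0\<close>.\<close>

definition lim_X :: "nat \<Rightarrow> nat \<Rightarrow> param \<Rightarrow> (int \<Rightarrow> real \<Rightarrow> nat) \<Rightarrow> int \<Rightarrow> real" where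
  "lim_X p q \<theta> Yf k = enn2real (SUP m::int. ennreal (path_X p q \<theta> (\<lambda>_. 0) Yf m k))"

lemma lim_X_nonneg: "0 \<le> lim_X p q \<theta> Yf k"
  by (simp add: lim_X_def)

text \<open>The supremum in \<open>lim_X\<close> ranges over all integer starting times, so a time
  shift only permutes them.\<close>

lemma lim_X_shift: "lim_X p q \<theta> (\<lambda>j. Yf (j + h)) k = lim_X p q \<theta> Yf (k + h)"
proof -
  define F where "F m = ennreal (path_X p q \<theta> (\<lambda>_. 0) Yf m (k + h))" for m
  have "range (\<lambda>m. ennreal (path_X p q \<theta> (\<lambda>_. 0) (\<lambda>j. Yf (j + h)) m k)) = range (\<lambda>m. F (m + h))"
    using path_X_shift[of p q \<theta> "\<lambda>_. 0" h Yf] by (simp add: F_def)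
  also have "\<dots> = F ` range (\<lambda>m. m + h)" by (simp only: image_image)
  also have "range (\<lambda>m::int. m + h) = UNIV" by (rule surjI[of _ "\<lambda>m. m - h"]) simp
  finally show ?thesis unfolding lim_X_def F_def by simp
qed

lemma lim_X_cong: "(\<And>j x. j < k \<Longrightarrow> Yf j x = Yf' j x) \<Longrightarrow> lim_X p q \<theta> Yf k = lim_X p q \<theta> Yf' k"
  unfolding lim_X_def by (subst path_X_cong[of _ "\<lambda>_. 0" "\<lambda>_. 0" k Yf Yf']) auto

lemma lim_X_measurable:
  assumes "\<And>j f. j < k \<Longrightarrow> f \<in> borel_measurable M \<Longrightarrow> (\<lambda>w. Yf w j (f w)) \<in> measurable M (count_space UNIV)"
  shows "(\<lambda>w. lim_X p q \<theta> (Yf w) k) \<in> borel_measurable M"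
proof -
  have [measurable]: "(\<lambda>w. path_X p q \<theta> (\<lambda>_. 0) (Yf w) m k) \<in> borel_measurable M" for m
    using assms by (intro path_X_measurable) auto
  show ?thesis unfolding lim_X_def by measurable
qed

text \<open>
  The constants \<open>\<rho>\<close> and \<open>\<eta>\<close> will be chosen uniformly over the compact parameter set; dividing by \<open>\<rho>^i\<close> leaves
  room for the geometric weights of all estimates below.
\<close>

locale garch_orders =
  fixes p q :: nat and \<rho> \<eta> :: real
  assumes p1: "1 \<le> p" and q1: "1 \<le> q" and rho: "0 < \<rho>" "\<rho> < 1" and eta: "0 < \<eta>" "\<eta> < 1"
begin

definition adm :: "param \<Rightarrow> bool" where
  "adm \<theta> \<longleftrightarrow> 0 < om \<theta> \<and> (\<forall>i\<in>{1..p}. 0 \<le> ca \<theta> i) \<and> (\<forall>i\<in>{1..q}. 0 \<le> cb \<theta> i) \<and> 0 < cr \<theta> \<and>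
    (\<Sum>i=1..p. ca \<theta> i / \<rho> ^ i) + cr \<theta> * (\<Sum>i=1..q. cb \<theta> i / \<rho> ^ i) \<le> 1 - \<eta>"

lemma admD:
  assumes "adm \<theta>"
  shows "0 < om \<theta>" "0 < cr \<theta>" "\<And>i. 1 \<le> i \<Longrightarrow> i \<le> p \<Longrightarrow> 0 \<le> ca \<theta> i"
    "\<And>i. 1 \<le> i \<Longrightarrow> i \<le> q \<Longrightarrow> 0 \<le> cb \<theta> i"
  using assms by (auto simp: adm_def)

lemma adm_sum_a: assumes "adm \<theta>" shows "(\<Sum>i=1..p. ca \<theta> i / \<rho> ^ i) \<le> 1 - \<eta>"
proof -
  have "0 \<le> cr \<theta> * (\<Sum>i=1..q. cb \<theta> i / \<rho> ^ i)"
    using assms rho by (auto simp: adm_def intro!: mult_nonneg_nonneg sum_nonneg divide_nonneg_nonneg)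
  then show ?thesis using assms by (simp add: adm_def)
qed

lemma slow_growth:
  fixes E :: "int \<Rightarrow> real"
  assumes E: "\<And>k. E (k - 1) \<le> E k / \<rho>"
  shows "E (k - int i) \<le> E k / \<rho> ^ i"
proof (induction i)
  case (Suc i)
  have "E (k - int (Suc i)) \<le> E (k - int i) / \<rho>" using E[of "k - int i"] by (simp add: algebra_simps)
  also have "\<dots> \<le> E k / \<rho> ^ i / \<rho>" using Suc rho by (intro divide_right_mono) auto
  finally show ?case by (simp add: mult.commute)
qed simp

text \<open>
  Comparison principle: a recursion with total weight below one tracks its forcing term, provided the
  forcing decays at most geometrically backwards in time.
\<close>

lemma dominate:
  fixes d E :: "int \<Rightarrow> real" and c e :: "nat \<Rightarrow> real"
  assumes E: "\<And>k. E (k - 1) \<le> E k / \<rho>" and E0: "\<And>k. 0 \<le> E k"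
    and c: "\<And>i. 1 \<le> i \<Longrightarrow> i \<le> L \<Longrightarrow> 0 \<le> c i" and csum: "(\<Sum>i=1..L. c i / \<rho> ^ i) \<le> 1 - \<eta>"
    and init: "\<And>k. m - int L < k \<Longrightarrow> k \<le> m \<Longrightarrow> d k \<le> E k / \<eta>"
    and step: "\<And>k. m < k \<Longrightarrow> d k \<le> (\<Sum>i=1..L. c i * d (k - int i)) + E k"
    and k: "m - int L < k"
  shows "d k \<le> E k / \<eta>"
  using k
proof (induction k rule: int_induct_from[where m = m])
  case (base k)
  then show ?case by (intro init) auto
next
  case (step k)
  have "d k \<le> (\<Sum>i=1..L. c i * d (k - int i)) + E k" using step by (intro assms(6)) auto
  also have "(\<Sum>i=1..L. c i * d (k - int i)) \<le> (\<Sum>i=1..L. c i * (E k / \<rho> ^ i / \<eta>))"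
  proof (intro sum_mono mult_left_mono c)
    fix i assume i: "i \<in> {1..L}"
    have "d (k - int i) \<le> E (k - int i) / \<eta>" using i step by (intro step.IH) auto
    also have "\<dots> \<le> E k / \<rho> ^ i / \<eta>" using slow_growth[of E, OF E] eta by (intro divide_right_mono) auto
    finally show "d (k - int i) \<le> E k / \<rho> ^ i / \<eta>" .
  qed auto
  also have "\<dots> = (\<Sum>i=1..L. c i / \<rho> ^ i) * (E k / \<eta>)" by (simp add: sum_distrib_right sum_divide_distrib)
  \<comment> \<open>The bound reproduces itself because
    \<open>(1 - \<eta>) / \<eta> + 1 = 1 / \<eta>\<close>.\<close>
  also have "\<dots> \<le> (1 - \<eta>) * (E k / \<eta>)" using csum E0 eta by (intro mult_right_mono) auto
  finally show ?case using eta by (simp add: field_simps)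
qed

lemma dominate_homogeneous:
  fixes d :: "int \<Rightarrow> real"
  assumes c: "\<And>i. 1 \<le> i \<Longrightarrow> i \<le> L \<Longrightarrow> 0 \<le> c i" and csum: "(\<Sum>i=1..L. c i / \<rho> ^ i) \<le> 1 - \<eta>"
    and M: "0 \<le> M" and init: "\<And>k. m - int L < k \<Longrightarrow> k \<le> m \<Longrightarrow> d k \<le> M * \<rho> powi (k - m)"
    and step: "\<And>k. m < k \<Longrightarrow> d k \<le> (\<Sum>i=1..L. c i * d (k - int i))"
    and k: "m - int L < k"
  shows "d k \<le> M * \<rho> powi (k - m)"
proof -
  \<comment> \<open>An artificial forcing of \<open>\<eta>\<close> times the target is added, since
    the comparison principle returns the forcing divided by \<open>\<eta>\<close>.\<close>
  have "d k \<le> \<eta> * M * \<rho> powi (k - m) / \<eta>"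
  proof (rule dominate[OF _ _ c csum _ _ k])
    show "\<eta> * M * \<rho> powi (k - 1 - m) \<le> \<eta> * M * \<rho> powi (k - m) / \<rho>" for k
    proof -
      have "\<rho> powi (k - 1 - m) = \<rho> powi (k - m) / \<rho>"
        using rho power_int_diff[of \<rho> "k - m" 1] by (simp add: algebra_simps)
      then show ?thesis by simp
    qed
    show "0 \<le> \<eta> * M * \<rho> powi (k - m)" for k using M eta rho by auto
    show "d k \<le> (\<Sum>i=1..L. c i * d (k - int i)) + \<eta> * M * \<rho> powi (k - m)" if "m < k" for k
      using step[OF that] M eta rho by (intro add_increasing2) auto
  qed (use init eta in auto)
  then show ?thesis using eta by simp
qed

lemma powi_init: "j \<le> 0 \<Longrightarrow> 1 \<le> \<rho> powi j"
  using rho by (simp add: power_int_def one_le_inverse_iff power_le_one flip: power_inverse)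

section \<open>Monotone limits of paths started from zero\<close>

lemma path_X_nonneg:
  assumes \<theta>: "adm \<theta>" and x0: "\<And>j. 0 \<le> x0 j"
  shows "0 \<le> path_X p q \<theta> x0 Yf m k"
proof (induction k rule: int_induct_from[where m = m])
  case (base k)
  then show ?case by (simp add: path_X_init x0)
next
  case (step k)
  then show ?case using admD[OF \<theta>] less_imp_le[OF admD(1)[OF \<theta>]]
    by (auto simp: path_X_step garch_step_eq intro!: add_nonneg_nonneg sum_nonneg mult_nonneg_nonneg)
qed

lemma garch_step_ge:
  assumes "adm \<theta>" "\<And>j. 0 \<le> x j" shows "om \<theta> \<le> garch_step p q \<theta> x u k"
  using admD[OF assms(1)] assms(2)
  by (auto simp: garch_step_eq add.assoc intro!: add_nonneg_nonneg sum_nonneg)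

lemma garch_step_mono:
  assumes "adm \<theta>" "\<And>j. j < k \<Longrightarrow> x j \<le> x' j" "\<And>j. j < k \<Longrightarrow> u j \<le> u' j"
  shows "garch_step p q \<theta> x u k \<le> garch_step p q \<theta> x' u' k"
  using admD[OF assms(1)] assms(2,3)
  by (auto simp: garch_step_eq intro!: add_mono sum_mono mult_left_mono)

text \<open>What a response needs in order to pass through a monotone limit of paths: monotonicity,
  and left continuity in the form suited to integer values, namely eventual equality.\<close>

definition mono_resp :: "(int \<Rightarrow> real \<Rightarrow> nat) \<Rightarrow> bool" where
  "mono_resp Yf \<longleftrightarrow> (\<forall>j x x'. 0 \<le> x \<longrightarrow> x \<le> x' \<longrightarrow> Yf j x \<le> Yf j x') \<and>
    (\<forall>j f x. (\<forall>n. 0 \<le> f n \<and> f n \<le> x) \<longrightarrow> f \<longlonglongrightarrow> x \<longrightarrow> (\<forall>\<^sub>F n in sequentially. Yf j (f n) = Yf j x))"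

lemma mono_resp_const: "mono_resp (\<lambda>j _. y j)"
  by (simp add: mono_resp_def)

lemma mono_resp_quantile: "0 < r \<Longrightarrow> mono_resp (\<lambda>j x. nb_quantile r x (u j))"
  using nb_quantile_mono nb_quantile_left_continuous by (auto simp: mono_resp_def)

text \<open>A path started from zero earlier already has nonnegative values where the later one is
  still zero, and the recursion preserves this order.\<close>

lemma path_X_antimono:
  assumes \<theta>: "adm \<theta>" and Yf: "mono_resp Yf" and m: "m' \<le> m"
  shows "path_X p q \<theta> (\<lambda>_. 0) Yf m k \<le> path_X p q \<theta> (\<lambda>_. 0) Yf m' k"
proof (induction k rule: int_induct_from[where m = m])
  case (base k)
  then show ?case by (simp add: path_X_init path_X_nonneg[OF \<theta>])
next
  case (step k)
  have "path_X p q \<theta> (\<lambda>_. 0) Yf m k =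
      garch_step p q \<theta> (path_X p q \<theta> (\<lambda>_. 0) Yf m) (\<lambda>j. Yf j (path_X p q \<theta> (\<lambda>_. 0) Yf m j)) k"
    using step by (simp add: path_X_step)
  also have "\<dots> \<le> garch_step p q \<theta> (path_X p q \<theta> (\<lambda>_. 0) Yf m') (\<lambda>j. Yf j (path_X p q \<theta> (\<lambda>_. 0) Yf m' j)) k"
    using step Yf path_X_nonneg[OF \<theta>] by (intro garch_step_mono[OF \<theta>]) (auto simp: mono_resp_def)
  also have "\<dots> = path_X p q \<theta> (\<lambda>_. 0) Yf m' k" using step m by (simp add: path_X_step)
  finally show ?case .
qed

text \<open>Starting times \<open>- n\<close> give a countable increasing sequence, as monotone
  convergence requires.\<close>

lemma lim_X_ennreal_eq:
  assumes \<theta>: "adm \<theta>" and Yf: "mono_resp Yf"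
  shows "(SUP m::int. ennreal (path_X p q \<theta> (\<lambda>_. 0) Yf m k)) = (SUP n::nat. ennreal (path_X p q \<theta> (\<lambda>_. 0) Yf (- int n) k))"
proof (rule antisym)
  show "(SUP m::int. ennreal (path_X p q \<theta> (\<lambda>_. 0) Yf m k)) \<le> (SUP n::nat. ennreal (path_X p q \<theta> (\<lambda>_. 0) Yf (- int n) k))"
  proof (rule SUP_least)
    fix m :: int
    have "ennreal (path_X p q \<theta> (\<lambda>_. 0) Yf m k) \<le> ennreal (path_X p q \<theta> (\<lambda>_. 0) Yf (- int (nat (- m))) k)"
      by (intro ennreal_leI path_X_antimono[OF \<theta> Yf]) auto
    then show "ennreal (path_X p q \<theta> (\<lambda>_. 0) Yf m k) \<le> (SUP n::nat. ennreal (path_X p q \<theta> (\<lambda>_. 0) Yf (- int n) k))"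
      by (rule SUP_upper2[rotated]) simp
  qed
  show "(SUP n::nat. ennreal (path_X p q \<theta> (\<lambda>_. 0) Yf (- int n) k)) \<le> (SUP m::int. ennreal (path_X p q \<theta> (\<lambda>_. 0) Yf m k))"
    by (rule SUP_least) (rule SUP_upper, simp)
qed

lemma lim_X_limit:
  assumes \<theta>: "adm \<theta>" and Yf: "mono_resp Yf"
    and fin: "(SUP m::int. ennreal (path_X p q \<theta> (\<lambda>_. 0) Yf m k)) < \<infinity>"
  shows "(\<lambda>n. path_X p q \<theta> (\<lambda>_. 0) Yf (- int n) k) \<longlonglongrightarrow> lim_X p q \<theta> Yf k"
    and "path_X p q \<theta> (\<lambda>_. 0) Yf m k \<le> lim_X p q \<theta> Yf k"
proof -
  let ?f = "\<lambda>n. path_X p q \<theta> (\<lambda>_. 0) Yf (- int n) k"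
  have e: "ennreal (lim_X p q \<theta> Yf k) = (SUP m::int. ennreal (path_X p q \<theta> (\<lambda>_. 0) Yf m k))"
    unfolding lim_X_def using fin by (intro ennreal_enn2real) auto
  have "(\<lambda>n. ennreal (?f n)) \<longlonglongrightarrow> (SUP n. ennreal (?f n))"
    by (intro LIMSEQ_SUP) (auto simp: incseq_def intro!: ennreal_leI path_X_antimono[OF \<theta> Yf])
  then have "(\<lambda>n. ennreal (?f n)) \<longlonglongrightarrow> ennreal (lim_X p q \<theta> Yf k)"
    using e lim_X_ennreal_eq[OF \<theta> Yf] by simp
  then show "?f \<longlonglongrightarrow> lim_X p q \<theta> Yf k"
    by (rule tendsto_ennrealD) (auto simp: lim_X_nonneg path_X_nonneg[OF \<theta>])
  have "ennreal (path_X p q \<theta> (\<lambda>_. 0) Yf m k) \<le> ennreal (lim_X p q \<theta> Yf k)"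
    unfolding e by (rule SUP_upper) simp
  then show "path_X p q \<theta> (\<lambda>_. 0) Yf m k \<le> lim_X p q \<theta> Yf k" by (simp add: lim_X_nonneg)
qed

text \<open>The approximants approach their limit from below, so left continuity of the response
  lets the recursion pass to the limit.\<close>

lemma lim_X_recursion:
  assumes \<theta>: "adm \<theta>" and Yf: "mono_resp Yf"
    and fin: "\<And>k. (SUP m::int. ennreal (path_X p q \<theta> (\<lambda>_. 0) Yf m k)) < \<infinity>"
  shows "lim_X p q \<theta> Yf k = garch_step p q \<theta> (lim_X p q \<theta> Yf) (\<lambda>j. Yf j (lim_X p q \<theta> Yf j)) k"
proof -
  let ?f = "\<lambda>n. path_X p q \<theta> (\<lambda>_. 0) Yf (- int n)"
  have l: "(\<lambda>n. ?f n j) \<longlonglongrightarrow> lim_X p q \<theta> Yf j" for j by (rule lim_X_limit[OF \<theta> Yf fin])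
  have "(\<lambda>n. garch_step p q \<theta> (?f n) (\<lambda>j. Yf j (?f n j)) k) \<longlonglongrightarrow>
      garch_step p q \<theta> (lim_X p q \<theta> Yf) (\<lambda>j. Yf j (lim_X p q \<theta> Yf j)) k"
    unfolding garch_step_eq
  proof (intro tendsto_intros l)
    fix i
    have "\<forall>\<^sub>F n in sequentially. Yf (k - int i) (?f n (k - int i)) = Yf (k - int i) (lim_X p q \<theta> Yf (k - int i))"
      using Yf l lim_X_limit(2)[OF \<theta> Yf fin] path_X_nonneg[OF \<theta>] unfolding mono_resp_def by auto
    then show "(\<lambda>n. real (Yf (k - int i) (?f n (k - int i)))) \<longlonglongrightarrow> real (Yf (k - int i) (lim_X p q \<theta> Yf (k - int i)))"
      by (intro tendsto_eventually) (auto elim: eventually_mono)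
  qed
  moreover have "\<forall>\<^sub>F n in sequentially. garch_step p q \<theta> (?f n) (\<lambda>j. Yf j (?f n j)) k = ?f n k"
    using eventually_gt_at_top[of "nat (- k)"] by eventually_elim (subst path_X_step, auto)
  ultimately have "(\<lambda>n. ?f n k) \<longlonglongrightarrow> garch_step p q \<theta> (lim_X p q \<theta> Yf) (\<lambda>j. Yf j (lim_X p q \<theta> Yf j)) k"
    by (rule Lim_transform_eventually)
  with l show ?thesis by (rule LIMSEQ_unique)
qed

lemma abs_garch_step_diff_le:
  assumes "adm \<theta>"
  shows "\<bar>garch_step p q \<theta> x u k - garch_step p q \<theta> x' u' k\<bar> \<le>
    (\<Sum>i=1..p. ca \<theta> i * \<bar>x (k - int i) - x' (k - int i)\<bar>) + (\<Sum>i=1..q. cb \<theta> i * \<bar>real (u (k - int i)) - real (u' (k - int i))\<bar>)"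
proof -
  let ?A = "\<Sum>i=1..p. ca \<theta> i * (x (k - int i) - x' (k - int i))"
  let ?B = "\<Sum>i=1..q. cb \<theta> i * (real (u (k - int i)) - real (u' (k - int i)))"
  have "garch_step p q \<theta> x u k - garch_step p q \<theta> x' u' k = ?A + ?B"
    by (simp add: garch_step_eq sum_subtractf right_diff_distrib)
  moreover have "\<bar>?A\<bar> \<le> (\<Sum>i=1..p. ca \<theta> i * \<bar>x (k - int i) - x' (k - int i)\<bar>)"
    by (rule order_trans[OF sum_abs], rule sum_mono) (use admD[OF assms] in \<open>auto simp: abs_mult\<close>)
  moreover have "\<bar>?B\<bar> \<le> (\<Sum>i=1..q. cb \<theta> i * \<bar>real (u (k - int i)) - real (u' (k - int i))\<bar>)"
    by (rule order_trans[OF sum_abs], rule sum_mono) (use admD[OF assms] in \<open>auto simp: abs_mult\<close>)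
  ultimately show ?thesis by linarith
qed

text \<open>Equal observations cancel the \<open>cb\<close> terms. What remains is a homogeneous
  recursion with weights \<open>ca\<close>, which forgets its initial values geometrically.\<close>

lemma same_obs_merge:
  assumes \<theta>: "adm \<theta>"
    and x: "\<And>k. m < k \<Longrightarrow> x k = garch_step p q \<theta> x u k" and x': "\<And>k. m < k \<Longrightarrow> x' k = garch_step p q \<theta> x' u' k"
    and u: "\<And>k. m - int q < k \<Longrightarrow> u k = u' k"
    and M: "\<And>j. m - int p < j \<Longrightarrow> j \<le> m \<Longrightarrow> \<bar>x j - x' j\<bar> \<le> M" "0 \<le> M"
    and k: "m - int p < k"
  shows "\<bar>x k - x' k\<bar> \<le> M * \<rho> powi (k - m)"
proof (rule dominate_homogeneous[where d = "\<lambda>k. \<bar>x k - x' k\<bar>", OF _ adm_sum_a[OF \<theta>] M(2) _ _ k])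
  show "\<bar>x k - x' k\<bar> \<le> M * \<rho> powi (k - m)" if "m - int p < k" "k \<le> m" for k
    using M(1)[OF that] mult_left_mono[OF powi_init[of "k - m"] M(2)] that by simp
  show "\<bar>x k - x' k\<bar> \<le> (\<Sum>i = 1..p. ca \<theta> i * \<bar>x (k - int i) - x' (k - int i)\<bar>)" if "m < k" for k
    using abs_garch_step_diff_le[OF \<theta>, of x u k x' u'] u x[OF that] x'[OF that] that by simp
qed (use admD[OF \<theta>] in auto)

end

section \<open>A law of large numbers for functions of independent noise\<close>

locale measure_preserving = prob_space M for M :: "'w measure" +
  fixes T :: "'w \<Rightarrow> 'w"
  assumes T_meas [measurable]: "T \<in> measurable M M" and T_inv: "distr M M T = M"
begin

lemma Tn_meas [measurable]: "(T ^^ n) \<in> measurable M M"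
  by (induction n) (auto intro: measurable_comp[OF _ T_meas])

lemma comp_Tn_meas: "f \<in> measurable M N \<Longrightarrow> (\<lambda>w. f ((T ^^ n) w)) \<in> measurable M N"
  by (rule measurable_compose[OF Tn_meas])

lemma Tn_inv: "distr M M (T ^^ n) = M"
proof (induction n)
  case (Suc n)
  have "distr M M (T ^^ Suc n) = distr (distr M M (T ^^ n)) M T" by (subst distr_distr) auto
  then show ?case unfolding Suc T_inv .
qed (simp add: distr_id2[unfolded id_def])

lemma integral_Tn: "f \<in> borel_measurable M \<Longrightarrow> (\<integral>w. f ((T ^^ n) w) \<partial>M) = (\<integral>w. (f w :: real) \<partial>M)"
  using integral_distr[of "T ^^ n" M M f] by (simp add: Tn_inv)

lemma integrable_Tn: "integrable M (f :: _ \<Rightarrow> real) \<Longrightarrow> integrable M (\<lambda>w. f ((T ^^ n) w))"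
  using integrable_distr_eq[of "T ^^ n" M M f] by (simp add: Tn_inv)

definition avg :: "('w \<Rightarrow> real) \<Rightarrow> nat \<Rightarrow> 'w \<Rightarrow> real" where
  "avg f n w = (\<Sum>k<n. f ((T ^^ k) w)) / real n"

lemma avg_measurable [measurable]: "f \<in> borel_measurable M \<Longrightarrow> avg f n \<in> borel_measurable M"
  unfolding avg_def[abs_def]
  by (rule borel_measurable_divide, rule borel_measurable_sum, rule comp_Tn_meas) auto

text \<open>The maximum of 0 and the partial sums of length at most \<open>n\<close> along the
  orbit, given by the recursion that Garsia's argument exploits.\<close>

primrec max_sum :: "('w \<Rightarrow> real) \<Rightarrow> nat \<Rightarrow> 'w \<Rightarrow> real" where
  "max_sum f 0 w = 0"
| "max_sum f (Suc n) w = max 0 (f w + max_sum f n (T w))"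

lemma max_sum_0: "max_sum f 0 = (\<lambda>_. 0)"
  by (rule ext) simp

lemma max_sum_nonneg: "0 \<le> max_sum f n w"
  by (cases n) auto

lemma max_sum_measurable [measurable]: "f \<in> borel_measurable M \<Longrightarrow> max_sum f n \<in> borel_measurable M"
proof (induction n)
  case (Suc n)
  note [measurable] = Suc
  show ?case by simp
qed (simp add: max_sum_0)

lemma max_sum_mono: "max_sum f n w \<le> max_sum f (Suc n) w"
proof (induction n arbitrary: w)
  case (Suc n)
  have "max_sum f n (T w) \<le> max_sum f (Suc n) (T w)" by (rule Suc)
  then show ?case by (subst (1 2) max_sum.simps) (auto simp del: max_sum.simps)
qed simp

lemma max_sum_upper: "j \<le> n \<Longrightarrow> (\<Sum>k<j. f ((T ^^ k) w)) \<le> max_sum f n w"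
proof (induction n arbitrary: j w)
  case (Suc n)
  show ?case
  proof (cases j)
    case (Suc i)
    have "(\<Sum>k<i. f ((T ^^ k) (T w))) \<le> max_sum f n (T w)" using Suc Suc.prems by (intro Suc.IH) auto
    moreover have "(\<Sum>k<j. f ((T ^^ k) w)) = f w + (\<Sum>k<i. f ((T ^^ k) (T w)))"
      unfolding Suc by (subst sum.lessThan_Suc_shift) (simp add: funpow_swap1)
    ultimately show ?thesis by simp
  qed simp
qed simp

lemma max_sum_integrable: "integrable M f \<Longrightarrow> integrable M (max_sum f n)"
proof (induction n)
  case (Suc n)
  then have "integrable M (\<lambda>w. f w + max_sum f n (T w))"
    using integrable_Tn[of "max_sum f n" 1] by (intro Bochner_Integration.integrable_add) auto
  then show ?case by (simp add: integrable_max)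
qed (simp add: max_sum_0)

text \<open>Hopf's maximal ergodic lemma, in Garsia's formulation.\<close>

lemma maximal_ergodic:
  assumes f: "integrable M f"
  shows "0 \<le> (\<integral>w. f w * indicator {w \<in> space M. 0 < max_sum f n w} w \<partial>M)"
proof -
  have [measurable]: "f \<in> borel_measurable M" using f by auto
  let ?A = "{w \<in> space M. 0 < max_sum f n w}"
  have i1: "integrable M (max_sum f n)" by (rule max_sum_integrable[OF f])
  have i2: "integrable M (\<lambda>w. max_sum f n (T w))" using integrable_Tn[OF i1, of 1] by simp
  have i3: "integrable M (\<lambda>w. f w * indicator ?A w)"
    using f by (intro integrable_real_mult_indicator) auto
  have "0 = (\<integral>w. max_sum f n w \<partial>M) - (\<integral>w. max_sum f n (T w) \<partial>M)"
    using integral_Tn[of "max_sum f n" 1] by simp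
  also have "\<dots> = (\<integral>w. max_sum f n w - max_sum f n (T w) \<partial>M)" using i1 i2 by simp
  also have "\<dots> \<le> (\<integral>w. f w * indicator ?A w \<partial>M)"
  proof (rule integral_mono)
    fix w assume w: "w \<in> space M"
    show "max_sum f n w - max_sum f n (T w) \<le> f w * indicator ?A w"
    proof (cases "0 < max_sum f n w")
      case True
      have "max_sum f n w \<le> max_sum f (Suc n) w" by (rule max_sum_mono)
      then have "max_sum f n w \<le> f w + max_sum f n (T w)" using True by auto
      then show ?thesis using True w by simp
    next
      case False
      then show ?thesis using max_sum_nonneg[of f n "T w"] by simp
    qed
  qed (use i1 i2 i3 in auto)
  finally show ?thesis .
qed

text \<open>An average exceeds \<open>c\<close> exactly when the corresponding partial sum of
  \<open>f - c\<close> is positive. On the set where this happens the maximal ergodic lemma compares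
  \<open>c\<close> times the probability with the integral of \<open>f\<close>.\<close>

lemma maximal_inequality:
  assumes f: "integrable M f" and nn: "\<And>w. 0 \<le> f w" and c: "0 < c"
  shows "emeasure M {w \<in> space M. \<exists>n\<ge>1. c < avg f n w} \<le> ennreal ((\<integral>w. f w \<partial>M) / c)"
proof -
  have [measurable]: "f \<in> borel_measurable M" using f by auto
  let ?g = "\<lambda>w. f w - c"
  let ?A = "\<lambda>n. {w \<in> space M. 0 < max_sum ?g n w}"
  have g: "integrable M ?g" using f by auto
  have bound: "emeasure M (?A n) \<le> ennreal ((\<integral>w. f w \<partial>M) / c)" for n
  proof -
    have "0 \<le> (\<integral>w. ?g w * indicator (?A n) w \<partial>M)" by (rule maximal_ergodic[OF g])
    also have "\<dots> = (\<integral>w. f w * indicator (?A n) w - c * indicator (?A n) w \<partial>M)"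
      by (simp add: left_diff_distrib)
    also have "\<dots> = (\<integral>w. f w * indicator (?A n) w \<partial>M) - (\<integral>w. c * indicator (?A n) w \<partial>M)"
      using f by (intro Bochner_Integration.integral_diff integrable_real_mult_indicator) (auto simp: less_top[symmetric])
    also have "(\<integral>w. c * indicator (?A n) w \<partial>M) = c * measure M (?A n)" by simp
    also have "(\<integral>w. f w * indicator (?A n) w \<partial>M) \<le> (\<integral>w. f w \<partial>M)"
      using f nn by (intro integral_mono integrable_real_mult_indicator) (auto simp: indicator_def)
    finally have "measure M (?A n) \<le> (\<integral>w. f w \<partial>M) / c" using c by (simp add: field_simps)
    then show ?thesis unfolding emeasure_eq_measure by (rule ennreal_leI)
  qed
  have "{w \<in> space M. \<exists>n\<ge>1. c < avg f n w} \<subseteq> (\<Union>n. ?A n)"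
  proof safe
    fix w and n :: nat assume w: "w \<in> space M" "1 \<le> n" "c < avg f n w"
    then have "0 < (\<Sum>k<n. ?g ((T ^^ k) w))" by (simp add: avg_def sum_subtractf field_simps)
    also have "\<dots> \<le> max_sum ?g n w" by (rule max_sum_upper) simp
    finally show "w \<in> (\<Union>n. ?A n)" using w by auto
  qed
  then have "emeasure M {w \<in> space M. \<exists>n\<ge>1. c < avg f n w} \<le> emeasure M (\<Union>n. ?A n)"
    by (intro emeasure_mono) auto
  also have "\<dots> = (SUP n. emeasure M (?A n))"
  proof (intro SUP_emeasure_incseq[symmetric])
    show "incseq ?A"
      by (intro incseq_SucI) (auto intro: less_le_trans[OF _ max_sum_mono] simp del: max_sum.simps)
  qed auto
  also have "\<dots> \<le> ennreal ((\<integral>w. f w \<partial>M) / c)" by (rule SUP_least) (rule bound)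
  finally show ?thesis .
qed

definition lln :: "('w \<Rightarrow> real) \<Rightarrow> bool" where
  "lln f \<longleftrightarrow> integrable M f \<and> (AE w in M. (\<lambda>n. avg f n w) \<longlonglongrightarrow> (\<integral>w. f w \<partial>M))"

lemma avg_linear: "avg (\<lambda>w. a * f w + b * g w) n w = a * avg f n w + b * avg g n w"
  by (simp add: avg_def sum.distrib sum_distrib_left[symmetric] add_divide_distrib)

lemma lln_linear: "lln f \<Longrightarrow> lln g \<Longrightarrow> lln (\<lambda>w. a * f w + b * g w)"
  unfolding lln_def by (auto simp: avg_linear elim!: eventually_elim2 intro!: tendsto_intros)

lemma lln_const: "lln (\<lambda>_. c)"
proof -
  have "(\<lambda>n. avg (\<lambda>_. c) n w) \<longlonglongrightarrow> c" for w
    by (rule Lim_transform_eventually[OF tendsto_const], rule eventually_mono[OF eventually_gt_at_top[of 0]])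
       (simp add: avg_def)
  then show ?thesis by (auto simp: lln_def prob_space)
qed

text \<open>Banach's principle: outside a set controlled by the maximal inequality the averages of
  \<open>f\<close> stay close to those of the approximant \<open>g\<close>, so almost sure
  convergence survives limits in mean.\<close>

lemma lln_L1_closed:
  assumes f: "integrable M f" and g: "\<And>e. 0 < e \<Longrightarrow> \<exists>g. lln g \<and> (\<integral>w. \<bar>f w - g w\<bar> \<partial>M) < e"
  shows "lln f"
proof -
  have [measurable]: "f \<in> borel_measurable M" using f by auto
  let ?I = "\<integral>w. f w \<partial>M"
  \<comment> \<open>The factor 3 pays for the distance between the averages of \<open>f\<close> and
    \<open>g\<close>, the convergence for \<open>g\<close>, and the distance between the two
    means.\<close>
  define B where "B e = {w \<in> space M. \<exists>\<^sub>F n in sequentially. 3 * e \<le> \<bar>avg f n w - ?I\<bar>}" for e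
  have Bm [measurable]: "B e \<in> sets M" for e
    unfolding B_def frequently_sequentially by measurable
  have small: "emeasure M (B e) \<le> ennreal d" if e: "0 < e" and d: "0 < d" for e d
  proof -
    \<comment> \<open>\<open>e\<close> bounds the difference of the means, and \<open>d * e\<close>
      makes the maximal inequality yield \<open>d\<close>.\<close>
    obtain g where g: "lln g" and d1: "(\<integral>w. \<bar>f w - g w\<bar> \<partial>M) < min e (d * e)"
      using assms(2)[of "min e (d * e)"] e d by auto
    have gi: "integrable M g" and lim: "AE w in M. (\<lambda>n. avg g n w) \<longlonglongrightarrow> (\<integral>w. g w \<partial>M)" using g by (auto simp: lln_def)
    have [measurable]: "g \<in> borel_measurable M" using gi by auto
    let ?h = "\<lambda>w. \<bar>f w - g w\<bar>"
    have hi: "integrable M ?h" using f gi by auto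
    have "\<bar>?I - (\<integral>w. g w \<partial>M)\<bar> = \<bar>\<integral>w. f w - g w \<partial>M\<bar>" using f gi by simp
    also have "\<dots> \<le> (\<integral>w. ?h w \<partial>M)" using f gi by (intro integral_abs_bound)
    finally have I: "\<bar>?I - (\<integral>w. g w \<partial>M)\<bar> < e" using d1 by simp
    have avgd: "\<bar>avg f n w - avg g n w\<bar> \<le> avg ?h n w" for n w
      by (auto simp: avg_def sum_subtractf[symmetric] diff_divide_distrib[symmetric] intro!: divide_right_mono sum_abs)
    have "AE w in M. w \<in> B e \<longrightarrow> w \<in> {w \<in> space M. \<exists>n\<ge>1. e < avg ?h n w}"
      using lim
    proof eventually_elim
      case (elim w)
      show ?case
      proof
        assume w: "w \<in> B e"
        have "\<forall>\<^sub>F n in sequentially. \<bar>avg g n w - (\<integral>w. g w \<partial>M)\<bar> < e"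
          using elim e by (auto simp: tendsto_iff dist_real_def)
        then have ev: "\<forall>\<^sub>F n in sequentially. \<bar>avg g n w - (\<integral>w. g w \<partial>M)\<bar> < e \<and> 1 \<le> n"
          using eventually_ge_at_top[of 1] by eventually_elim simp
        have "\<exists>\<^sub>F n in sequentially. 3 * e \<le> \<bar>avg f n w - ?I\<bar>" using w by (simp add: B_def)
        from frequently_ex[OF frequently_rev_mp[OF this eventually_mono[OF ev]]]
        obtain n where n: "1 \<le> n" "3 * e \<le> \<bar>avg f n w - ?I\<bar>" "\<bar>avg g n w - (\<integral>w. g w \<partial>M)\<bar> < e" by blast
        have "e < avg ?h n w" using n(2,3) I avgd[of n w] by linarith
        then show "w \<in> {w \<in> space M. \<exists>n\<ge>1. e < avg ?h n w}" using n w by (auto simp: B_def)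
      qed
    qed
    then have "emeasure M (B e) \<le> emeasure M {w \<in> space M. \<exists>n\<ge>1. e < avg ?h n w}"
      by (intro emeasure_mono_AE) auto
    also have "\<dots> \<le> ennreal ((\<integral>w. ?h w \<partial>M) / e)" using hi e by (intro maximal_inequality) auto
    also have "\<dots> \<le> ennreal d" using d1 e by (intro ennreal_leI) (simp add: field_simps)
    finally show ?thesis .
  qed
  have "emeasure M (B e) = 0" if "0 < e" for e
  proof (rule antisym)
    show "emeasure M (B e) \<le> 0"
      by (rule ennreal_le_epsilon) (use small[OF that] in simp)
  qed simp
  then have "AE w in M. w \<notin> B (1 / real (Suc m))" for m
    by (intro AE_not_in) (auto simp: null_sets_def)
  then have "AE w in M. \<forall>m. w \<notin> B (1 / real (Suc m))" by (subst AE_all_countable) auto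
  moreover have "AE w in M. w \<in> space M" by (rule AE_space)
  ultimately have "AE w in M. (\<lambda>n. avg f n w) \<longlonglongrightarrow> ?I"
  proof eventually_elim
    case (elim w)
    show ?case
    proof (rule tendstoI)
      fix e :: real assume "0 < e"
      then obtain m where m: "1 / real (Suc m) < e / 3" using reals_Archimedean[of "e / 3"] by (auto simp: inverse_eq_divide)
      have "\<forall>\<^sub>F n in sequentially. \<bar>avg f n w - ?I\<bar> < 3 * (1 / real (Suc m))"
        using elim by (auto simp: B_def not_frequently not_le)
      then show "\<forall>\<^sub>F n in sequentially. dist (avg f n w) ?I < e"
        by eventually_elim (use m in \<open>simp add: dist_real_def\<close>)
    qed
  qed
  then show ?thesis using f by (simp add: lln_def)
qed

text \<open>
  Averages of bounded coboundaries vanish surely. This turns mean convergence (along multiples of some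
  \<open>D\<close>) into almost sure convergence, because \<open>f\<close> differs from its averages by a bounded coboundary.
\<close>

lemma lln_coboundary:
  assumes [measurable]: "g \<in> borel_measurable M" and b: "\<And>w. \<bar>g w\<bar> \<le> b"
  shows "lln (\<lambda>w. g w - g (T w))" and "(\<integral>w. g w - g (T w) \<partial>M) = 0"
proof -
  have gi: "integrable M g" using b by (intro integrable_const_bound[where B = b]) auto
  have gi2: "integrable M (\<lambda>w. g (T w))" using integrable_Tn[OF gi, of 1] by simp
  show int: "(\<integral>w. g w - g (T w) \<partial>M) = 0" using gi gi2 integral_Tn[of g 1] by simp
  have e: "avg (\<lambda>w. g w - g (T w)) n w = (g w - g ((T ^^ n) w)) / real n" for n w
  proof -
    have "(\<Sum>k<n. g ((T ^^ k) w) - g (T ((T ^^ k) w))) = g w - g ((T ^^ n) w)"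
      by (induction n) auto
    then show ?thesis by (simp add: avg_def)
  qed
  have "(\<lambda>n. avg (\<lambda>w. g w - g (T w)) n w) \<longlonglongrightarrow> 0" for w
  proof (rule Lim_null_comparison)
    have b0: "0 \<le> b" using b[of w] by linarith
    show "\<forall>\<^sub>F n in sequentially. norm (avg (\<lambda>w. g w - g (T w)) n w) \<le> 2 * b / real n"
    proof (rule always_eventually, rule allI)
      fix n
      have "\<bar>g w - g ((T ^^ n) w)\<bar> \<le> 2 * b" using b[of w] b[of "(T ^^ n) w"] by linarith
      then show "norm (avg (\<lambda>w. g w - g (T w)) n w) \<le> 2 * b / real n"
        unfolding e by (simp add: abs_divide divide_right_mono)
    qed
    show "(\<lambda>n. 2 * b / real n) \<longlonglongrightarrow> 0" by (rule lim_const_over_n)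
  qed
  then show "lln (\<lambda>w. g w - g (T w))" using gi gi2 int by (auto simp: lln_def)
qed

text \<open>Telescoping: a coboundary for an iterate is a sum of coboundaries for
  \<open>T\<close>.\<close>

lemma lln_coboundary_iter:
  assumes [measurable]: "g \<in> borel_measurable M" and b: "\<And>w. \<bar>g w\<bar> \<le> b"
  shows "lln (\<lambda>w. g w - g ((T ^^ k) w)) \<and> (\<integral>w. g w - g ((T ^^ k) w) \<partial>M) = 0"
proof (induction k)
  case 0
  then show ?case using lln_const[of 0] by simp
next
  case (Suc k)
  have c: "lln (\<lambda>w. g ((T ^^ k) w) - g ((T ^^ k) (T w)))"
      "(\<integral>w. g ((T ^^ k) w) - g ((T ^^ k) (T w)) \<partial>M) = 0"
    using lln_coboundary[of "\<lambda>w. g ((T ^^ k) w)" b] b by auto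
  have i: "integrable M (\<lambda>w. g w - g ((T ^^ k) w))" "integrable M (\<lambda>w. g ((T ^^ k) w) - g ((T ^^ k) (T w)))"
    using Suc c by (auto simp: lln_def)
  have eq: "(\<lambda>w. g w - g ((T ^^ Suc k) w)) = (\<lambda>w. 1 * (g w - g ((T ^^ k) w)) + 1 * (g ((T ^^ k) w) - g ((T ^^ k) (T w))))"
    by (auto simp: funpow_swap1)
  show ?case unfolding eq
  proof (intro conjI lln_linear c(1) conjunct1[OF Suc])
    show "(\<integral>w. 1 * (g w - g ((T ^^ k) w)) + 1 * (g ((T ^^ k) w) - g ((T ^^ k) (T w))) \<partial>M) = 0"
      unfolding mult_1 using Suc c(2) by (subst Bochner_Integration.integral_add[OF i]) simp
  qed
qed

lemma lln_sum: "finite I \<Longrightarrow> (\<And>i. i \<in> I \<Longrightarrow> lln (f i)) \<Longrightarrow> lln (\<lambda>w. \<Sum>i\<in>I. f i w)"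
proof (induction I rule: finite_induct)
  case (insert i I)
  then show ?case using lln_linear[of "f i" "\<lambda>w. \<Sum>i\<in>I. f i w" 1 1] by simp
qed (simp add: lln_const)

lemma lln_mean_ergodic:
  assumes f [measurable]: "f \<in> borel_measurable M" and b: "\<And>w. \<bar>f w\<bar> \<le> b"
    and mean: "(\<lambda>m. \<integral>w. \<bar>(\<Sum>k<m. f ((T ^^ (D * k)) w)) / real m - c\<bar> \<partial>M) \<longlonglongrightarrow> 0"
  shows "lln f"
proof (rule lln_L1_closed)
  show fi: "integrable M f" using b by (intro integrable_const_bound[where B = b]) auto
  fix e :: real assume "0 < e"
  let ?avg = "\<lambda>m w. (\<Sum>k<m. f ((T ^^ (D * k)) w)) / real m"
  from mean \<open>0 < e\<close> have "\<forall>\<^sub>F m in sequentially. (\<integral>w. \<bar>?avg m w - c\<bar> \<partial>M) < e \<and> 1 \<le> m"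
    using eventually_ge_at_top[of 1] by (intro eventually_conj order_tendstoD(2)) auto
  then obtain m where m: "(\<integral>w. \<bar>?avg m w - c\<bar> \<partial>M) < e" "1 \<le> m"
    by (auto simp: eventually_sequentially)
  let ?S = "\<lambda>w. \<Sum>k<m. f w - f ((T ^^ (D * k)) w)"
  have "lln ?S" using lln_coboundary_iter[OF f b] by (intro lln_sum) auto
  then have "lln (\<lambda>w. 1 / real m * ?S w + 1 * c)" by (rule lln_linear[OF _ lln_const])
  moreover have "(\<lambda>w. \<bar>f w - (1 / real m * ?S w + 1 * c)\<bar>) = (\<lambda>w. \<bar>?avg m w - c\<bar>)"
    using m(2) by (simp add: sum_subtractf field_simps)
  then have "(\<integral>w. \<bar>f w - (1 / real m * ?S w + 1 * c)\<bar> \<partial>M) < e" using m(1) by (simp only:)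
  ultimately show "\<exists>g. lln g \<and> (\<integral>w. \<bar>f w - g w\<bar> \<partial>M) < e" by blast
qed

end

lemma finite_int_bound:
  assumes "finite (J :: int set)" shows "\<exists>N::nat. \<forall>j\<in>J. \<bar>j\<bar> \<le> int N"
proof -
  have "\<bar>j\<bar> \<le> int (nat (\<Sum>j\<in>J. \<bar>j\<bar>))" if "j \<in> J" for j
    using member_le_sum[OF that, of "\<lambda>j. \<bar>j\<bar>"] assms by auto
  then show ?thesis by blast
qed

section \<open>The shift of independent uniform noise\<close>

definition noise :: "(int \<Rightarrow> real) measure" where
  "noise = Pi\<^sub>M UNIV (\<lambda>_. U01)"

lemma space_noise [simp]: "space noise = UNIV"
  by (simp add: noise_def space_PiM)

lemma sets_noise [measurable_cong]: "sets noise = sets (Pi\<^sub>M UNIV (\<lambda>_. borel))"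
  unfolding noise_def by (intro sets_PiM_cong) auto

interpretation noise: product_prob_space "\<lambda>_::int. U01" UNIV
  by (intro product_prob_spaceI prob_space_U01)

lemma prob_space_noise: "prob_space noise"
  unfolding noise_def by (rule prob_space_PiM) (rule prob_space_U01)

lemma noise_coord [measurable]: "(\<lambda>u. u k) \<in> borel_measurable noise"
  unfolding noise_def by measurable

lemma distr_noise_shift: "distr noise noise (\<lambda>u k. u (k + h)) = noise"
  using distr_PiM_reindex[of UNIV "\<lambda>_. U01" "\<lambda>k::int. k + h" UNIV] prob_space_U01
  by (simp add: noise_def inj_on_def restrict_UNIV)

lemma noise_shift_meas: "(\<lambda>u k. u (k + h)) \<in> measurable noise noise"
  unfolding noise_def by (intro measurable_PiM_single') (auto simp: space_PiM)

definition shift1 :: "(int \<Rightarrow> 'a) \<Rightarrow> int \<Rightarrow> 'a" where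
  "shift1 u = (\<lambda>k. u (k + 1))"

lemma funpow_shift1: "(shift1 ^^ n) u = (\<lambda>k. u (k + int n))"
  by (induction n arbitrary: u) (auto simp: shift1_def algebra_simps)

lemma noise_measure_preserving: "measure_preserving noise shift1"
  using distr_noise_shift[of 1] noise_shift_meas[of 1]
  by (intro measure_preserving.intro measure_preserving_axioms.intro prob_space_noise) (simp_all add: shift1_def[abs_def])

lemma noise_upd_meas [measurable]: "(\<lambda>(x, u). u(i := x)) \<in> measurable (U01 \<Otimes>\<^sub>M noise) noise"
  unfolding noise_def
  by (intro measurable_PiM_single') (auto simp: space_PiM split_beta fun_upd_def)

text \<open>Redrawing one coordinate independently does not change a product law. The inner integral
  plays the role of conditioning on all noise except \<open>u i\<close>.\<close>

lemma nn_integral_noise_resample: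
  assumes [measurable]: "f \<in> borel_measurable noise"
  shows "(\<integral>\<^sup>+ u. f u \<partial>noise) = (\<integral>\<^sup>+ u. \<integral>\<^sup>+ v. f (u(i := v)) \<partial>U01 \<partial>noise)"
proof -
  interpret P: prob_space U01 by (rule prob_space_U01)
  interpret N: prob_space noise by (rule prob_space_noise)
  interpret PN: pair_sigma_finite U01 noise ..
  have d: "distr (U01 \<Otimes>\<^sub>M noise) noise (\<lambda>(x, u). u(i := x)) = noise"
    using distr_pair_PiM_eq_PiM[of UNIV "\<lambda>_. U01" i] prob_space_U01 by (simp add: noise_def)
  have "(\<integral>\<^sup>+ u. f u \<partial>noise) = (\<integral>\<^sup>+ u. f u \<partial>distr (U01 \<Otimes>\<^sub>M noise) noise (\<lambda>(x, u). u(i := x)))"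
    unfolding d ..
  also have "\<dots> = (\<integral>\<^sup>+ z. f (case z of (x, u) \<Rightarrow> u(i := x)) \<partial>(U01 \<Otimes>\<^sub>M noise))"
    by (rule nn_integral_distr) auto
  also have "\<dots> = (\<integral>\<^sup>+ u. \<integral>\<^sup>+ v. f (u(i := v)) \<partial>U01 \<partial>noise)"
    by (subst PN.nn_integral_snd[symmetric]) (auto simp: split_beta)
  finally show ?thesis .
qed

lemma measure_noise_cylinder:
  assumes "finite J" "\<And>j. j \<in> J \<Longrightarrow> F j \<in> sets borel"
  shows "measure noise {u. \<forall>j\<in>J. u j \<in> F j} = (\<Prod>j\<in>J. measure U01 (F j))"
proof -
  have "{u. \<forall>j\<in>J. u j \<in> F j} = prod_emb UNIV (\<lambda>_. U01) J (\<Pi>\<^sub>E j\<in>J. F j)"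
    by (auto simp: prod_emb_def PiE_def Pi_def)
  then have "emeasure noise {u. \<forall>j\<in>J. u j \<in> F j} = (\<Prod>j\<in>J. emeasure U01 (F j))"
    using noise.emeasure_PiM_emb[of J F] assms by (simp add: noise_def)
  also have "\<dots> = ennreal (\<Prod>j\<in>J. measure U01 (F j))"
    by (simp add: finite_measure.emeasure_eq_measure[OF prob_space.finite_measure[OF prob_space_U01]] prod_ennreal)
  finally show ?thesis by (simp add: measure_def prod_nonneg)
qed

lemma measurable_Collect_borel_member: "F \<in> sets borel \<Longrightarrow> {u \<in> space noise. u j \<in> F} \<in> sets noise"
  using measurable_sets[OF noise_coord[of j], of F] by (simp add: vimage_def)

lemma cylinder_sets:
  assumes "finite J" "\<And>j. j \<in> J \<Longrightarrow> F j \<in> sets borel"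
  shows "{u. \<forall>j\<in>J. u j \<in> F j} \<in> sets noise"
proof -
  have "{u \<in> space noise. \<forall>j\<in>J. u j \<in> F j} \<in> sets noise"
    using assms by (intro sets.sets_Collect_finite_All measurable_Collect_borel_member) auto
  then show ?thesis by simp
qed

interpretation MP: measure_preserving noise shift1
  by (rule noise_measure_preserving)

text \<open>Shifts of a cylinder by sufficiently distant amounts are uncorrelated.\<close>

lemma noise_lln_cylinder:
  assumes J: "finite J" and F: "\<And>j. j \<in> J \<Longrightarrow> F j \<in> sets borel"
  shows "MP.lln (indicator {u. \<forall>j\<in>J. u j \<in> F j})"
proof -
  obtain B :: nat where B: "\<And>j. j \<in> J \<Longrightarrow> \<bar>j\<bar> \<le> int B" using finite_int_bound[OF J] by blast
  \<comment> \<open>\<open>J\<close> lies in \<open>[-B, B]\<close>, so its translates by distinct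
    multiples of \<open>D\<close> are disjoint.\<close>
  define D where "D = 2 * B + 1"
  define f :: "(int \<Rightarrow> real) \<Rightarrow> real" where "f = indicator {u. \<forall>j\<in>J. u j \<in> F j}"
  define c where "c = (\<Prod>j\<in>J. measure U01 (F j))"
  define g where "g k u = f (\<lambda>j. u (j + int (D * k))) - c" for k :: nat and u
  have fm [measurable]: "f \<in> borel_measurable noise"
    unfolding f_def using cylinder_sets[of J F] J F by (intro borel_measurable_indicator) auto
  have c01: "0 \<le> c" "c \<le> 1" unfolding c_def by (auto intro!: prod_nonneg prod_le_1 simp: prob_space.prob_le_1[OF prob_space_U01])
  have gm [measurable]: "g k \<in> borel_measurable noise" for k
    unfolding g_def by (intro borel_measurable_diff measurable_compose[OF noise_shift_meas fm]) auto
  have gb: "\<bar>g k u\<bar> \<le> 1" for k u using c01 by (auto simp: g_def f_def indicator_def)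
  have ggb: "\<bar>g k u * g l u\<bar> \<le> 1" for k l u
    unfolding abs_mult using gb[of k u] gb[of l u] by (intro mult_le_one) auto
  have ggi: "integrable noise (\<lambda>u. g k u * g l u)" for k l
    by (rule MP.integrable_const_bound[where B = 1]) (use ggb in auto)
  have fk: "f (\<lambda>j. u (j + int (D * k))) = indicator {u. \<forall>j\<in>(\<lambda>j. j + int (D * k)) ` J. u j \<in> F (j - int (D * k))} u" for k u
    by (auto simp: f_def indicator_def)
  have fsm [measurable]: "(\<lambda>u. f (\<lambda>j. u (j + int (D * k)))) \<in> borel_measurable noise" for k
    by (rule measurable_compose[OF noise_shift_meas fm])
  have f01: "0 \<le> f u" "f u \<le> 1" for u by (auto simp: f_def)
  have int_f: "integrable noise (\<lambda>u. f (\<lambda>j. u (j + int (D * k))))" for k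
    by (rule MP.integrable_const_bound[where B = 1]) (use f01 fsm in auto)
  have Ef: "(\<integral>u. f (\<lambda>j. u (j + int (D * k))) \<partial>noise) = c" for k
  proof -
    have I: "(\<integral>u. indicator A u \<partial>noise) = measure noise A" for A by simp
    show ?thesis unfolding fk I using J F
      by (subst measure_noise_cylinder) (auto simp: c_def prod.reindex inj_on_def)
  qed
  have orth: "(\<integral>u. g k u * g l u \<partial>noise) = 0" if kl: "k < l" for k l
  proof -
    let ?Jk = "(\<lambda>j. j + int (D * k)) ` J" and ?Jl = "(\<lambda>j. j + int (D * l)) ` J"
    let ?G = "\<lambda>j. if j \<in> ?Jk then F (j - int (D * k)) else F (j - int (D * l))"
    have "int (D * l) - int (D * k) = int D * (int l - int k)" by (simp add: algebra_simps)
    moreover have "int D * 1 \<le> int D * (int l - int k)" using kl by (intro mult_left_mono) auto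
    moreover have "int D = 2 * int B + 1" by (simp add: D_def)
    ultimately have sep: "int (D * k) + 2 * int B < int (D * l)" by linarith
    have disj: "?Jk \<inter> ?Jl = {}"
    proof safe
      fix i j assume "i \<in> J" "j \<in> J" "i + int (D * k) = j + int (D * l)"
      then show "i + int (D * k) \<in> {}" using B[of i] B[of j] sep by (auto simp: abs_le_iff)
    qed
    have "f (\<lambda>j. u (j + int (D * k))) * f (\<lambda>j. u (j + int (D * l))) = indicator {u. \<forall>j\<in>?Jk \<union> ?Jl. u j \<in> ?G j} u" for u
    proof -
      have "j + int (D * l) \<notin> ?Jk" if "j \<in> J" for j using disj that by blast
      then have "(\<forall>j\<in>?Jk \<union> ?Jl. u j \<in> ?G j) \<longleftrightarrow>
        (\<forall>j\<in>J. u (j + int (D * k)) \<in> F j) \<and> (\<forall>j\<in>J. u (j + int (D * l)) \<in> F j)" by (auto simp: ball_Un)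
      then show ?thesis by (auto simp: f_def indicator_def)
    qed
    moreover have "measure noise {u. \<forall>j\<in>?Jk \<union> ?Jl. u j \<in> ?G j} = c * c"
    proof -
      have "measure noise {u. \<forall>j\<in>?Jk \<union> ?Jl. u j \<in> ?G j} = (\<Prod>j\<in>?Jk \<union> ?Jl. measure U01 (?G j))"
        using J F by (intro measure_noise_cylinder) auto
      also have "\<dots> = (\<Prod>j\<in>?Jk. measure U01 (?G j)) * (\<Prod>j\<in>?Jl. measure U01 (?G j))"
        using J disj by (intro prod.union_disjoint) auto
      also have "(\<Prod>j\<in>?Jk. measure U01 (?G j)) = c"
        by (subst prod.reindex) (auto simp: inj_on_def c_def)
      also have "(\<Prod>j\<in>?Jl. measure U01 (?G j)) = (\<Prod>j\<in>?Jl. measure U01 (F (j - int (D * l))))"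
        using disj by (intro prod.cong refl) auto
      also have "\<dots> = c" by (subst prod.reindex) (auto simp: inj_on_def c_def)
      finally show ?thesis .
    qed
    ultimately have ff: "(\<integral>u. f (\<lambda>j. u (j + int (D * k))) * f (\<lambda>j. u (j + int (D * l))) \<partial>noise) = c * c" by simp
    have ffi: "integrable noise (\<lambda>u. f (\<lambda>j. u (j + int (D * k))) * f (\<lambda>j. u (j + int (D * l))))"
      by (rule MP.integrable_const_bound[where B = 1])
         (use f01 fsm in \<open>auto simp: abs_mult intro!: mult_le_one\<close>)
    have "(\<integral>u. g k u * g l u \<partial>noise) = (\<integral>u. (f (\<lambda>j. u (j + int (D * k))) * f (\<lambda>j. u (j + int (D * l)))
        - c * f (\<lambda>j. u (j + int (D * k)))) - (c * f (\<lambda>j. u (j + int (D * l))) - c * c) \<partial>noise)"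
      by (simp add: g_def algebra_simps)
    also have "\<dots> = 0" using int_f ffi MP.prob_space by (simp add: ff Ef del: of_nat_mult)
    finally show ?thesis .
  qed
  \<comment> \<open>Orthogonality leaves the diagonal terms, so the second moment of the centred sum
    grows only linearly.\<close>
  have L2: "(\<integral>u. (\<Sum>k<m. g k u)\<^sup>2 \<partial>noise) \<le> real m" for m
  proof -
    have "(\<integral>u. (\<Sum>k<m. g k u)\<^sup>2 \<partial>noise) = (\<integral>u. (\<Sum>k<m. \<Sum>l<m. g k u * g l u) \<partial>noise)"
      by (simp add: power2_eq_square sum_product)
    also have "\<dots> = (\<Sum>k<m. \<Sum>l<m. \<integral>u. g k u * g l u \<partial>noise)" using ggi by simp
    also have "\<dots> = (\<Sum>k<m. \<Sum>l<m. if k = l then \<integral>u. g k u * g k u \<partial>noise else 0)"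
    proof (intro sum.cong refl)
      fix k l
      show "(\<integral>u. g k u * g l u \<partial>noise) = (if k = l then \<integral>u. g k u * g k u \<partial>noise else 0)"
        using orth[of k l] orth[of l k] by (cases k l rule: linorder_cases) (auto simp: mult.commute)
    qed
    also have "\<dots> = (\<Sum>k<m. \<integral>u. g k u * g k u \<partial>noise)" by simp
    also have "\<dots> \<le> (\<Sum>k<m. 1)"
    proof (intro sum_mono)
      fix k
      have "(\<integral>u. g k u * g k u \<partial>noise) \<le> (\<integral>u. 1 \<partial>noise)"
      proof (rule integral_mono[OF ggi])
        show "g k u * g k u \<le> 1" for u using gb[of k u] by (metis abs_mult_self_eq abs_ge_zero mult_le_one)
      qed simp
      then show "(\<integral>u. g k u * g k u \<partial>noise) \<le> 1" using MP.prob_space by simp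
    qed
    finally show ?thesis by simp
  qed
  have "(\<lambda>m. \<integral>u. \<bar>(\<Sum>k<m. f ((shift1 ^^ (D * k)) u)) / real m - c\<bar> \<partial>noise) \<longlonglongrightarrow> 0"
  proof (rule Lim_null_comparison)
    show "\<forall>\<^sub>F m in sequentially. norm (\<integral>u. \<bar>(\<Sum>k<m. f ((shift1 ^^ (D * k)) u)) / real m - c\<bar> \<partial>noise) \<le> 1 / sqrt (real m)"
      using eventually_gt_at_top[of 0]
    proof eventually_elim
      case (elim m)
      have e: "(\<Sum>k<m. f ((shift1 ^^ (D * k)) u)) / real m - c = (\<Sum>k<m. g k u) / real m" for u
        using elim by (simp add: g_def sum_subtractf funpow_shift1 field_simps)
      have i: "integrable noise (\<lambda>u. ((\<Sum>k<m. g k u) / real m)\<^sup>2)"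
        using ggi by (simp add: power_divide power2_eq_square sum_product)
      \<comment> \<open>Nonnegativity of the variance passes from the second to the first absolute
        moment.\<close>
      have "(\<integral>u. \<bar>(\<Sum>k<m. g k u) / real m\<bar> \<partial>noise)\<^sup>2 \<le> (\<integral>u. \<bar>(\<Sum>k<m. g k u) / real m\<bar>\<^sup>2 \<partial>noise)"
      proof -
        have i1: "integrable noise (\<lambda>u. \<bar>(\<Sum>k<m. g k u) / real m\<bar>)"
          by (intro integrable_abs integrable_divide Bochner_Integration.integrable_sum MP.integrable_const_bound[where B = 1])
             (auto simp: gb)
        have i2: "integrable noise (\<lambda>u. \<bar>(\<Sum>k<m. g k u) / real m\<bar>\<^sup>2)" unfolding power2_abs by (rule i)
        show ?thesis
          using MP.variance_eq[OF i1 i2] MP.variance_positive[of "\<lambda>u. \<bar>(\<Sum>k<m. g k u) / real m\<bar>"] by linarith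
      qed
      also have "\<dots> = (\<integral>u. (\<Sum>k<m. g k u)\<^sup>2 \<partial>noise) / (real m)\<^sup>2" by (simp add: power_divide)
      also have "\<dots> \<le> real m / (real m)\<^sup>2" by (intro divide_right_mono L2) auto
      also have "\<dots> = (1 / sqrt (real m))\<^sup>2" using elim by (simp add: power_divide power2_eq_square)
      finally have "(\<integral>u. \<bar>(\<Sum>k<m. g k u) / real m\<bar> \<partial>noise) \<le> 1 / sqrt (real m)"
        by (rule power2_le_imp_le) simp
      then show ?case unfolding e by simp
    qed
    show "(\<lambda>m. 1 / sqrt (real m)) \<longlonglongrightarrow> 0" by real_asymp
  qed
  then have "MP.lln f" by (intro MP.lln_mean_ergodic[OF fm, of 1 D c]) (use f01 in auto)
  then show ?thesis by (simp add: f_def)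
qed

text \<open>Cylinders generate the sigma-algebra and are stable under intersection; complements
  follow by linearity, countable disjoint unions by closedness under limits in mean.\<close>

lemma noise_lln_indicator:
  assumes "A \<in> sets noise" shows "MP.lln (indicator A)"
proof -
  have sp: "(\<Pi>\<^sub>E i\<in>UNIV. space U01) = (UNIV :: (int \<Rightarrow> real) set)" by auto
  have "A \<in> sigma_sets (\<Pi>\<^sub>E i\<in>UNIV. space U01) (prod_algebra UNIV (\<lambda>_. U01))"
    using assms by (simp add: noise_def sets_PiM)
  from Int_stable_prod_algebra prod_algebra_sets_into_space this show ?thesis
  proof (induction rule: sigma_sets_induct_disjoint)
    case (basic A)
    then obtain J E where A: "A = prod_emb UNIV (\<lambda>_. U01) J (\<Pi>\<^sub>E j\<in>J. E j)"
        and J: "finite J" "\<And>i. i \<in> J \<Longrightarrow> E i \<in> sets (U01)"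
      by (rule prod_algebraE) auto
    have "A = {u. \<forall>j\<in>J. u j \<in> E j}" unfolding A by (auto simp: prod_emb_def PiE_def Pi_def)
    then show ?case using noise_lln_cylinder[of J E] J by simp
  next
    case empty
    then show ?case using MP.lln_const[of 0] by (simp add: indicator_def)
  next
    case (compl A)
    have "indicator ((\<Pi>\<^sub>E i\<in>UNIV. space U01) - A) = (\<lambda>u. 1 * 1 + (-1) * indicator A u :: real)"
      by (auto simp: indicator_def)
    then show ?case using MP.lln_linear[OF MP.lln_const[of 1] compl(2), of 1 "-1"] by (simp only:)
  next
    case (union A)
    have Am [measurable]: "A i \<in> sets noise" for i using union(2) by (auto simp: noise_def sets_PiM)
    let ?g = "\<lambda>n. indicator (\<Union>i<n. A i) :: _ \<Rightarrow> real"
    have g: "MP.lln (?g n)" for n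
    proof -
      have "?g n = (\<lambda>u. \<Sum>i<n. indicator (A i) u)"
        using union(1) by (intro ext indicator_UN_disjoint) (auto simp: disjoint_family_on_def)
      then show ?thesis using MP.lln_sum[of "{..<n}" "\<lambda>i. indicator (A i)"] union by simp
    qed
    show ?case
    proof (rule MP.lln_L1_closed)
      show "integrable noise (indicator (\<Union>i. A i) :: _ \<Rightarrow> real)"
        by (rule MP.integrable_const_bound[where B = 1]) (auto simp: indicator_def)
      have "(\<lambda>n. \<integral>u. \<bar>indicator (\<Union>i. A i) u - ?g n u\<bar> \<partial>noise) \<longlonglongrightarrow> (\<integral>u. 0 \<partial>noise)"
      proof (rule integral_dominated_convergence[where w = "\<lambda>_. 1"])
        show "AE u in noise. (\<lambda>n. \<bar>indicator (\<Union>i. A i) u - ?g n u\<bar>) \<longlonglongrightarrow> 0"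
        proof (rule AE_I2)
          fix u
          have "\<forall>\<^sub>F n in sequentially. \<bar>indicator (\<Union>i. A i) u - ?g n u\<bar> = 0"
          proof (cases "u \<in> (\<Union>i. A i)")
            case True
            then obtain i where "u \<in> A i" by auto
            then show ?thesis
              by (intro eventually_mono[OF eventually_gt_at_top[of i]]) (auto simp: indicator_def)
          qed (auto simp: indicator_def)
          then show "(\<lambda>n. \<bar>indicator (\<Union>i. A i) u - ?g n u\<bar>) \<longlonglongrightarrow> 0" by (rule tendsto_eventually)
        qed
      qed (auto simp: indicator_def)
      then have lim: "(\<lambda>n. \<integral>u. \<bar>indicator (\<Union>i. A i) u - ?g n u\<bar> \<partial>noise) \<longlonglongrightarrow> 0" by simp
      fix e :: real assume "0 < e"
      from order_tendstoD(2)[OF lim this] obtain n where "(\<integral>u. \<bar>indicator (\<Union>i. A i) u - ?g n u\<bar> \<partial>noise) < e"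
        by (auto simp: eventually_sequentially)
      then show "\<exists>g. MP.lln g \<and> (\<integral>u. \<bar>indicator (\<Union>i. A i) u - g u\<bar> \<partial>noise) < e" using g by blast
    qed
  qed
qed

text \<open>Simple functions inherit the law from indicators and approximate every integrable
  function in mean. As the limit is a constant, this contains the ergodicity of the shift.\<close>

lemma noise_lln:
  fixes f :: "(int \<Rightarrow> real) \<Rightarrow> real"
  assumes "integrable noise f" shows "MP.lln f"
  using assms
proof (induction rule: integrable_induct)
  case (base A c)
  have "(\<lambda>x. indicator A x *\<^sub>R c) = (\<lambda>x. c * indicator A x + 0 * indicator A x)" by auto
  then show ?case using MP.lln_linear[OF noise_lln_indicator noise_lln_indicator, of A A c 0] base by (simp only:)
next
  case (add f g)
  then show ?case using MP.lln_linear[of f g 1 1] by simp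
next
  fix f :: "(int \<Rightarrow> real) \<Rightarrow> real" and s
  assume lim: "\<And>i. MP.lln (s i)" "\<And>i. integrable noise (s i)"
    "\<And>u. u \<in> space noise \<Longrightarrow> (\<lambda>i. s i u) \<longlonglongrightarrow> f u"
    "\<And>i u. u \<in> space noise \<Longrightarrow> norm (s i u) \<le> 2 * norm (f u)" "integrable noise f"
  note [measurable] = borel_measurable_integrable[OF lim(2)] borel_measurable_integrable[OF lim(5)]
  show "MP.lln f"
  proof (rule MP.lln_L1_closed[OF lim(5)])
    have "(\<lambda>i. \<integral>u. \<bar>f u - s i u\<bar> \<partial>noise) \<longlonglongrightarrow> (\<integral>u. 0 \<partial>noise)"
    proof (rule integral_dominated_convergence[where w = "\<lambda>u. 3 * \<bar>f u\<bar>"])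
      show "AE u in noise. (\<lambda>i. \<bar>f u - s i u\<bar>) \<longlonglongrightarrow> 0"
      proof (rule AE_I2)
        fix u
        have "(\<lambda>i. \<bar>f u - s i u\<bar>) \<longlonglongrightarrow> \<bar>f u - f u\<bar>" by (intro tendsto_intros lim(3)) simp
        then show "(\<lambda>i. \<bar>f u - s i u\<bar>) \<longlonglongrightarrow> 0" by simp
      qed
      show "AE u in noise. norm \<bar>f u - s i u\<bar> \<le> 3 * \<bar>f u\<bar>" for i
      proof (rule AE_I2)
        fix u
        have "\<bar>s i u\<bar> \<le> 2 * \<bar>f u\<bar>" using lim(4)[of u i] by simp
        then show "norm \<bar>f u - s i u\<bar> \<le> 3 * \<bar>f u\<bar>" by simp
      qed
    qed (use lim(5) in auto)
    then have l: "(\<lambda>i. \<integral>u. \<bar>f u - s i u\<bar> \<partial>noise) \<longlonglongrightarrow> 0" by simp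
    fix e :: real assume "0 < e"
    from order_tendstoD(2)[OF l this] obtain i where "(\<integral>u. \<bar>f u - s i u\<bar> \<partial>noise) < e"
      by (auto simp: eventually_sequentially)
    then show "\<exists>g. MP.lln g \<and> (\<integral>u. \<bar>f u - g u\<bar> \<partial>noise) < e" using lim(1) by blast
  qed
qed

section \<open>Existence of a stationary solution\<close>

lemma space_path_space [simp]: "space path_space = UNIV"
  by (simp add: path_space_def space_PiM space_pair_measure)

lemma path_space_meas:
  assumes "\<And>k. X k \<in> borel_measurable M" "\<And>k. Y k \<in> measurable M (count_space UNIV)"
  shows "(\<lambda>w k. (X k w, Y k w)) \<in> measurable M path_space"
  unfolding path_space_def using assms
  by (intro measurable_PiM_single') (auto simp: space_PiM space_pair_measure)

lemma path_space_coord [measurable]: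
  "(\<lambda>w. fst (w k)) \<in> borel_measurable path_space" "(\<lambda>w. snd (w k)) \<in> measurable path_space (count_space UNIV)"
  unfolding path_space_def by measurable

lemma path_space_shift_meas:
  assumes "sets P = sets path_space"
  shows "(\<lambda>w k. w (k + h)) \<in> measurable P path_space"
  unfolding measurable_cong_sets[OF assms refl]
  unfolding path_space_def by (intro measurable_PiM_single') (auto simp: space_PiM space_pair_measure)

lemma past_subalgebra:
  assumes "\<And>k. X k \<in> borel_measurable M" "\<And>k. Y k \<in> measurable M (count_space UNIV)"
  shows "subalgebra M (past_algebra M X Y k)"
proof -
  let ?G = "{X j -` A \<inter> space M | j A. j \<le> k \<and> A \<in> sets borel} \<union> {Y j -` B \<inter> space M | j B. j \<le> k - 1}"
  have G: "?G \<subseteq> sets M" using measurable_sets[OF assms(1)] measurable_sets[OF assms(2)] by auto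
  have sp: "?G \<subseteq> Pow (space M)" by auto
  show ?thesis
    unfolding subalgebra_def past_algebra_def using sets.sigma_sets_subset[OF G] sp
    by (simp add: space_measure_of sets_measure_of)
qed

lemma past_algebra_X:
  assumes "j \<le> k" shows "X j \<in> borel_measurable (past_algebra M X Y k)"
proof (rule measurableI)
  fix A :: "real set" assume "A \<in> sets borel"
  then show "X j -` A \<inter> space (past_algebra M X Y k) \<in> sets (past_algebra M X Y k)"
    unfolding past_algebra_def using assms
    by (auto simp: space_measure_of_conv intro!: in_measure_of)
qed simp

lemma past_algebra_Y:
  assumes "j < k" shows "Y j \<in> measurable (past_algebra M X Y k) (count_space UNIV)"
proof (rule measurableI)
  fix A :: "nat set"
  have "j \<le> k - 1" using assms by simp
  then show "Y j -` A \<inter> space (past_algebra M X Y k) \<in> sets (past_algebra M X Y k)"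
    unfolding past_algebra_def space_measure_of_conv by (intro in_measure_of) blast+
qed simp

lemma past_algebra_measurableI:
  assumes f: "f \<in> space N \<rightarrow> space M"
    and X: "\<And>j. j \<le> k \<Longrightarrow> (\<lambda>w. X j (f w)) \<in> borel_measurable N"
    and Y: "\<And>j. j < k \<Longrightarrow> (\<lambda>w. Y j (f w)) \<in> measurable N (count_space UNIV)"
  shows "f \<in> measurable N (past_algebra M X Y k)"
  unfolding past_algebra_def
proof (rule measurable_measure_of)
  fix A assume "A \<in> {X j -` A \<inter> space M | j A. j \<le> k \<and> A \<in> sets borel} \<union> {Y j -` B \<inter> space M | j B. j \<le> k - 1}"
  then consider j B where "A = X j -` B \<inter> space M" "j \<le> k" "B \<in> sets borel" | j B where "A = Y j -` B \<inter> space M" "j < k"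
    by auto
  then show "f -` A \<inter> space N \<in> sets N"
  proof cases
    case 1
    have "f -` A \<inter> space N = (\<lambda>w. X j (f w)) -` B \<inter> space N" using 1 f by auto
    then show ?thesis using measurable_sets[OF X] 1 by simp
  next
    case 2
    have "f -` A \<inter> space N = (\<lambda>w. Y j (f w)) -` B \<inter> space N" using 2 f by auto
    then show ?thesis using measurable_sets[OF Y] 2 by simp
  qed
qed (use f in auto)

text \<open>Trades conditional expectations for identities between nonnegative integrals over past
  events, which are easily carried over to image measures.\<close>

lemma nbin_garch_processI:
  assumes M: "prob_space M" and X: "\<And>k. X k \<in> borel_measurable M"
    and Y: "\<And>k. Y k \<in> measurable M (count_space UNIV)" and r: "0 < cr \<theta>"
    and nn: "\<And>k. AE w in M. 0 \<le> X k w"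
    and rec: "\<And>k. AE w in M. X (k + 1) w = garch_step p q \<theta> (\<lambda>j. X j w) (\<lambda>j. Y j w) (k + 1)"
    and cond: "\<And>k y A. A \<in> sets (past_algebra M X Y k) \<Longrightarrow>
      (\<integral>\<^sup>+ w. indicator A w * indicator {v \<in> space M. Y k v = y} w \<partial>M) = (\<integral>\<^sup>+ w. indicator A w * ennreal (nb (cr \<theta>) (X k w) y) \<partial>M)"
  shows "nbin_garch_process p q \<theta> M X Y"
proof -
  interpret prob_space M by (rule M)
  note [measurable] = X Y
  have "AE w in M. real_cond_exp M (past_algebra M X Y k) (indicator {v \<in> space M. Y k v = y}) w = nbin_pmf \<theta> (X k w) y" for k y
  proof -
    let ?F = "past_algebra M X Y k"
    have sub: "subalgebra M ?F" by (rule past_subalgebra[OF X Y])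
    interpret S: finite_measure_subalgebra M ?F by unfold_locales (rule sub)
    let ?nb = "\<lambda>w. nb (cr \<theta>) (X k w) y"
    have i1: "integrable M (indicator {v \<in> space M. Y k v = y} :: _ \<Rightarrow> real)"
      by (rule integrable_const_bound[where B = 1]) auto
    have b: "AE w in M. 0 \<le> ?nb w \<and> ?nb w \<le> 1" using nn[of k] by eventually_elim (simp add: nb_nonneg nb_le_1 r)
    then have i2: "integrable M ?nb" by (intro integrable_const_bound[where B = 1]) auto
    have "AE w in M. real_cond_exp M ?F (indicator {v \<in> space M. Y k v = y}) w = ?nb w"
    proof (rule S.real_cond_exp_charact[OF _ i1 i2])
      show "?nb \<in> borel_measurable ?F" using past_algebra_X[of k k X M Y] by measurable
      fix A assume A: "A \<in> sets ?F"
      then have [measurable]: "A \<in> sets M" using sub by (auto simp: subalgebra_def)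
      have "(\<integral>w\<in>A. indicator {v \<in> space M. Y k v = y} w \<partial>M) =
          enn2real (\<integral>\<^sup>+ w. indicator A w * indicator {v \<in> space M. Y k v = y} w \<partial>M)"
        unfolding set_lebesgue_integral_def
        by (subst integral_eq_nn_integral) (auto intro!: arg_cong[where f = enn2real] nn_integral_cong simp: indicator_def)
      also have "\<dots> = enn2real (\<integral>\<^sup>+ w. indicator A w * ennreal (?nb w) \<partial>M)" using cond[OF A] by simp
      also have "\<dots> = (\<integral>w\<in>A. ?nb w \<partial>M)"
        unfolding set_lebesgue_integral_def using b
        by (subst integral_eq_nn_integral) (auto intro!: arg_cong[where f = enn2real] nn_integral_cong simp: indicator_def)
      finally show "(\<integral>w\<in>A. indicator {v \<in> space M. Y k v = y} w \<partial>M) = (\<integral>w\<in>A. ?nb w \<partial>M)" .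
    qed
    then show ?thesis using r by (simp add: nbin_pmf_nb)
  qed
  then show ?thesis unfolding nbin_garch_process_def using M X Y nn rec by blast
qed

lemma nbin_garch_processD:
  assumes "nbin_garch_process p q \<theta> M X Y"
  shows "prob_space M" "\<And>k. X k \<in> borel_measurable M" "\<And>k. Y k \<in> measurable M (count_space UNIV)"
    "\<And>k. AE w in M. 0 \<le> X k w"
    "\<And>k. AE w in M. X k w = garch_step p q \<theta> (\<lambda>j. X j w) (\<lambda>j. Y j w) k"
proof -
  show "AE w in M. X k w = garch_step p q \<theta> (\<lambda>j. X j w) (\<lambda>j. Y j w) k" for k
  proof -
    have "AE w in M. X (k - 1 + 1) w = garch_step p q \<theta> (\<lambda>j. X j w) (\<lambda>j. Y j w) (k - 1 + 1)"
      using assms unfolding nbin_garch_process_def by blast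
    then show ?thesis by simp
  qed
qed (use assms in \<open>auto simp: nbin_garch_process_def\<close>)

text \<open>Extends the conditional law from single values to integrands that combine
  \<open>Y k\<close> with the past: split by the value of \<open>Y k\<close> and integrate each
  piece against its conditional expectation.\<close>

lemma nbin_garch_transition:
  assumes G: "nbin_garch_process p q \<theta> M X Y" and r: "0 < cr \<theta>"
    and H: "\<And>y. H y \<in> borel_measurable (past_algebra M X Y k)"
  shows "(\<integral>\<^sup>+ w. H (Y k w) w \<partial>M) = (\<integral>\<^sup>+ w. (\<Sum>y. ennreal (nb (cr \<theta>) (X k w) y) * H y w) \<partial>M)"
proof -
  note D = nbin_garch_processD[OF G]
  interpret prob_space M by (rule D)
  note [measurable] = D(2,3)
  let ?F = "past_algebra M X Y k"
  have sub: "subalgebra M ?F" by (rule past_subalgebra[OF D(2,3)])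
  interpret S: finite_measure_subalgebra M ?F by unfold_locales (rule sub)
  have HM [measurable]: "H y \<in> borel_measurable M" for y by (rule measurable_from_subalg[OF sub H])
  have step: "(\<integral>\<^sup>+ w. H y w * indicator {w. Y k w = y} w \<partial>M) = (\<integral>\<^sup>+ w. ennreal (nb (cr \<theta>) (X k w) y) * H y w \<partial>M)" for y
  proof -
    let ?I = "indicator {v \<in> space M. Y k v = y} :: _ \<Rightarrow> real"
    have a: "AE w in M. 0 = nn_cond_exp M ?F (\<lambda>_. 0) w" "AE w in M. 1 = nn_cond_exp M ?F (\<lambda>_. 1) w"
      by (rule S.nn_cond_exp_F_meas, simp)+
    have b: "AE w in M. nn_cond_exp M ?F (\<lambda>w. ennreal (?I w)) w \<le> nn_cond_exp M ?F (\<lambda>_. 1) w"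
      by (rule S.nn_cond_exp_mono) (auto simp: indicator_def)
    \<comment> \<open>\<open>real_cond_exp\<close> is the difference of two nonnegative conditional
      expectations. The negative part vanishes here, and the bound by 1 keeps the positive part
      finite, where \<open>enn2real\<close> loses nothing.\<close>
    have z: "(\<lambda>w. ennreal (- ?I w)) = (\<lambda>_. 0)" by (auto simp: indicator_def ennreal_neg)
    have "AE w in M. real_cond_exp M ?F ?I w = nbin_pmf \<theta> (X k w) y"
      using G unfolding nbin_garch_process_def by blast
    then have "AE w in M. nn_cond_exp M ?F (\<lambda>w. ennreal (?I w)) w = ennreal (nb (cr \<theta>) (X k w) y)"
      using a b
    proof eventually_elim
      case (elim w)
      have "nn_cond_exp M ?F (\<lambda>w. ennreal (?I w)) w < \<infinity>" using elim by (auto intro: le_less_trans)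
      moreover have "enn2real (nn_cond_exp M ?F (\<lambda>w. ennreal (?I w)) w) = nb (cr \<theta>) (X k w) y"
        using elim r unfolding real_cond_exp_def z by (simp add: nbin_pmf_nb)
      ultimately show ?case by (metis ennreal_enn2real infinity_ennreal_def)
    qed
    then have "(\<integral>\<^sup>+ w. ennreal (nb (cr \<theta>) (X k w) y) * H y w \<partial>M) = (\<integral>\<^sup>+ w. H y w * nn_cond_exp M ?F (\<lambda>w. ennreal (?I w)) w \<partial>M)"
      by (intro nn_integral_cong_AE) (auto simp: mult.commute)
    also have "\<dots> = (\<integral>\<^sup>+ w. H y w * ennreal (?I w) \<partial>M)" by (rule S.nn_cond_exp_intg) (use H in auto)
    also have "\<dots> = (\<integral>\<^sup>+ w. H y w * indicator {w. Y k w = y} w \<partial>M)" by (intro nn_integral_cong) (auto simp: indicator_def)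
    finally show ?thesis ..
  qed
  have "(\<integral>\<^sup>+ w. H (Y k w) w \<partial>M) = (\<Sum>y. \<integral>\<^sup>+ w. H y w * indicator {w. Y k w = y} w \<partial>M)"
    by (rule nn_integral_nat_partition) auto
  also have "\<dots> = (\<Sum>y. \<integral>\<^sup>+ w. ennreal (nb (cr \<theta>) (X k w) y) * H y w \<partial>M)" unfolding step ..
  also have "\<dots> = (\<integral>\<^sup>+ w. (\<Sum>y. ennreal (nb (cr \<theta>) (X k w) y) * H y w) \<partial>M)"
    by (rule nn_integral_suminf[symmetric]) auto
  finally show ?thesis .
qed

text \<open>Since every value of \<open>Y\<^sub>k\<close> has positive conditional probability, it may be replaced by an arbitrary one.\<close>

lemma nbin_garch_transition_AE:
  assumes G: "nbin_garch_process p q \<theta> M X Y" and r: "0 < cr \<theta>" and X0: "AE w in M. 0 < X k w"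
    and Q: "\<And>y. {w \<in> space M. Q y w} \<in> sets (past_algebra M X Y k)" and ae: "AE w in M. Q (Y k w) w"
  shows "AE w in M. \<forall>y. Q y w"
proof -
  note D = nbin_garch_processD[OF G]
  let ?F = "past_algebra M X Y k"
  have sub: "subalgebra M ?F" by (rule past_subalgebra[OF D(2,3)])
  have sp: "space ?F = space M" by (simp add: past_algebra_def space_measure_of_conv)
  note [measurable] = D(2,3)
  let ?N = "\<lambda>y. space M - {w \<in> space M. Q y w}"
  have N: "?N y \<in> sets ?F" for y using sets.compl_sets[OF Q] sp by metis
  have [measurable]: "?N y \<in> sets M" for y using N sub by (auto simp: subalgebra_def)
  have "(\<integral>\<^sup>+ w. (\<Sum>y. ennreal (nb (cr \<theta>) (X k w) y) * indicator (?N y) w) \<partial>M) = (\<integral>\<^sup>+ w. indicator (?N (Y k w)) w \<partial>M)"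
    using N by (intro nbin_garch_transition[OF G r, symmetric, of "\<lambda>y. indicator (?N y)"]) auto
  also have "\<dots> = (\<integral>\<^sup>+ w. 0 \<partial>M)"
    by (rule nn_integral_cong_AE, use ae in eventually_elim) simp
  finally have "(\<integral>\<^sup>+ w. (\<Sum>y. ennreal (nb (cr \<theta>) (X k w) y) * indicator (?N y) w) \<partial>M) = 0" by simp
  then have "AE w in M. (\<Sum>y. ennreal (nb (cr \<theta>) (X k w) y) * indicator (?N y) w) = 0"
    by (subst (asm) nn_integral_0_iff_AE) measurable
  moreover have "AE w in M. w \<in> space M" by (rule AE_space)
  ultimately show ?thesis using X0
  proof eventually_elim
    case (elim w)
    have "ennreal (nb (cr \<theta>) (X k w) y) * indicator (?N y) w = 0" for y using elim(1) by (simp add: suminf_eq_zero_iff)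
    then have "nb (cr \<theta>) (X k w) y \<le> 0 \<or> Q y w" for y
      using elim(2) by (auto simp: indicator_def ennreal_eq_0_iff split: if_splits)
    moreover have "0 < nb (cr \<theta>) (X k w) y" for y by (rule nb_pos[OF r elim(3)])
    ultimately show ?case by (simp add: not_le[symmetric])
  qed
qed

lemma suminf_indicator_singleton: "(\<Sum>y'::nat. f y' * (c * indicator {y} y')) = (c * f y :: ennreal)"
  by (subst suminf_finite[of "{y}"]) (auto simp: mult.commute indicator_def)

text \<open>Past events of the coordinate process pull back to past events of the original process,
  so the image measure on path space inherits the transition identity.\<close>

lemma stationary_solutionI:
  assumes G: "nbin_garch_process p q \<theta> M X Y" and r: "0 < cr \<theta>"
    and stat: "\<And>h. distr M path_space (\<lambda>w k. (X (k + h) w, Y (k + h) w)) = distr M path_space (\<lambda>w k. (X k w, Y k w))"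
  shows "stationary_solution p q \<theta> (distr M path_space (\<lambda>w k. (X k w, Y k w)))"
proof -
  note D = nbin_garch_processD[OF G]
  interpret prob_space M by (rule D)
  let ?\<Phi> = "\<lambda>w k. (X k w, Y k w)"
  let ?P = "distr M path_space ?\<Phi>"
  let ?X = "\<lambda>k w. fst (w k) :: real" and ?Y = "\<lambda>k w. snd (w k) :: nat"
  have \<Phi> [measurable]: "?\<Phi> \<in> measurable M path_space" by (rule path_space_meas[OF D(2,3)])
  have shift: "(\<lambda>w k. w (k + h)) \<in> measurable path_space path_space" for h :: int by (rule path_space_shift_meas[OF refl])
  have inv: "distr ?P path_space (\<lambda>w k. w (k + h)) = ?P" for h
    using stat[of h] by (subst distr_distr[OF shift \<Phi>]) (simp add: o_def)
  have "nbin_garch_process p q \<theta> ?P ?X ?Y"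
  proof (rule nbin_garch_processI[OF _ _ _ r])
    show "prob_space ?P" by (rule prob_space_distr) measurable
    show "AE w in ?P. 0 \<le> ?X k w" for k
    proof (subst AE_distr_iff[OF \<Phi>])
      show "{w \<in> space path_space. 0 \<le> ?X k w} \<in> sets path_space" by measurable
    qed (use D(4)[of k] in auto)
    show "AE w in ?P. ?X (k + 1) w = garch_step p q \<theta> (\<lambda>j. ?X j w) (\<lambda>j. ?Y j w) (k + 1)" for k
      unfolding garch_step_eq
    proof (subst AE_distr_iff[OF \<Phi>])
      show "{w \<in> space path_space. ?X (k + 1) w = om \<theta> + (\<Sum>i=1..p. ca \<theta> i * ?X (k + 1 - int i) w)
          + (\<Sum>i=1..q. cb \<theta> i * real (?Y (k + 1 - int i) w))} \<in> sets path_space" by measurable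
    qed (use D(5)[of "k + 1"] in \<open>auto simp: garch_step_eq\<close>)
    fix k y A assume A: "A \<in> sets (past_algebra ?P ?X ?Y k)"
    have subP: "subalgebra ?P (past_algebra ?P ?X ?Y k)" by (rule past_subalgebra) auto
    then have [measurable]: "A \<in> sets path_space" using A by (auto simp: subalgebra_def)
    have \<Phi>F: "?\<Phi> \<in> measurable (past_algebra M X Y k) (past_algebra ?P ?X ?Y k)"
      by (rule past_algebra_measurableI) (auto intro: past_algebra_X past_algebra_Y)
    have IA: "(\<lambda>w. indicator A (?\<Phi> w) :: ennreal) \<in> borel_measurable (past_algebra M X Y k)"
      using \<Phi>F A by (intro measurable_compose[OF \<Phi>F borel_measurable_indicator])
    have "(\<integral>\<^sup>+ w. indicator A w * indicator {v \<in> space ?P. ?Y k v = y} w \<partial>?P)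
        = (\<integral>\<^sup>+ w. indicator A (?\<Phi> w) * indicator {y} (Y k w) \<partial>M)"
      by (subst nn_integral_distr) (auto intro!: nn_integral_cong simp: indicator_def)
    also have "\<dots> = (\<integral>\<^sup>+ w. (\<Sum>y'. ennreal (nb (cr \<theta>) (X k w) y') * (indicator A (?\<Phi> w) * indicator {y} y')) \<partial>M)"
      using IA by (intro nbin_garch_transition[OF G r, of "\<lambda>y' w. indicator A (?\<Phi> w) * indicator {y} y'"]) auto
    also have "\<dots> = (\<integral>\<^sup>+ w. indicator A (?\<Phi> w) * ennreal (nb (cr \<theta>) (X k w) y) \<partial>M)"
      by (simp only: suminf_indicator_singleton)
    also have "\<dots> = (\<integral>\<^sup>+ w. indicator A w * ennreal (nb (cr \<theta>) (?X k w) y) \<partial>?P)"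
      by (subst nn_integral_distr) auto
    finally show "(\<integral>\<^sup>+ w. indicator A w * indicator {v \<in> space ?P. ?Y k v = y} w \<partial>?P) =
      (\<integral>\<^sup>+ w. indicator A w * ennreal (nb (cr \<theta>) (?X k w) y) \<partial>?P)" .
  qed auto
  then show ?thesis unfolding stationary_solution_def using inv by simp
qed

text \<open>\<open>f\<close> and \<open>h\<close> do not read \<open>u k\<close>, so this coordinate
  may be redrawn: given everything else, the quantile transform has law \<open>nb\<close>.\<close>

lemma nn_integral_noise_quantile:
  assumes r: "0 < r" and f [measurable]: "f \<in> borel_measurable noise" and f0: "\<And>u. 0 \<le> f u"
    and fk: "\<And>u v. f (u(k := v)) = f u"
    and h [measurable]: "\<And>y. h y \<in> borel_measurable noise" and hk: "\<And>y u v. h y (u(k := v)) = h y u"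
  shows "(\<integral>\<^sup>+ u. h (nb_quantile r (f u) (u k)) u \<partial>noise) = (\<integral>\<^sup>+ u. (\<Sum>y. ennreal (nb r (f u) y) * h y u) \<partial>noise)"
proof -
  have [measurable]: "(\<lambda>u. h (nb_quantile r (f u) (u k)) u) \<in> borel_measurable noise"
    by (rule measurable_compose_countable[where f = h]) measurable
  have "(\<integral>\<^sup>+ u. h (nb_quantile r (f u) (u k)) u \<partial>noise) = (\<integral>\<^sup>+ u. \<integral>\<^sup>+ v. h (nb_quantile r (f u) v) u \<partial>U01 \<partial>noise)"
    by (subst nn_integral_noise_resample[where i = k]) (auto simp: fk hk)
  also have "\<dots> = (\<integral>\<^sup>+ u. (\<Sum>y. ennreal (nb r (f u) y) * h y u) \<partial>noise)"
    by (intro nn_integral_cong nn_integral_U01_quantile r f0)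
  finally show ?thesis .
qed

context garch_orders
begin

section \<open>The solution driven by noise\<close>

lemma ennreal_garch_step:
  assumes \<theta>: "adm \<theta>" and x: "\<And>j. 0 \<le> x j"
  shows "ennreal (garch_step p q \<theta> x u k) = ennreal (om \<theta>)
    + (\<Sum>i=1..p. ennreal (ca \<theta> i) * ennreal (x (k - int i)))
    + (\<Sum>i=1..q. ennreal (cb \<theta> i) * ennreal (real (u (k - int i))))"
proof -
  have "(\<Sum>i=1..p. ennreal (ca \<theta> i) * ennreal (x (k - int i))) = ennreal (\<Sum>i=1..p. ca \<theta> i * x (k - int i))"
    using admD[OF \<theta>] x by (subst sum_ennreal[symmetric]) (auto simp: ennreal_mult intro!: sum.cong)
  moreover have "(\<Sum>i=1..q. ennreal (cb \<theta> i) * ennreal (real (u (k - int i)))) = ennreal (\<Sum>i=1..q. cb \<theta> i * real (u (k - int i)))"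
    using admD[OF \<theta>] by (subst sum_ennreal[symmetric]) (auto simp: ennreal_mult intro!: sum.cong)
  moreover have "0 \<le> (\<Sum>i=1..p. ca \<theta> i * x (k - int i))" "0 \<le> (\<Sum>i=1..q. cb \<theta> i * real (u (k - int i)))"
    using admD[OF \<theta>] x by (auto intro!: sum_nonneg)
  ultimately show ?thesis using admD(1)[OF \<theta>] by (simp add: garch_step_eq ennreal_plus)
qed

lemma adm_sum: assumes "adm \<theta>" shows "(\<Sum>i=1..p. ca \<theta> i) + cr \<theta> * (\<Sum>i=1..q. cb \<theta> i) \<le> 1 - \<eta>"
proof -
  have d: "c \<le> c / \<rho> ^ i" if "0 \<le> c" for c :: real and i
    using that rho power_le_one[of \<rho> i] by (simp add: pos_le_divide_eq mult_left_le)
  have s: "(\<Sum>i=1..p. ca \<theta> i) \<le> (\<Sum>i=1..p. ca \<theta> i / \<rho> ^ i)" "(\<Sum>i=1..q. cb \<theta> i) \<le> (\<Sum>i=1..q. cb \<theta> i / \<rho> ^ i)"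
    using assms by (auto intro!: sum_mono d simp: adm_def)
  have "cr \<theta> * (\<Sum>i=1..q. cb \<theta> i) \<le> cr \<theta> * (\<Sum>i=1..q. cb \<theta> i / \<rho> ^ i)"
    using admD(2)[OF assms] by (intro mult_left_mono s) auto
  then show ?thesis using assms s(1) unfolding adm_def by linarith
qed

abbreviation driven :: "param \<Rightarrow> (int \<Rightarrow> real) \<Rightarrow> int \<Rightarrow> real \<Rightarrow> nat" where
  "driven \<theta> u \<equiv> \<lambda>j x. nb_quantile (cr \<theta>) x (u j)"

lemma driven_path_measurable [measurable]:
  "(\<lambda>u. path_X p q \<theta> x0 (driven \<theta> u) m k) \<in> borel_measurable noise"
  by (rule path_X_measurable) auto

lemma driven_path_upd: "k \<le> j \<Longrightarrow> path_X p q \<theta> x0 (driven \<theta> (u(j := v))) m k = path_X p q \<theta> x0 (driven \<theta> u) m k"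
  by (rule path_X_cong) auto

text \<open>The bound is the fixed point of \<open>B = om \<theta> + (1 - \<eta>) * B\<close>, since
  the mean of \<open>Y\<close> is \<open>cr \<theta>\<close> times that of \<open>X\<close>. Being
  uniform in \<open>m\<close>, it survives the supremum over starting times.\<close>

lemma driven_path_mean:
  assumes \<theta>: "adm \<theta>"
  shows "(\<integral>\<^sup>+ u. ennreal (path_X p q \<theta> (\<lambda>_. 0) (driven \<theta> u) m k) \<partial>noise) \<le> ennreal (om \<theta> / \<eta>)"
proof (induction k rule: int_induct_from[where m = m])
  case (base k)
  then show ?case by (simp add: path_X_init)
next
  case (step k)
  let ?x = "\<lambda>u. path_X p q \<theta> (\<lambda>_. 0) (driven \<theta> u) m"
  let ?B = "ennreal (om \<theta> / \<eta>)"
  note r = admD(2)[OF \<theta>] and x0 = path_X_nonneg[OF \<theta>, of "\<lambda>_. 0"]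
  have Y: "(\<integral>\<^sup>+ u. ennreal (real (driven \<theta> u j (?x u j))) \<partial>noise) = ennreal (cr \<theta>) * (\<integral>\<^sup>+ u. ennreal (?x u j) \<partial>noise)" for j
  proof -
    have "(\<integral>\<^sup>+ u. ennreal (real (driven \<theta> u j (?x u j))) \<partial>noise) = (\<integral>\<^sup>+ u. (\<Sum>y. ennreal (nb (cr \<theta>) (?x u j) y) * ennreal (real y)) \<partial>noise)"
      by (rule nn_integral_noise_quantile[OF r]) (simp_all add: x0 driven_path_upd del: fun_upd_apply)
    also have "\<dots> = (\<integral>\<^sup>+ u. ennreal (cr \<theta>) * ennreal (?x u j) \<partial>noise)"
      using nb_nn_mean[OF r x0] r x0 by (simp add: ennreal_of_nat_eq_real_of_nat ennreal_mult)
    finally show ?thesis by (simp add: nn_integral_cmult)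
  qed
  have "(\<integral>\<^sup>+ u. ennreal (?x u k) \<partial>noise) = (\<integral>\<^sup>+ u. ennreal (om \<theta>)
    + (\<Sum>i=1..p. ennreal (ca \<theta> i) * ennreal (?x u (k - int i)))
    + (\<Sum>i=1..q. ennreal (cb \<theta> i) * ennreal (real (driven \<theta> u (k - int i) (?x u (k - int i))))) \<partial>noise)"
    using step by (intro nn_integral_cong) (simp add: path_X_step ennreal_garch_step[OF \<theta>] x0)
  also have "\<dots> = ennreal (om \<theta>)
    + (\<Sum>i=1..p. ennreal (ca \<theta> i) * (\<integral>\<^sup>+ u. ennreal (?x u (k - int i)) \<partial>noise))
    + (\<Sum>i=1..q. ennreal (cb \<theta> i) * (ennreal (cr \<theta>) * (\<integral>\<^sup>+ u. ennreal (?x u (k - int i)) \<partial>noise)))"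
    by (simp add: nn_integral_add nn_integral_sum nn_integral_cmult Y MP.emeasure_space_1[simplified])
  also have "\<dots> \<le> ennreal (om \<theta>) + (\<Sum>i=1..p. ennreal (ca \<theta> i) * ?B) + (\<Sum>i=1..q. ennreal (cb \<theta> i) * (ennreal (cr \<theta>) * ?B))"
    using step by (intro add_mono sum_mono mult_left_mono) auto
  also have "\<dots> = ennreal (om \<theta> + ((\<Sum>i=1..p. ca \<theta> i) + cr \<theta> * (\<Sum>i=1..q. cb \<theta> i)) * (om \<theta> / \<eta>))"
  proof -
    have B0: "0 \<le> om \<theta> / \<eta>" using admD(1)[OF \<theta>] eta by simp
    have "(\<Sum>i=1..p. ennreal (ca \<theta> i) * ?B) = ennreal ((\<Sum>i=1..p. ca \<theta> i) * (om \<theta> / \<eta>))"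
      unfolding sum_distrib_right using admD[OF \<theta>] B0
      by (subst sum_ennreal[symmetric]) (auto simp: ennreal_mult[symmetric] intro!: sum.cong mult_nonneg_nonneg simp del: times_divide_eq_right)
    moreover have "(\<Sum>i=1..q. ennreal (cb \<theta> i) * (ennreal (cr \<theta>) * ?B)) = ennreal (cr \<theta> * (\<Sum>i=1..q. cb \<theta> i) * (om \<theta> / \<eta>))"
    proof -
      have e: "cr \<theta> * (\<Sum>i=1..q. cb \<theta> i) * (om \<theta> / \<eta>) = (\<Sum>i=1..q. cb \<theta> i * (cr \<theta> * (om \<theta> / \<eta>)))"
        by (simp add: sum_distrib_left sum_distrib_right mult_ac)
      show ?thesis unfolding e using admD[OF \<theta>] B0 r
        by (subst sum_ennreal[symmetric]) (auto simp: ennreal_mult[symmetric] intro!: sum.cong mult_nonneg_nonneg simp del: times_divide_eq_right)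
    qed
    moreover have "0 \<le> (\<Sum>i=1..p. ca \<theta> i) * (om \<theta> / \<eta>)" "0 \<le> cr \<theta> * (\<Sum>i=1..q. cb \<theta> i) * (om \<theta> / \<eta>)"
      using admD[OF \<theta>] r by (intro mult_nonneg_nonneg sum_nonneg B0; simp)+
    ultimately show ?thesis using admD(1)[OF \<theta>] by (simp add: distrib_right add_divide_distrib ennreal_plus[symmetric] add.assoc del: ennreal_plus)
  qed
  also have "\<dots> \<le> ?B"
  proof (rule ennreal_leI)
    have "((\<Sum>i=1..p. ca \<theta> i) + cr \<theta> * (\<Sum>i=1..q. cb \<theta> i)) * (om \<theta> / \<eta>) \<le> (1 - \<eta>) * (om \<theta> / \<eta>)"
      using adm_sum[OF \<theta>] admD(1)[OF \<theta>] eta by (intro mult_right_mono) auto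
    then show "om \<theta> + ((\<Sum>i=1..p. ca \<theta> i) + cr \<theta> * (\<Sum>i=1..q. cb \<theta> i)) * (om \<theta> / \<eta>) \<le> om \<theta> / \<eta>"
      using eta by (simp add: field_simps)
  qed
  finally show ?case .
qed

definition noise_X :: "param \<Rightarrow> int \<Rightarrow> (int \<Rightarrow> real) \<Rightarrow> real" where
  "noise_X \<theta> k u = lim_X p q \<theta> (driven \<theta> u) k"

definition noise_Y :: "param \<Rightarrow> int \<Rightarrow> (int \<Rightarrow> real) \<Rightarrow> nat" where
  "noise_Y \<theta> k u = nb_quantile (cr \<theta>) (noise_X \<theta> k u) (u k)"

lemma noise_X_measurable [measurable]: "noise_X \<theta> k \<in> borel_measurable noise"
  unfolding noise_X_def
proof (rule lim_X_measurable)
  fix j :: int and f :: "(int \<Rightarrow> real) \<Rightarrow> real" assume [measurable]: "f \<in> borel_measurable noise"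
  show "(\<lambda>u. nb_quantile (cr \<theta>) (f u) (u j)) \<in> measurable noise (count_space UNIV)" by measurable
qed

lemma noise_Y_measurable [measurable]: "noise_Y \<theta> k \<in> measurable noise (count_space UNIV)"
  unfolding noise_Y_def by measurable

lemma noise_X_nonneg: "0 \<le> noise_X \<theta> k u"
  by (simp add: noise_X_def lim_X_nonneg)

lemma noise_X_shift: "noise_X \<theta> k (\<lambda>j. u (j + h)) = noise_X \<theta> (k + h) u"
  using lim_X_shift[of p q \<theta> "driven \<theta> u" h k] by (simp add: noise_X_def)

lemma noise_Y_shift: "noise_Y \<theta> k (\<lambda>j. u (j + h)) = noise_Y \<theta> (k + h) u"
  by (simp add: noise_Y_def noise_X_shift)

lemma noise_X_upd: "k \<le> j \<Longrightarrow> noise_X \<theta> k (u(j := v)) = noise_X \<theta> k u"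
  unfolding noise_X_def by (rule lim_X_cong) auto

lemma noise_Y_upd: "k < j \<Longrightarrow> noise_Y \<theta> k (u(j := v)) = noise_Y \<theta> k u"
  unfolding noise_Y_def by (simp add: noise_X_upd)

text \<open>The mean is taken before \<open>enn2real\<close> is applied, so that almost sure
  finiteness can be concluded and is not hidden by a default value.\<close>

lemma noise_SUP_mean:
  assumes \<theta>: "adm \<theta>"
  shows "(\<integral>\<^sup>+ u. (SUP m::int. ennreal (path_X p q \<theta> (\<lambda>_. 0) (driven \<theta> u) m k)) \<partial>noise) \<le> ennreal (om \<theta> / \<eta>)"
proof -
  note mr = mono_resp_quantile[OF admD(2)[OF \<theta>]]
  have "(\<integral>\<^sup>+ u. (SUP m::int. ennreal (path_X p q \<theta> (\<lambda>_. 0) (driven \<theta> u) m k)) \<partial>noise)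
      = (\<integral>\<^sup>+ u. (SUP n. ennreal (path_X p q \<theta> (\<lambda>_. 0) (driven \<theta> u) (- int n) k)) \<partial>noise)"
    by (intro nn_integral_cong lim_X_ennreal_eq[OF \<theta> mr])
  also have "\<dots> = (SUP n. \<integral>\<^sup>+ u. ennreal (path_X p q \<theta> (\<lambda>_. 0) (driven \<theta> u) (- int n) k) \<partial>noise)"
    by (rule nn_integral_monotone_convergence_SUP)
       (auto simp: incseq_def le_fun_def intro!: ennreal_leI path_X_antimono[OF \<theta> mr])
  also have "\<dots> \<le> ennreal (om \<theta> / \<eta>)" by (rule SUP_least) (rule driven_path_mean[OF \<theta>])
  finally show ?thesis .
qed

text \<open>\<open>enn2real\<close> never increases a value; infinite suprema become 0.\<close>

lemma noise_X_mean:
  assumes "adm \<theta>" shows "(\<integral>\<^sup>+ u. ennreal (noise_X \<theta> k u) \<partial>noise) \<le> ennreal (om \<theta> / \<eta>)"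
proof (rule order_trans[OF nn_integral_mono noise_SUP_mean[OF assms, of k]])
  show "ennreal (noise_X \<theta> k u) \<le> (SUP m::int. ennreal (path_X p q \<theta> (\<lambda>_. 0) (driven \<theta> u) m k))" for u
  proof -
    have "ennreal (enn2real x) \<le> x" for x by (cases x) auto
    then show ?thesis unfolding noise_X_def lim_X_def .
  qed
qed

text \<open>Finite means make the suprema finite outside one null set for all \<open>k\<close>; off
  it the recursion holds pathwise.\<close>

lemma noise_recursion:
  assumes \<theta>: "adm \<theta>"
  shows "AE u in noise. \<forall>k. noise_X \<theta> k u = garch_step p q \<theta> (\<lambda>j. noise_X \<theta> j u) (\<lambda>j. noise_Y \<theta> j u) k"
proof -
  note mr = mono_resp_quantile[OF admD(2)[OF \<theta>]]
  have "AE u in noise. (SUP m::int. ennreal (path_X p q \<theta> (\<lambda>_. 0) (driven \<theta> u) m k)) \<noteq> \<infinity>" for k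
    by (rule nn_integral_PInf_AE) (use noise_SUP_mean[OF \<theta>, of k] in \<open>auto simp: top_unique\<close>)
  then have "AE u in noise. \<forall>k. (SUP m::int. ennreal (path_X p q \<theta> (\<lambda>_. 0) (driven \<theta> u) m k)) \<noteq> \<infinity>"
    by (subst AE_all_countable) auto
  then show ?thesis
  proof eventually_elim
    case (elim u)
    have "(SUP m::int. ennreal (path_X p q \<theta> (\<lambda>_. 0) (driven \<theta> u) m k)) < \<infinity>" for k
      using elim by (metis infinity_ennreal_def top.not_eq_extremum)
    from lim_X_recursion[OF \<theta> mr this] show ?case unfolding noise_X_def noise_Y_def by blast
  qed
qed

definition noise_path :: "param \<Rightarrow> (int \<Rightarrow> real) \<Rightarrow> int \<Rightarrow> real \<times> nat" where
  "noise_path \<theta> u k = (noise_X \<theta> k u, noise_Y \<theta> k u)"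

lemma noise_path_measurable [measurable]: "noise_path \<theta> \<in> measurable noise path_space"
  unfolding noise_path_def[abs_def] by (rule path_space_meas) auto

lemma noise_stationary_solution:
  assumes \<theta>: "adm \<theta>"
  shows "stationary_solution p q \<theta> (distr noise path_space (noise_path \<theta>))"
proof -
  note r = admD(2)[OF \<theta>]
  let ?X = "noise_X \<theta>" and ?Y = "noise_Y \<theta>"
  have "nbin_garch_process p q \<theta> noise ?X ?Y"
  proof (rule nbin_garch_processI[OF prob_space_noise _ _ r])
    show "AE u in noise. ?X (k + 1) u = garch_step p q \<theta> (\<lambda>j. ?X j u) (\<lambda>j. ?Y j u) (k + 1)" for k
      using noise_recursion[OF \<theta>] by eventually_elim blast
    fix k y A assume A: "A \<in> sets (past_algebra noise ?X ?Y k)"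
    have "subalgebra noise (past_algebra noise ?X ?Y k)" by (rule past_subalgebra) auto
    then have [measurable]: "A \<in> sets noise" using A by (auto simp: subalgebra_def)
    have "A \<in> sigma_sets UNIV ({?X j -` A \<inter> space noise | j A. j \<le> k \<and> A \<in> sets borel} \<union> {?Y j -` B \<inter> space noise | j B. j \<le> k - 1})"
      using A unfolding past_algebra_def by (subst (asm) sets_measure_of) auto
    \<comment> \<open>Past events at time \<open>k\<close> are insensitive to \<open>u k\<close>:
      this holds for the generators and propagates through the sigma-algebra.\<close>
    then have AI: "u(k := v) \<in> A \<longleftrightarrow> u \<in> A" for u v
      by (induction arbitrary: u v rule: sigma_sets.induct) (auto simp: noise_X_upd noise_Y_upd)
    have "(\<integral>\<^sup>+ u. indicator A u * indicator {v \<in> space noise. ?Y k v = y} u \<partial>noise)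
        = (\<integral>\<^sup>+ u. indicator A u * indicator {y} (nb_quantile (cr \<theta>) (?X k u) (u k)) \<partial>noise)"
      by (intro nn_integral_cong) (auto simp: indicator_def noise_Y_def)
    also have "\<dots> = (\<integral>\<^sup>+ u. (\<Sum>y'. ennreal (nb (cr \<theta>) (?X k u) y') * (indicator A u * indicator {y} y')) \<partial>noise)"
      by (rule nn_integral_noise_quantile[OF r, of _ _ "\<lambda>y' u. indicator A u * indicator {y} y'"])
         (auto simp: noise_X_nonneg noise_X_upd AI indicator_def)
    also have "\<dots> = (\<integral>\<^sup>+ u. indicator A u * ennreal (nb (cr \<theta>) (?X k u) y) \<partial>noise)"
      by (simp only: suminf_indicator_singleton)
    finally show "(\<integral>\<^sup>+ u. indicator A u * indicator {v \<in> space noise. ?Y k v = y} u \<partial>noise)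
        = (\<integral>\<^sup>+ u. indicator A u * ennreal (nb (cr \<theta>) (?X k u) y) \<partial>noise)" .
  qed (auto simp: noise_X_nonneg)
  moreover have "distr noise path_space (\<lambda>u k. (?X (k + h) u, ?Y (k + h) u)) = distr noise path_space (\<lambda>u k. (?X k u, ?Y k u))" for h
  proof -
    have "distr noise path_space (\<lambda>u k. (?X k u, ?Y k u)) = distr (distr noise noise (\<lambda>u k. u (k + h))) path_space (\<lambda>u k. (?X k u, ?Y k u))"
      by (simp add: distr_noise_shift)
    also have "\<dots> = distr noise path_space (\<lambda>u k. (?X (k + h) u, ?Y (k + h) u))"
      by (subst distr_distr[OF path_space_meas noise_shift_meas]) (auto simp: o_def noise_X_shift noise_Y_shift)
    finally show ?thesis ..
  qed
  ultimately show ?thesis using stationary_solutionI[OF _ r] unfolding noise_path_def[abs_def] by blast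
qed

end

section \<open>Uniqueness of the stationary solution\<close>

abbreviation obs_space :: "(int \<Rightarrow> nat) measure" where
  "obs_space \<equiv> Pi\<^sub>M UNIV (\<lambda>_. count_space UNIV)"

abbreviation Ys :: "(int \<Rightarrow> real \<times> nat) \<Rightarrow> int \<Rightarrow> nat" where
  "Ys w \<equiv> \<lambda>k. snd (w k)"

text \<open>\<open>Z\<close> may have infinite mean; truncation at 1 still permits dominated
  convergence.\<close>

lemma truncated_vanish:
  assumes M: "prob_space M" and Z [measurable]: "Z \<in> borel_measurable M" and c: "0 < c" "c < (1::real)"
  shows "(\<lambda>n. \<integral>w. min 1 (\<bar>Z w\<bar> * c ^ n) \<partial>M) \<longlonglongrightarrow> 0"
proof -
  interpret prob_space M by (rule M)
  have "(\<lambda>n. \<integral>w. min 1 (\<bar>Z w\<bar> * c ^ n) \<partial>M) \<longlonglongrightarrow> (\<integral>w. 0 \<partial>M)"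
  proof (rule integral_dominated_convergence[where w = "\<lambda>_. 1"])
    show "AE w in M. (\<lambda>n. min 1 (\<bar>Z w\<bar> * c ^ n)) \<longlonglongrightarrow> 0"
    proof (rule AE_I2)
      fix w
      have "(\<lambda>n. min 1 (\<bar>Z w\<bar> * c ^ n)) \<longlonglongrightarrow> min 1 (\<bar>Z w\<bar> * 0)"
        using c by (intro tendsto_intros LIMSEQ_realpow_zero) auto
      then show "(\<lambda>n. min 1 (\<bar>Z w\<bar> * c ^ n)) \<longlonglongrightarrow> 0" by simp
    qed
  qed (use c in \<open>auto simp: min_def\<close>)
  then show ?thesis by simp
qed

lemma stationary_solution_shift_integral:
  fixes f :: "(int \<Rightarrow> real \<times> nat) \<Rightarrow> real"
  assumes "stationary_solution p q \<theta> P" and [measurable]: "f \<in> borel_measurable path_space"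
  shows "(\<integral>w. f (\<lambda>k. w (k + h)) \<partial>P) = (\<integral>w. f w \<partial>P)"
proof -
  have s: "sets P = sets path_space" and d: "distr P path_space (\<lambda>w k. w (k + h)) = P"
    using assms(1) unfolding stationary_solution_def by blast+
  have m: "(\<lambda>w k. w (k + h)) \<in> measurable P path_space"
    by (rule path_space_shift_meas[OF s])
  have "(\<integral>w. f w \<partial>P) = (\<integral>w. f w \<partial>distr P path_space (\<lambda>w k. w (k + h)))" unfolding d ..
  also have "\<dots> = (\<integral>w. f (\<lambda>k. w (k + h)) \<partial>P)" by (rule integral_distr[OF m]) simp
  finally show ?thesis ..
qed

context garch_orders
begin

text \<open>The filter of the model: the limit of recursions that read the observations
  \<open>y\<close> and start from zero ever earlier.\<close>

definition obs_X :: "param \<Rightarrow> (int \<Rightarrow> nat) \<Rightarrow> int \<Rightarrow> real" where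
  "obs_X \<theta> y k = lim_X p q \<theta> (\<lambda>j _. y j) k"

lemma obs_X_nonneg: "0 \<le> obs_X \<theta> y k"
  by (simp add: obs_X_def lim_X_nonneg)

lemma obs_X_shift: "obs_X \<theta> (\<lambda>j. y (j + h)) k = obs_X \<theta> y (k + h)"
  using lim_X_shift[of p q \<theta> "\<lambda>j _. y j" h k] by (simp add: obs_X_def)

lemma obs_X_measurable:
  assumes "\<And>j. j < k \<Longrightarrow> (\<lambda>w. f w j) \<in> measurable M (count_space UNIV)"
  shows "(\<lambda>w. obs_X \<theta> (f w) k) \<in> borel_measurable M"
  unfolding obs_X_def by (rule lim_X_measurable) (use assms in auto)

text \<open>A nonnegative solution dominates all paths started from zero, hence their limit. The
  path started at \<open>m\<close> is initially off by at most the sum of \<open>p\<close> values of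
  \<open>x\<close>; this gap decays geometrically, and the path lies below the limit.\<close>

lemma obs_X_compare:
  assumes \<theta>: "adm \<theta>" and x0: "\<And>k. 0 \<le> x k" and x: "\<And>k. x k = garch_step p q \<theta> x y k"
  shows "\<And>k. (SUP m::int. ennreal (path_X p q \<theta> (\<lambda>_. 0) (\<lambda>j _. y j) m k)) < \<infinity>"
    and "\<And>k. obs_X \<theta> y k \<le> x k"
    and "\<And>m k. m \<le> k \<Longrightarrow> x k - obs_X \<theta> y k \<le> (\<Sum>i<p. x (m - int i)) * \<rho> powi (k - m)"
proof -
  let ?z = "path_X p q \<theta> (\<lambda>_. 0) (\<lambda>j _. y j)"
  have le: "?z m k \<le> x k" for m k
  proof (induction k rule: int_induct_from[where m = m])
    case (base k)
    then show ?case by (simp add: path_X_init x0)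
  next
    case (step k)
    have "?z m k = garch_step p q \<theta> (?z m) y k" using step by (simp add: path_X_step)
    also have "\<dots> \<le> garch_step p q \<theta> x y k" using step by (intro garch_step_mono[OF \<theta>]) auto
    also have "\<dots> = x k" by (rule x[symmetric])
    finally show ?case .
  qed
  show fin: "(SUP m::int. ennreal (?z m k)) < \<infinity>" for k
  proof -
    have "(SUP m::int. ennreal (?z m k)) \<le> ennreal (x k)" by (intro SUP_least ennreal_leI le)
    also have "\<dots> < \<infinity>" by simp
    finally show ?thesis .
  qed
  note lim = lim_X_limit[OF \<theta> mono_resp_const fin]
  show "obs_X \<theta> y k \<le> x k" for k
    unfolding obs_X_def by (rule LIMSEQ_le_const2[OF lim(1)]) (use le in auto)
  show "x k - obs_X \<theta> y k \<le> (\<Sum>i<p. x (m - int i)) * \<rho> powi (k - m)" if "m \<le> k" for m k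
  proof -
    have "\<bar>x k - ?z m k\<bar> \<le> (\<Sum>i<p. x (m - int i)) * \<rho> powi (k - m)"
    proof (rule same_obs_merge[OF \<theta>, where u = y and u' = y])
      show "?z m k = garch_step p q \<theta> (?z m) y k" if "m < k" for k using that by (simp add: path_X_step)
      show "\<bar>x j - ?z m j\<bar> \<le> (\<Sum>i<p. x (m - int i))" if "m - int p < j" "j \<le> m" for j
      proof -
        have "x (m - int (nat (m - j))) \<le> (\<Sum>i<p. x (m - int i))"
          by (rule member_le_sum) (use that x0 in auto)
        then show ?thesis using that x0 by (simp add: path_X_init)
      qed
      show "0 \<le> (\<Sum>i<p. x (m - int i))" by (intro sum_nonneg x0)
    qed (use p1 that in \<open>auto intro: x\<close>)
    moreover have "?z m k \<le> obs_X \<theta> y k" unfolding obs_X_def by (rule lim(2))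
    ultimately show ?thesis by linarith
  qed
qed

lemma stationary_solutionD:
  assumes "stationary_solution p q \<theta> P"
  shows "prob_space P" "sets P = sets path_space"
    "nbin_garch_process p q \<theta> P (\<lambda>k w. fst (w k)) (\<lambda>k w. snd (w k))"
    "AE w in P. \<forall>k. 0 \<le> fst (w k) \<and> fst (w k) = garch_step p q \<theta> (\<lambda>j. fst (w j)) (Ys w) k"
proof -
  show G: "nbin_garch_process p q \<theta> P (\<lambda>k w. fst (w k)) (\<lambda>k w. snd (w k))"
    using assms unfolding stationary_solution_def by blast
  show "prob_space P" using G unfolding nbin_garch_process_def by blast
  show "AE w in P. \<forall>k. 0 \<le> fst (w k) \<and> fst (w k) = garch_step p q \<theta> (\<lambda>j. fst (w j)) (Ys w) k"
    using nbin_garch_processD(4,5)[OF G] by (subst AE_all_countable) auto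
qed (use assms in \<open>auto simp: stationary_solution_def\<close>)

text \<open>Comparison from time \<open>k - n\<close> bounds the gap by a shifted copy of
  \<open>Z\<close> times \<open>\<rho> ^ n\<close>. Stationarity gives every copy the law of
  \<open>Z\<close>, so the truncated mean of the gap is 0.\<close>

lemma solution_X_eq_obs_X:
  assumes \<theta>: "adm \<theta>" and P: "stationary_solution p q \<theta> P"
  shows "AE w in P. \<forall>k. fst (w k) = obs_X \<theta> (Ys w) k"
proof -
  note D = stationary_solutionD[OF P]
  interpret prob_space P by (rule D)
  note [measurable_cong] = D(2)
  have om [measurable]: "(\<lambda>w. obs_X \<theta> (Ys w) k) \<in> borel_measurable path_space" for k
    by (rule obs_X_measurable) measurable
  have "AE w in P. fst (w k) = obs_X \<theta> (Ys w) k" for k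
  proof -
    define Z :: "(int \<Rightarrow> real \<times> nat) \<Rightarrow> real" where "Z w = (\<Sum>i<p. fst (w (k - int i)))" for w
    have Zm [measurable]: "Z \<in> borel_measurable path_space" unfolding Z_def[abs_def] by measurable
    let ?d = "\<lambda>w. min 1 (fst (w k) - obs_X \<theta> (Ys w) k)"
    have bound: "AE w in P. 0 \<le> ?d w \<and> (\<forall>n. ?d w \<le> min 1 (\<bar>Z (\<lambda>j. w (j + (- int n)))\<bar> * \<rho> ^ n))"
      using D(4)
    proof eventually_elim
      case (elim w)
      have x: "\<And>k. 0 \<le> fst (w k)" "\<And>k. fst (w k) = garch_step p q \<theta> (\<lambda>j. fst (w j)) (Ys w) k"
        using elim by blast+
      note c = obs_X_compare(2,3)[of \<theta> "\<lambda>j. fst (w j)" "Ys w", OF \<theta> x]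
      have "?d w \<le> min 1 (\<bar>Z (\<lambda>j. w (j + (- int n)))\<bar> * \<rho> ^ n)" for n
      proof -
        have "fst (w k) - obs_X \<theta> (Ys w) k \<le> (\<Sum>i<p. fst (w (k - int n - int i))) * \<rho> powi (k - (k - int n))"
          by (rule c(2)) simp
        also have "\<dots> = Z (\<lambda>j. w (j + (- int n))) * \<rho> ^ n" by (simp add: Z_def algebra_simps)
        also have "\<dots> \<le> \<bar>Z (\<lambda>j. w (j + (- int n)))\<bar> * \<rho> ^ n" using rho by (intro mult_right_mono) auto
        finally show ?thesis by simp
      qed
      then show ?case using c(1)[of k] by auto
    qed
    have dm: "integrable P ?d"
    proof (rule integrable_const_bound[where B = 1])
      show "AE w in P. norm (?d w) \<le> 1" using bound by eventually_elim auto
    qed measurable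
    have le: "(\<integral>w. ?d w \<partial>P) \<le> (\<integral>w. min 1 (\<bar>Z w\<bar> * \<rho> ^ n) \<partial>P)" for n
    proof -
      have sh: "(\<lambda>w j. w (j + (- int n))) \<in> measurable P path_space"
        by (rule path_space_shift_meas[OF D(2)])
      have [measurable]: "(\<lambda>w. Z (\<lambda>j. w (j + (- int n)))) \<in> borel_measurable P"
        by (rule measurable_compose[OF sh Zm])
      have "(\<integral>w. ?d w \<partial>P) \<le> (\<integral>w. min 1 (\<bar>Z (\<lambda>j. w (j + (- int n)))\<bar> * \<rho> ^ n) \<partial>P)"
      proof (rule integral_mono_AE[OF dm])
        show "integrable P (\<lambda>w. min 1 (\<bar>Z (\<lambda>j. w (j + (- int n)))\<bar> * \<rho> ^ n))"
        proof (rule integrable_const_bound[where B = 1])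
          show "(\<lambda>w. min 1 (\<bar>Z (\<lambda>j. w (j + (- int n)))\<bar> * \<rho> ^ n)) \<in> borel_measurable P" by measurable
        qed (use rho in auto)
      qed (use bound in \<open>eventually_elim, blast\<close>)
      also have "\<dots> = (\<integral>w. min 1 (\<bar>Z w\<bar> * \<rho> ^ n) \<partial>P)"
        by (rule stationary_solution_shift_integral[OF P, of "\<lambda>w. min 1 (\<bar>Z w\<bar> * \<rho> ^ n)"]) measurable
      finally show ?thesis .
    qed
    have "(\<integral>w. ?d w \<partial>P) \<le> 0"
      by (rule LIMSEQ_le_const[OF truncated_vanish[OF D(1) _ rho, of Z]]) (use le in auto)
    moreover have "0 \<le> (\<integral>w. ?d w \<partial>P)" using bound by (intro integral_nonneg_AE) auto
    ultimately have "(\<integral>w. ?d w \<partial>P) = 0" by simp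
    then have "AE w in P. ?d w = 0"
      using integral_nonneg_eq_0_iff_AE[OF dm] bound by auto
    then show ?thesis by eventually_elim (auto simp: min_def split: if_splits)
  qed
  then show ?thesis by (subst AE_all_countable) auto
qed

text \<open>
  The path that coincides with \<open>(x0, y0)\<close> up to \<open>X\<^sub>m\<close> and is driven by the noise \<open>u\<close> from \<open>Y\<^sub>m\<close> on.
\<close>

abbreviation resume :: "param \<Rightarrow> (int \<Rightarrow> nat) \<Rightarrow> int \<Rightarrow> (int \<Rightarrow> real) \<Rightarrow> int \<Rightarrow> real \<Rightarrow> nat" where
  "resume \<theta> y0 m u \<equiv> \<lambda>j x. if j < m then y0 j else nb_quantile (cr \<theta>) x (u j)"

definition cont_X :: "param \<Rightarrow> (int \<Rightarrow> real) \<Rightarrow> (int \<Rightarrow> nat) \<Rightarrow> int \<Rightarrow> (int \<Rightarrow> real) \<Rightarrow> int \<Rightarrow> real" where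
  "cont_X \<theta> x0 y0 m u = path_X p q \<theta> x0 (resume \<theta> y0 m u) m"

definition cont_Y :: "param \<Rightarrow> (int \<Rightarrow> real) \<Rightarrow> (int \<Rightarrow> nat) \<Rightarrow> int \<Rightarrow> (int \<Rightarrow> real) \<Rightarrow> int \<Rightarrow> nat" where
  "cont_Y \<theta> x0 y0 m u j = resume \<theta> y0 m u j (cont_X \<theta> x0 y0 m u j)"

text \<open>Resuming at \<open>m + 1\<close> requires \<open>X\<close> up to \<open>m + 1\<close>:
  the given past is continued by one step as if the observation at \<open>m\<close> were
  \<open>y\<close>.\<close>

definition ins_X :: "param \<Rightarrow> (int \<Rightarrow> real) \<Rightarrow> (int \<Rightarrow> nat) \<Rightarrow> int \<Rightarrow> nat \<Rightarrow> int \<Rightarrow> real" where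
  "ins_X \<theta> x0 y0 m y = x0(m + 1 := garch_step p q \<theta> x0 (y0(m := y)) (m + 1))"

text \<open>Splits off the first resumed observation: once its value is fixed, the rest of the path
  reads only noise after \<open>m\<close>.\<close>

lemma cont_X_ins:
  "cont_X \<theta> x0 y0 m u k = (let y = nb_quantile (cr \<theta>) (x0 m) (u m) in cont_X \<theta> (ins_X \<theta> x0 y0 m y) (y0(m := y)) (m + 1) u k)"
proof -
  define y where "y = nb_quantile (cr \<theta>) (x0 m) (u m)"
  have "cont_X \<theta> x0 y0 m u k = cont_X \<theta> (ins_X \<theta> x0 y0 m y) (y0(m := y)) (m + 1) u k"
  proof (induction k rule: int_induct_from[where m = "m + 1"])
    case (base k)
    show ?case
    proof (cases "k \<le> m")
      case True
      then show ?thesis by (simp add: cont_X_def path_X_init ins_X_def)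
    next
      case False
      then have k: "k = m + 1" using base by simp
      show ?thesis unfolding k cont_X_def
        by (simp add: path_X_init path_X_step ins_X_def, unfold garch_step_eq)
           (auto simp: path_X_init y_def intro!: sum.cong arg_cong2[where f = "(+)"])
    qed
  next
    case (step k)
    have "path_X p q \<theta> x0 (resume \<theta> y0 m u) m (k - int i) =
        path_X p q \<theta> (ins_X \<theta> x0 y0 m y) (resume \<theta> (y0(m := y)) (m + 1) u) (m + 1) (k - int i)" if "1 \<le> i" for i
      by (rule step.IH[of "k - int i", unfolded cont_X_def]) (use that in auto)
    moreover have "resume \<theta> y0 m u j (path_X p q \<theta> x0 (resume \<theta> y0 m u) m j) =
        resume \<theta> (y0(m := y)) (m + 1) u j (path_X p q \<theta> (ins_X \<theta> x0 y0 m y) (resume \<theta> (y0(m := y)) (m + 1) u) (m + 1) j)"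
      if "j < k" for j
      using step.IH[OF that, unfolded cont_X_def]
      by (cases j m rule: linorder_cases) (simp_all add: y_def path_X_init del: fun_upd_apply, simp_all)
    ultimately show ?case using step.hyps unfolding cont_X_def
      by (subst (1 2) path_X_step) (auto simp: garch_step_eq intro!: sum.cong arg_cong2[where f = "(+)"])
  qed
  then show ?thesis by (simp add: Let_def y_def)
qed

lemma cont_Y_ins:
  "cont_Y \<theta> x0 y0 m u j = (let y = nb_quantile (cr \<theta>) (x0 m) (u m) in cont_Y \<theta> (ins_X \<theta> x0 y0 m y) (y0(m := y)) (m + 1) u j)"
  using cont_X_ins[of \<theta> x0 y0 m u j]
  by (cases "j = m") (auto simp: cont_Y_def Let_def cont_X_def path_X_init)

text \<open>A path that obeys the recursion reproduces its own next \<open>X\<close> when its actual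
  observation is inserted.\<close>

lemma cont_Y_ins_real:
  assumes "x0 (m + 1) = garch_step p q \<theta> x0 y0 (m + 1)"
  shows "cont_Y \<theta> (ins_X \<theta> x0 y0 m (y0 m)) (y0(m := y0 m)) (m + 1) u = cont_Y \<theta> x0 y0 (m + 1) u"
  using assms by (simp add: ins_X_def fun_upd_idem)

lemma cont_Y_upd: "cont_Y \<theta> x0 y0 (m + 1) (u(m := v)) j = cont_Y \<theta> x0 y0 (m + 1) u j"
proof -
  have "cont_X \<theta> x0 y0 (m + 1) (u(m := v)) j = cont_X \<theta> x0 y0 (m + 1) u j"
    unfolding cont_X_def by (rule path_X_cong) auto
  then show ?thesis by (simp add: cont_Y_def)
qed

lemma cont_X_measurable:
  assumes x0: "\<And>j. j \<le> m \<Longrightarrow> (\<lambda>w. x0 w j) \<in> borel_measurable M"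
    and y0: "\<And>j. j < m \<Longrightarrow> (\<lambda>w. y0 w j) \<in> measurable M (count_space UNIV)"
    and u: "\<And>j. (\<lambda>w. u w j) \<in> borel_measurable M"
  shows "(\<lambda>w. cont_X \<theta> (x0 w) (y0 w) m (u w) k) \<in> borel_measurable M"
  unfolding cont_X_def
proof (rule path_X_measurable)
  fix j :: int and f :: "'a \<Rightarrow> real" assume [measurable]: "f \<in> borel_measurable M"
  show "(\<lambda>w. resume \<theta> (y0 w) m (u w) j (f w)) \<in> measurable M (count_space UNIV)"
    using y0[of j] u[of j] by (cases "j < m") auto
qed (rule x0)

lemma cont_Y_measurable:
  assumes x0: "\<And>j. j \<le> m \<Longrightarrow> (\<lambda>w. x0 w j) \<in> borel_measurable M"
    and y0: "\<And>j. j < m \<Longrightarrow> (\<lambda>w. y0 w j) \<in> measurable M (count_space UNIV)"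
    and u: "\<And>j. (\<lambda>w. u w j) \<in> borel_measurable M"
  shows "(\<lambda>w. cont_Y \<theta> (x0 w) (y0 w) m (u w) k) \<in> measurable M (count_space UNIV)"
  unfolding cont_Y_def using cont_X_measurable[of m x0 M y0 u \<theta> k, OF assms] y0[of k] u[of k]
  by (cases "k < m") auto

lemma ins_X_measurable:
  assumes x0: "\<And>j. j \<le> m \<Longrightarrow> (\<lambda>w. x0 w j) \<in> borel_measurable M"
    and y0: "\<And>j. j < m \<Longrightarrow> (\<lambda>w. y0 w j) \<in> measurable M (count_space UNIV)"
    and j: "j \<le> m + 1"
  shows "(\<lambda>w. ins_X \<theta> (x0 w) (y0 w) m y j) \<in> borel_measurable M"
proof (cases "j = m + 1")
  case True
  have [measurable]: "(\<lambda>w. x0 w (m + 1 - int i)) \<in> borel_measurable M" if "1 \<le> i" for i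
    using that by (intro x0) auto
  have [measurable]: "(\<lambda>w. ((y0 w)(m := y)) (m + 1 - int i)) \<in> measurable M (count_space UNIV)" if "1 \<le> i" for i
    using that by (cases "i = 1") (auto intro!: y0)
  show ?thesis using True unfolding ins_X_def garch_step_eq by (simp del: fun_upd_apply add: fun_upd_same)
next
  case False
  then show ?thesis using j x0[of j] by (simp add: ins_X_def)
qed

end

lemma cylinder_indicator_measurable:
  assumes "finite J" "\<And>j. j \<in> J \<Longrightarrow> (\<lambda>w. g w j) \<in> measurable M (count_space UNIV)"
  shows "(\<lambda>w. indicator {y. \<forall>j\<in>J. y j \<in> F j} (g w) :: ennreal) \<in> borel_measurable M"
proof -
  have "(\<lambda>w. indicator {y. \<forall>j\<in>J. y j \<in> F j} (g w) :: ennreal) = (\<lambda>w. \<Prod>j\<in>J. indicator (F j) (g w j))"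
    using assms(1) by (auto simp: fun_eq_iff indicator_def prod_zero_iff intro!: prod.neutral)
  also have "\<dots> \<in> borel_measurable M"
    using assms(2) by (intro borel_measurable_prod_ennreal measurable_compose[OF assms(2)]) auto
  finally show ?thesis .
qed

context garch_orders
begin

abbreviation Xs :: "(int \<Rightarrow> real \<times> nat) \<Rightarrow> int \<Rightarrow> real" where
  "Xs w \<equiv> \<lambda>k. fst (w k)"

lemma pair_coord_measurable:
  assumes "sets P = sets path_space"
  shows "(\<lambda>z. fst (fst z j)) \<in> borel_measurable (P \<Otimes>\<^sub>M noise)"
    "(\<lambda>z. snd (fst z j)) \<in> measurable (P \<Otimes>\<^sub>M noise) (count_space UNIV)"
    "(\<lambda>z. snd z j) \<in> borel_measurable (P \<Otimes>\<^sub>M noise)"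
  using path_space_coord[of j]
  by (auto intro!: measurable_compose[OF measurable_fst] measurable_compose[OF measurable_snd noise_coord]
      simp: measurable_cong_sets[OF assms refl])

text \<open>
  The value at time \<open>m\<close> is resampled from the transition law, so resuming from time \<open>m\<close> or from time \<open>m + 1\<close>
  gives the same law.
\<close>

lemma resume_step:
  fixes F :: "int \<Rightarrow> nat set"
  assumes \<theta>: "adm \<theta>" and P: "stationary_solution p q \<theta> P" and J: "finite J"
  defines "f \<equiv> indicator {y. \<forall>j\<in>J. y j \<in> F j} :: (int \<Rightarrow> nat) \<Rightarrow> ennreal"
  shows "(\<integral>\<^sup>+ w. \<integral>\<^sup>+ u. f (cont_Y \<theta> (Xs w) (Ys w) m u) \<partial>noise \<partial>P) =
    (\<integral>\<^sup>+ w. \<integral>\<^sup>+ u. f (cont_Y \<theta> (Xs w) (Ys w) (m + 1) u) \<partial>noise \<partial>P)"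
proof -
  note D = stationary_solutionD[OF P] and r = admD(2)[OF \<theta>]
  interpret P: prob_space P by (rule D)
  interpret PN: pair_sigma_finite P noise
    by (intro pair_sigma_finite.intro P.sigma_finite_measure_axioms MP.sigma_finite_measure_axioms)
  note [measurable_cong] = D(2)
  note PM = pair_coord_measurable[OF D(2)]
  \<comment> \<open>The observation at time \<open>m\<close> is kept as a free argument: for fixed
    \<open>y\<close> the path depends on \<open>w\<close> only through the past, and on the noise
    only after \<open>m\<close>.\<close>
  define \<Gamma> where "\<Gamma> y w u = cont_Y \<theta> (ins_X \<theta> (Xs w) (Ys w) m y) ((Ys w)(m := y)) (m + 1) u" for y w u
  let ?F = "past_algebra P (\<lambda>k w. fst (w k)) (\<lambda>k w. snd (w k)) m"
  have upd: "(\<lambda>z. ((v z)(m := y)) j) \<in> measurable N (count_space UNIV)"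
    if "\<And>j. j < m \<Longrightarrow> (\<lambda>z. v z j) \<in> measurable N (count_space UNIV)" "j < m + 1" for v :: "'z \<Rightarrow> int \<Rightarrow> nat" and N y j
    using that by (cases "j = m") auto
  have \<Gamma>_joint: "(\<lambda>z. f (\<Gamma> y (fst z) (snd z))) \<in> borel_measurable (P \<Otimes>\<^sub>M noise)" for y
    unfolding f_def
  proof (rule cylinder_indicator_measurable[OF J])
    fix j
    show "(\<lambda>z. \<Gamma> y (fst z) (snd z) j) \<in> measurable (P \<Otimes>\<^sub>M noise) (count_space UNIV)"
      unfolding \<Gamma>_def
      by (rule cont_Y_measurable, rule ins_X_measurable, rule PM(1), rule PM(2), assumption, rule upd, rule PM(2), assumption, rule PM(3))
  qed
  have \<Gamma>_past: "(\<lambda>w. f (\<Gamma> y w u)) \<in> borel_measurable ?F" for y u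
    unfolding f_def
  proof (rule cylinder_indicator_measurable[OF J])
    fix j
    have x: "(\<lambda>w. fst (w j)) \<in> borel_measurable ?F" if "j \<le> m" for j by (rule past_algebra_X[OF that])
    have y: "(\<lambda>w. snd (w j)) \<in> measurable ?F (count_space UNIV)" if "j < m" for j by (rule past_algebra_Y[OF that])
    show "(\<lambda>w. \<Gamma> y w u j) \<in> measurable ?F (count_space UNIV)"
      unfolding \<Gamma>_def
      by (rule cont_Y_measurable, rule ins_X_measurable[OF x y], assumption+, rule upd[OF y]) auto
  qed
  have \<Gamma>_noise: "(\<lambda>u. f (\<Gamma> y w u)) \<in> borel_measurable noise" for y w
    unfolding f_def
  proof (rule cylinder_indicator_measurable[OF J])
    show "(\<lambda>u. \<Gamma> y w u j) \<in> measurable noise (count_space UNIV)" for j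
      unfolding \<Gamma>_def by (rule cont_Y_measurable) auto
  qed
  have nb_joint: "(\<lambda>z. ennreal (nb (cr \<theta>) (fst (fst z m)) y)) \<in> borel_measurable (P \<Otimes>\<^sub>M noise)" for y
    by (intro measurable_compose[OF measurable_compose[OF PM(1) nb_measurable]]) auto
  have "(\<integral>\<^sup>+ w. \<integral>\<^sup>+ u. f (cont_Y \<theta> (Xs w) (Ys w) m u) \<partial>noise \<partial>P) =
      (\<integral>\<^sup>+ w. \<integral>\<^sup>+ u. (\<Sum>y. ennreal (nb (cr \<theta>) (fst (w m)) y) * f (\<Gamma> y w u)) \<partial>noise \<partial>P)"
  proof (rule nn_integral_cong_AE, use D(4) in eventually_elim)
    case (elim w)
    have "cont_Y \<theta> (Xs w) (Ys w) m u = \<Gamma> (nb_quantile (cr \<theta>) (fst (w m)) (u m)) w u" for u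
      unfolding \<Gamma>_def by (rule ext, subst cont_Y_ins) (simp only: Let_def)
    then have "(\<integral>\<^sup>+ u. f (cont_Y \<theta> (Xs w) (Ys w) m u) \<partial>noise) =
        (\<integral>\<^sup>+ u. f (\<Gamma> (nb_quantile (cr \<theta>) (fst (w m)) (u m)) w u) \<partial>noise)" by simp
    also have "\<dots> = (\<integral>\<^sup>+ u. (\<Sum>y. ennreal (nb (cr \<theta>) (fst (w m)) y) * f (\<Gamma> y w u)) \<partial>noise)"
    proof (rule nn_integral_noise_quantile[OF r, of "\<lambda>_. fst (w m)" m "\<lambda>y u. f (\<Gamma> y w u)"])
      show "f (\<Gamma> y w (u(m := v))) = f (\<Gamma> y w u)" for y u v
        unfolding \<Gamma>_def by (intro arg_cong[where f = f] ext cont_Y_upd)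
      show "(\<lambda>u. f (\<Gamma> y w u)) \<in> borel_measurable noise" for y by (rule \<Gamma>_noise)
      show "0 \<le> fst (w m)" using elim by blast
    qed (rule borel_measurable_const refl)+
    finally show ?case .
  qed
  \<comment> \<open>With the noise frozen, the integrand is past-measurable for each
    \<open>y\<close>, so the transition identity can put the actual observation of \<open>w\<close>
    in place of the sum.\<close>
  also have "\<dots> = (\<integral>\<^sup>+ u. \<integral>\<^sup>+ w. (\<Sum>y. ennreal (nb (cr \<theta>) (fst (w m)) y) * f (\<Gamma> y w u)) \<partial>P \<partial>noise)"
    using \<Gamma>_joint nb_joint by (intro PN.Fubini'[symmetric]) (auto simp: split_beta)
  also have "\<dots> = (\<integral>\<^sup>+ u. \<integral>\<^sup>+ w. f (\<Gamma> (snd (w m)) w u) \<partial>P \<partial>noise)"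
    by (intro nn_integral_cong nbin_garch_transition[OF D(3) r, symmetric] \<Gamma>_past)
  also have "\<dots> = (\<integral>\<^sup>+ w. \<integral>\<^sup>+ u. f (\<Gamma> (snd (w m)) w u) \<partial>noise \<partial>P)"
  proof (intro PN.Fubini')
    have "(\<lambda>z. f (\<Gamma> (snd (fst z m)) (fst z) (snd z))) \<in> borel_measurable (P \<Otimes>\<^sub>M noise)"
      by (rule measurable_compose_countable[where f = "\<lambda>y z. f (\<Gamma> y (fst z) (snd z))", OF \<Gamma>_joint PM(2)])
    then show "(\<lambda>(w, u). f (\<Gamma> (snd (w m)) w u)) \<in> borel_measurable (P \<Otimes>\<^sub>M noise)" by (simp add: split_beta)
  qed
  also have "\<dots> = (\<integral>\<^sup>+ w. \<integral>\<^sup>+ u. f (cont_Y \<theta> (Xs w) (Ys w) (m + 1) u) \<partial>noise \<partial>P)"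
  proof (rule nn_integral_cong_AE, use D(4) in eventually_elim)
    case (elim w)
    then have "\<Gamma> (snd (w m)) w u = cont_Y \<theta> (Xs w) (Ys w) (m + 1) u" for u
      unfolding \<Gamma>_def by (intro cont_Y_ins_real) blast
    then show ?case by simp
  qed
  finally show ?thesis .
qed

text \<open>Resampling step by step preserves the law, and once the resumption time lies beyond
  \<open>J\<close> only actual observations remain.\<close>

lemma emeasure_resume:
  assumes \<theta>: "adm \<theta>" and P: "stationary_solution p q \<theta> P" and J: "finite J"
  shows "emeasure P {w \<in> space P. \<forall>j\<in>J. snd (w j) \<in> F j} =
    (\<integral>\<^sup>+ w. emeasure noise {u. \<forall>j\<in>J. cont_Y \<theta> (Xs w) (Ys w) 0 u j \<in> F j} \<partial>P)"
proof -
  note D = stationary_solutionD[OF P]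
  interpret P: prob_space P by (rule D)
  note [measurable_cong] = D(2)
  let ?f = "indicator {y. \<forall>j\<in>J. y j \<in> F j} :: (int \<Rightarrow> nat) \<Rightarrow> ennreal"
  have T: "(\<integral>\<^sup>+ w. \<integral>\<^sup>+ u. ?f (cont_Y \<theta> (Xs w) (Ys w) 0 u) \<partial>noise \<partial>P) =
      (\<integral>\<^sup>+ w. \<integral>\<^sup>+ u. ?f (cont_Y \<theta> (Xs w) (Ys w) (int n) u) \<partial>noise \<partial>P)" for n
  proof (induction n)
    case (Suc n)
    then show ?case using resume_step[OF \<theta> P J, of F "int n"] by (simp add: add.commute)
  qed simp
  obtain N :: nat where N: "\<And>j. j \<in> J \<Longrightarrow> \<bar>j\<bar> \<le> int N" using finite_int_bound[OF J] by blast
  \<comment> \<open>Only observations strictly before the resumption time are kept, so it must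
    exceed every element of \<open>J\<close>.\<close>
  define n where "n = Suc N"
  have n: "j < int n" if "j \<in> J" for j using N[OF that] by (simp add: n_def)
  have m: "{u. \<forall>j\<in>J. cont_Y \<theta> x0 y0 0 u j \<in> F j} \<in> sets noise" for x0 y0
  proof -
    have "{u \<in> space noise. \<forall>j\<in>J. cont_Y \<theta> x0 y0 0 u j \<in> F j} \<in> sets noise"
    proof (intro sets.sets_Collect_finite_All J)
      fix j
      have [measurable]: "(\<lambda>u. cont_Y \<theta> x0 y0 0 u j) \<in> measurable noise (count_space UNIV)"
        by (rule cont_Y_measurable) auto
      show "{u \<in> space noise. cont_Y \<theta> x0 y0 0 u j \<in> F j} \<in> sets noise" by measurable
    qed
    then show ?thesis by simp
  qed
  have "(\<integral>\<^sup>+ w. emeasure noise {u. \<forall>j\<in>J. cont_Y \<theta> (Xs w) (Ys w) 0 u j \<in> F j} \<partial>P) =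
      (\<integral>\<^sup>+ w. \<integral>\<^sup>+ u. ?f (cont_Y \<theta> (Xs w) (Ys w) 0 u) \<partial>noise \<partial>P)"
    by (intro nn_integral_cong) (auto simp: nn_integral_indicator[OF m, symmetric] indicator_def intro!: nn_integral_cong)
  also have "\<dots> = (\<integral>\<^sup>+ w. \<integral>\<^sup>+ u. ?f (cont_Y \<theta> (Xs w) (Ys w) (int n) u) \<partial>noise \<partial>P)" by (rule T)
  also have "\<dots> = (\<integral>\<^sup>+ w. ?f (Ys w) \<partial>P)"
  proof (intro nn_integral_cong)
    fix w
    have "?f (cont_Y \<theta> (Xs w) (Ys w) (int n) u) = ?f (Ys w)" for u
      using n by (auto simp: indicator_def cont_Y_def)
    then show "(\<integral>\<^sup>+ u. ?f (cont_Y \<theta> (Xs w) (Ys w) (int n) u) \<partial>noise) = ?f (Ys w)"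
      using MP.emeasure_space_1 by simp
  qed
  also have "\<dots> = (\<integral>\<^sup>+ w. indicator {w \<in> space P. \<forall>j\<in>J. snd (w j) \<in> F j} w \<partial>P)"
    by (intro nn_integral_cong) (auto simp: indicator_def)
  also have "\<dots> = emeasure P {w \<in> space P. \<forall>j\<in>J. snd (w j) \<in> F j}"
  proof (intro nn_integral_indicator sets.sets_Collect_finite_All J)
    show "{w \<in> space P. snd (w j) \<in> F j} \<in> sets P" for j by measurable
  qed
  finally show ?thesis ..
qed

text \<open>Synchronous coupling: both paths use the same noise, and the transition is a contraction in mean.\<close>

lemma cont_merge:
  fixes x0 :: "int \<Rightarrow> real" and y0 :: "int \<Rightarrow> nat"
  assumes \<theta>: "adm \<theta>" and x0: "\<And>k. 0 \<le> x0 k"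
  defines "V \<equiv> (\<Sum>i\<le>p + q. x0 (- int i)) + (\<Sum>i\<le>p + q. real (y0 (- int i))) / cr \<theta>"
  shows "- int (p + q) \<le> k \<Longrightarrow>
      (\<integral>\<^sup>+ u. ennreal \<bar>cont_X \<theta> x0 y0 0 u k - cont_X \<theta> (\<lambda>_. 0) (\<lambda>_. 0) 0 u k\<bar> \<partial>noise) \<le> ennreal (V * \<rho> powi k)"
    and "- int (p + q) \<le> k \<Longrightarrow>
      (\<integral>\<^sup>+ u. ennreal \<bar>real (cont_Y \<theta> x0 y0 0 u k) - real (cont_Y \<theta> (\<lambda>_. 0) (\<lambda>_. 0) 0 u k)\<bar> \<partial>noise) \<le> ennreal (cr \<theta> * V * \<rho> powi k)"
proof -
  note r = admD(2)[OF \<theta>]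
  let ?x = "\<lambda>u. cont_X \<theta> x0 y0 0 u" and ?x' = "\<lambda>u. cont_X \<theta> (\<lambda>_. 0) (\<lambda>_. 0) 0 u"
  let ?y = "\<lambda>u. cont_Y \<theta> x0 y0 0 u" and ?y' = "\<lambda>u. cont_Y \<theta> (\<lambda>_. 0) (\<lambda>_. 0) 0 u"
  \<comment> \<open>\<open>V\<close> dominates \<open>X\<close> and \<open>Y / cr \<theta>\<close>
    on the whole window to which the recursion can reach back; the division matches the target
    \<open>cr \<theta> * V\<close> for \<open>Y\<close>.\<close>
  have V1: "x0 k \<le> V" and V2: "real (y0 k) \<le> cr \<theta> * V" if "- int (p + q) \<le> k" "k \<le> 0" for k
  proof -
    have a: "x0 (- int (nat (- k))) \<le> (\<Sum>i\<le>p + q. x0 (- int i))"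
      by (rule member_le_sum) (use that x0 in auto)
    have b: "real (y0 (- int (nat (- k)))) \<le> (\<Sum>i\<le>p + q. real (y0 (- int i)))"
      by (rule member_le_sum) (use that in auto)
    have c: "0 \<le> (\<Sum>i\<le>p + q. x0 (- int i))" by (intro sum_nonneg x0)
    show "x0 k \<le> V" using a that r unfolding V_def by (auto intro!: add_increasing2 divide_nonneg_pos sum_nonneg)
    have "real (y0 k) \<le> cr \<theta> * (\<Sum>i\<le>p + q. x0 (- int i)) + (\<Sum>i\<le>p + q. real (y0 (- int i)))"
      using b c that r by (auto intro!: add_increasing mult_nonneg_nonneg)
    then show "real (y0 k) \<le> cr \<theta> * V" using r unfolding V_def by (simp add: distrib_left)
  qed
  have V0: "0 \<le> V" using V1[of 0] x0[of 0] by auto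
  have xm [measurable]: "(\<lambda>u. cont_X \<theta> a b 0 u j) \<in> borel_measurable noise" for a b j
    by (rule cont_X_measurable) auto
  have ym [measurable]: "(\<lambda>u. cont_Y \<theta> a b 0 u j) \<in> measurable noise (count_space UNIV)" for a b j
    by (rule cont_Y_measurable) auto
  have xnn: "0 \<le> ?x u j" "0 \<le> ?x' u j" for u j
    unfolding cont_X_def by (intro path_X_nonneg[OF \<theta>] x0 order_refl)+
  have xupd: "cont_X \<theta> a b 0 (u(j := v)) j = cont_X \<theta> a b 0 u j" for a b u j v
    unfolding cont_X_def by (rule path_X_cong) auto
  let ?d = "\<lambda>k. \<integral>\<^sup>+ u. ennreal \<bar>?x u k - ?x' u k\<bar> \<partial>noise"
  let ?e = "\<lambda>k. \<integral>\<^sup>+ u. ennreal \<bar>real (?y u k) - real (?y' u k)\<bar> \<partial>noise"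
  have pow1: "1 \<le> \<rho> powi k" if "k \<le> 0" for k using powi_init[OF that] .
  have ypos: "?e k = ennreal (cr \<theta>) * ?d k" if "0 \<le> k" for k
  proof -
    have "?e k = (\<integral>\<^sup>+ u. ennreal \<bar>real (nb_quantile (cr \<theta>) (?x u k) (u k)) - real (nb_quantile (cr \<theta>) (?x' u k) (u k))\<bar> \<partial>noise)"
      using that by (simp add: cont_Y_def)
    also have "\<dots> = (\<integral>\<^sup>+ u. \<integral>\<^sup>+ v. ennreal \<bar>real (nb_quantile (cr \<theta>) (?x u k) v) - real (nb_quantile (cr \<theta>) (?x' u k) v)\<bar> \<partial>U01 \<partial>noise)"
      by (subst nn_integral_noise_resample[where i = k]) (simp_all add: xupd)
    also have "\<dots> = (\<integral>\<^sup>+ u. ennreal (cr \<theta>) * ennreal \<bar>?x u k - ?x' u k\<bar> \<partial>noise)"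
      using r by (simp add: nn_integral_quantile_diff[OF r xnn] ennreal_mult)
    finally show ?thesis by (simp add: nn_integral_cmult)
  qed
  have ybound: "?e k \<le> ennreal (cr \<theta> * V * \<rho> powi k)"
    if "- int (p + q) \<le> k" and d: "0 \<le> k \<Longrightarrow> ?d k \<le> ennreal (V * \<rho> powi k)" for k
  proof (cases "0 \<le> k")
    case True
    have "?e k = ennreal (cr \<theta>) * ?d k" by (rule ypos[OF True])
    also have "\<dots> \<le> ennreal (cr \<theta>) * ennreal (V * \<rho> powi k)" using d[OF True] by (rule mult_left_mono) simp
    also have "\<dots> = ennreal (cr \<theta> * V * \<rho> powi k)" using r V0 rho by (simp add: ennreal_mult[symmetric] mult.assoc)
    finally show ?thesis .
  next
    case False
    have "?e k = ennreal (real (y0 k))" using False MP.emeasure_space_1 by (simp add: cont_Y_def)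
    also have "\<dots> \<le> ennreal (cr \<theta> * V * \<rho> powi k)"
    proof (rule ennreal_leI)
      have "real (y0 k) \<le> cr \<theta> * V * 1" using V2[of k] that False by simp
      also have "\<dots> \<le> cr \<theta> * V * \<rho> powi k" using pow1[of k] False r V0 by (intro mult_left_mono) auto
      finally show "real (y0 k) \<le> cr \<theta> * V * \<rho> powi k" .
    qed
    finally show ?thesis .
  qed
  have dbound: "?d k \<le> ennreal (V * \<rho> powi k)" if "- int (p + q) \<le> k" for k
    using that
  proof (induction k rule: int_induct_from[where m = 0])
    case (base k)
    have "?d k = ennreal (x0 k)" using base x0 MP.emeasure_space_1 by (simp add: cont_X_def path_X_init)
    also have "\<dots> \<le> ennreal (V * \<rho> powi k)"
    proof (rule ennreal_leI)
      have "x0 k \<le> V * 1" using V1[of k] base by simp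
      also have "\<dots> \<le> V * \<rho> powi k" using pow1[of k] base V0 by (intro mult_left_mono) auto
      finally show "x0 k \<le> V * \<rho> powi k" .
    qed
    finally show ?case .
  next
    case (step k)
    have "?d k \<le> (\<integral>\<^sup>+ u. (\<Sum>i=1..p. ennreal (ca \<theta> i) * ennreal \<bar>?x u (k - int i) - ?x' u (k - int i)\<bar>)
        + (\<Sum>i=1..q. ennreal (cb \<theta> i) * ennreal \<bar>real (?y u (k - int i)) - real (?y' u (k - int i))\<bar>) \<partial>noise)"
    proof (rule nn_integral_mono)
      fix u
      have "\<bar>?x u k - ?x' u k\<bar> \<le> (\<Sum>i=1..p. ca \<theta> i * \<bar>?x u (k - int i) - ?x' u (k - int i)\<bar>)
          + (\<Sum>i=1..q. cb \<theta> i * \<bar>real (?y u (k - int i)) - real (?y' u (k - int i))\<bar>)" (is "_ \<le> ?A + ?B")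
        using abs_garch_step_diff_le[OF \<theta>, of "?x u" "?y u" k "?x' u" "?y' u"] step.hyps
        unfolding cont_Y_def cont_X_def by (simp only: path_X_step)
      then have "ennreal \<bar>?x u k - ?x' u k\<bar> \<le> ennreal (?A + ?B)" by (rule ennreal_leI)
      also have "\<dots> = ennreal ?A + ennreal ?B"
        using admD[OF \<theta>] by (intro ennreal_plus sum_nonneg mult_nonneg_nonneg) auto
      also have "ennreal ?A = (\<Sum>i=1..p. ennreal (ca \<theta> i) * ennreal \<bar>?x u (k - int i) - ?x' u (k - int i)\<bar>)"
        using admD[OF \<theta>] by (subst sum_ennreal[symmetric]) (auto simp: ennreal_mult intro!: sum.cong)
      also have "ennreal ?B = (\<Sum>i=1..q. ennreal (cb \<theta> i) * ennreal \<bar>real (?y u (k - int i)) - real (?y' u (k - int i))\<bar>)"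
        using admD[OF \<theta>] by (subst sum_ennreal[symmetric]) (auto simp: ennreal_mult intro!: sum.cong)
      finally show "ennreal \<bar>?x u k - ?x' u k\<bar> \<le> (\<Sum>i=1..p. ennreal (ca \<theta> i) * ennreal \<bar>?x u (k - int i) - ?x' u (k - int i)\<bar>)
        + (\<Sum>i=1..q. ennreal (cb \<theta> i) * ennreal \<bar>real (?y u (k - int i)) - real (?y' u (k - int i))\<bar>)" .
    qed
    also have "\<dots> = (\<Sum>i=1..p. ennreal (ca \<theta> i) * ?d (k - int i)) + (\<Sum>i=1..q. ennreal (cb \<theta> i) * ?e (k - int i))"
      by (simp add: nn_integral_add nn_integral_sum nn_integral_cmult)
    also have "\<dots> \<le> (\<Sum>i=1..p. ennreal (ca \<theta> i) * ennreal (V * \<rho> powi (k - int i)))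
        + (\<Sum>i=1..q. ennreal (cb \<theta> i) * ennreal (cr \<theta> * V * \<rho> powi (k - int i)))"
      using step by (intro add_mono sum_mono mult_left_mono ybound step.IH) auto
    also have "\<dots> = ennreal ((\<Sum>i=1..p. ca \<theta> i * (V * \<rho> powi (k - int i))) + (\<Sum>i=1..q. cb \<theta> i * (cr \<theta> * V * \<rho> powi (k - int i))))"
    proof -
      have "(\<Sum>i=1..p. ennreal (ca \<theta> i) * ennreal (V * \<rho> powi (k - int i))) = ennreal (\<Sum>i=1..p. ca \<theta> i * (V * \<rho> powi (k - int i)))"
        using admD[OF \<theta>] V0 rho by (subst sum_ennreal[symmetric]) (auto simp: ennreal_mult[symmetric] intro!: sum.cong)
      moreover have "(\<Sum>i=1..q. ennreal (cb \<theta> i) * ennreal (cr \<theta> * V * \<rho> powi (k - int i))) = ennreal (\<Sum>i=1..q. cb \<theta> i * (cr \<theta> * V * \<rho> powi (k - int i)))"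
        using admD[OF \<theta>] V0 rho by (subst sum_ennreal[symmetric]) (auto simp: ennreal_mult[symmetric] intro!: sum.cong)
      ultimately show ?thesis using admD[OF \<theta>] V0 rho
        by (subst ennreal_plus) (auto intro!: sum_nonneg)
    qed
    also have "\<dots> \<le> ennreal (V * \<rho> powi k)"
    proof (rule ennreal_leI)
      \<comment> \<open>Lag \<open>i\<close> costs a factor \<open>1 / \<rho> ^ i\<close>, which is
        precisely the weight in \<open>adm\<close>. The weights sum to at most 1, so the bound
        reproduces itself.\<close>
      have pw: "\<rho> powi (k - int i) = \<rho> powi k / \<rho> ^ i" for i using rho by (simp add: power_int_diff)
      have "(\<Sum>i=1..p. ca \<theta> i * (V * \<rho> powi (k - int i))) + (\<Sum>i=1..q. cb \<theta> i * (cr \<theta> * V * \<rho> powi (k - int i)))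
          = ((\<Sum>i=1..p. ca \<theta> i / \<rho> ^ i) + cr \<theta> * (\<Sum>i=1..q. cb \<theta> i / \<rho> ^ i)) * (V * \<rho> powi k)"
        unfolding pw by (simp add: distrib_right distrib_left sum_distrib_right sum_distrib_left mult_ac)
      also have "\<dots> \<le> 1 * (V * \<rho> powi k)"
        using \<theta> V0 rho eta unfolding adm_def by (intro mult_right_mono) auto
      finally show "(\<Sum>i=1..p. ca \<theta> i * (V * \<rho> powi (k - int i))) + (\<Sum>i=1..q. cb \<theta> i * (cr \<theta> * V * \<rho> powi (k - int i))) \<le> V * \<rho> powi k"
        by simp
    qed
    finally show ?case .
  qed
  show "?d k \<le> ennreal (V * \<rho> powi k)" if "- int (p + q) \<le> k" by (rule dbound[OF that])
  show "?e k \<le> ennreal (cr \<theta> * V * \<rho> powi k)" if "- int (p + q) \<le> k" by (rule ybound[OF that dbound[OF that]])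
qed


text \<open>The sequence on the left does not involve \<open>P\<close>. Given the past under
  \<open>P\<close>, the resumed path and the zero path share their noise from time 0, and they
  disagree on the window shifted by \<open>n\<close> with probability of order
  \<open>\<rho> ^ n\<close>.\<close>

lemma window_limit:
  fixes F :: "int \<Rightarrow> nat set"
  assumes \<theta>: "adm \<theta>" and P: "stationary_solution p q \<theta> P" and J: "finite J"
  shows "(\<lambda>n. measure noise {u. \<forall>j\<in>J. cont_Y \<theta> (\<lambda>_. 0) (\<lambda>_. 0) 0 u (j + int n) \<in> F j})
    \<longlonglongrightarrow> measure P {w \<in> space P. \<forall>j\<in>J. snd (w j) \<in> F j}"
proof -
  note D = stationary_solutionD[OF P] and r = admD(2)[OF \<theta>]
  interpret P: prob_space P by (rule D)
  note [measurable_cong] = D(2)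
  define A where "A x0 y0 n = {u. \<forall>j\<in>J. cont_Y \<theta> x0 y0 0 u (j + int n) \<in> F j}" for x0 y0 and n :: nat
  define c where "c n = measure noise (A (\<lambda>_. 0) (\<lambda>_. 0) n)" for n
  define g where "g n w = measure noise (A (Xs w) (Ys w) n)" for n w
  let ?E = "{w \<in> space P. \<forall>j\<in>J. snd (w j) \<in> F j}"
  have ym [measurable]: "(\<lambda>u. cont_Y \<theta> a b 0 u j) \<in> measurable noise (count_space UNIV)" for a b j
    by (rule cont_Y_measurable) auto
  have Am: "A x0 y0 n \<in> sets noise" for x0 y0 n
  proof -
    have "{u \<in> space noise. \<forall>j\<in>J. cont_Y \<theta> x0 y0 0 u (j + int n) \<in> F j} \<in> sets noise"
    proof (intro sets.sets_Collect_finite_All J)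
      show "{u \<in> space noise. cont_Y \<theta> x0 y0 0 u (j + int n) \<in> F j} \<in> sets noise" for j by measurable
    qed
    then show ?thesis by (simp add: A_def)
  qed
  have Em: "{w. \<forall>j\<in>J. snd (w (j + h)) \<in> F j} \<in> sets path_space" for h
  proof -
    have "{w \<in> space path_space. \<forall>j\<in>J. snd (w (j + h)) \<in> F j} \<in> sets path_space"
    proof (intro sets.sets_Collect_finite_All J)
      show "{w \<in> space path_space. snd (w (j + h)) \<in> F j} \<in> sets path_space" for j by measurable
    qed
    then show ?thesis by simp
  qed
  have spP: "space P = UNIV" using sets_eq_imp_space_eq[OF D(2)] by simp
  have gm [measurable]: "(\<lambda>w. emeasure noise (A (Xs w) (Ys w) n)) \<in> borel_measurable P" for n
  proof -
    interpret PN: pair_sigma_finite P noise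
      by (intro pair_sigma_finite.intro P.sigma_finite_measure_axioms MP.sigma_finite_measure_axioms)
    note PM = pair_coord_measurable[OF D(2)]
    have "(\<lambda>z. indicator {y. \<forall>j\<in>(\<lambda>j. j + int n) ` J. y j \<in> F (j - int n)} (cont_Y \<theta> (Xs (fst z)) (Ys (fst z)) 0 (snd z)) :: ennreal)
        \<in> borel_measurable (P \<Otimes>\<^sub>M noise)"
    proof (rule cylinder_indicator_measurable)
      show "(\<lambda>z. cont_Y \<theta> (Xs (fst z)) (Ys (fst z)) 0 (snd z) j) \<in> measurable (P \<Otimes>\<^sub>M noise) (count_space UNIV)" for j
        by (rule cont_Y_measurable, rule PM(1), rule PM(2), rule PM(3))
    qed (use J in simp)
    then have "(\<lambda>w. \<integral>\<^sup>+ u. indicator {y. \<forall>j\<in>(\<lambda>j. j + int n) ` J. y j \<in> F (j - int n)} (cont_Y \<theta> (Xs w) (Ys w) 0 u) \<partial>noise) \<in> borel_measurable P"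
      by (rule MP.borel_measurable_nn_integral_fst[where f = "\<lambda>z. indicator {y. \<forall>j\<in>(\<lambda>j. j + int n) ` J. y j \<in> F (j - int n)} (cont_Y \<theta> (Xs (fst z)) (Ys (fst z)) 0 (snd z))", simplified fst_conv snd_conv])
    moreover have "(\<integral>\<^sup>+ u. indicator {y. \<forall>j\<in>(\<lambda>j. j + int n) ` J. y j \<in> F (j - int n)} (cont_Y \<theta> (Xs w) (Ys w) 0 u) \<partial>noise)
        = emeasure noise (A (Xs w) (Ys w) n)" for w
      unfolding nn_integral_indicator[OF Am, symmetric]
      by (intro nn_integral_cong) (simp add: indicator_def A_def)
    ultimately show ?thesis by simp
  qed
  have gm' [measurable]: "g n \<in> borel_measurable P" for n
    unfolding g_def[abs_def] measure_def by measurable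
  \<comment> \<open>By stationarity the window may be moved by \<open>n\<close>, and there resuming
    from time 0 does not change the law.\<close>
  have E: "measure P ?E = (\<integral>w. g n w \<partial>P)" for n
  proof -
    have "measure P ?E = (\<integral>w. indicator {w. \<forall>j\<in>J. snd (w (j + 0)) \<in> F j} w \<partial>P)" using Em[of 0] D(2) spP by simp
    also have "\<dots> = (\<integral>w. indicator {w. \<forall>j\<in>J. snd (w (j + 0)) \<in> F j} (\<lambda>k. w (k + int n)) \<partial>P)"
      using Em[of 0] by (intro stationary_solution_shift_integral[OF P, symmetric] borel_measurable_indicator)
    also have "\<dots> = (\<integral>w. indicator {w. \<forall>j\<in>J. snd (w (j + int n)) \<in> F j} w \<partial>P)"
      by (simp add: indicator_def)
    also have "\<dots> = measure P {w \<in> space P. \<forall>j\<in>(\<lambda>j. j + int n) ` J. snd (w j) \<in> F (j - int n)}"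
      using Em[of "int n"] D(2) spP by simp
    also have "ennreal \<dots> = (\<integral>\<^sup>+ w. emeasure noise (A (Xs w) (Ys w) n) \<partial>P)"
    proof -
      have fJ: "finite ((\<lambda>j. j + int n) ` J)" using J by simp
      have "{u. \<forall>j\<in>(\<lambda>j. j + int n) ` J. cont_Y \<theta> x0 y0 0 u j \<in> F (j - int n)} = A x0 y0 n" for x0 y0
        unfolding A_def by simp
      then show ?thesis unfolding P.emeasure_eq_measure[symmetric]
        using emeasure_resume[OF \<theta> P fJ, of "\<lambda>j. F (j - int n)"] by (simp only:)
    qed
    also have "\<dots> = (\<integral>\<^sup>+ w. ennreal (g n w) \<partial>P)" by (simp add: g_def MP.emeasure_eq_measure)
    finally have "ennreal (measure P ?E) = (\<integral>\<^sup>+ w. ennreal (g n w) \<partial>P)" .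
    from arg_cong[OF this, of enn2real] have "measure P ?E = enn2real (\<integral>\<^sup>+ w. ennreal (g n w) \<partial>P)"
      by (simp only: enn2real_ennreal[OF measure_nonneg])
    also have "\<dots> = (\<integral>w. g n w \<partial>P)" by (rule integral_eq_nn_integral[symmetric, OF gm']) (auto simp: g_def)
    finally show ?thesis .
  qed
  define V where "V w = (\<Sum>i\<le>p + q. Xs w (- int i)) + (\<Sum>i\<le>p + q. real (Ys w (- int i))) / cr \<theta>" for w :: "int \<Rightarrow> real \<times> nat"
  \<comment> \<open>Collects the union bound over the window: coordinate \<open>j\<close>
    contributes \<open>cr \<theta> * \<rho> powi j\<close>.\<close>
  define K where "K = cr \<theta> * (\<Sum>j\<in>J. \<rho> powi j)"
  have Vm [measurable]: "(\<lambda>w. V w * K) \<in> borel_measurable P" unfolding V_def by measurable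
  have merge: "\<bar>g n w - c n\<bar> \<le> min 1 (\<bar>V w * K\<bar> * \<rho> ^ n)"
    if w: "\<forall>k. 0 \<le> Xs w k" and n: "\<And>j. j \<in> J \<Longrightarrow> 0 \<le> j + int n" for w n
  proof -
    let ?D = "\<lambda>j. {u. cont_Y \<theta> (Xs w) (Ys w) 0 u (j + int n) \<noteq> cont_Y \<theta> (\<lambda>_. 0) (\<lambda>_. 0) 0 u (j + int n)}"
    have Dm: "?D j \<in> sets noise" for j
    proof -
      have "{u \<in> space noise. cont_Y \<theta> (Xs w) (Ys w) 0 u (j + int n) \<noteq> cont_Y \<theta> (\<lambda>_. 0) (\<lambda>_. 0) 0 u (j + int n)} \<in> sets noise"
        by measurable
      then show ?thesis by simp
    qed
    have V0: "0 \<le> V w" using w r unfolding V_def by (auto intro!: add_nonneg_nonneg sum_nonneg divide_nonneg_pos)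
    have Dj: "measure noise (?D j) \<le> cr \<theta> * V w * \<rho> powi (j + int n)" if "j \<in> J" for j
    proof -
      \<comment> \<open>Distinct integers are at distance at least 1, so the probability of
        disagreement is at most the mean distance.\<close>
      have "emeasure noise (?D j) = (\<integral>\<^sup>+ u. indicator (?D j) u \<partial>noise)" using Dm by simp
      also have "\<dots> \<le> (\<integral>\<^sup>+ u. ennreal \<bar>real (cont_Y \<theta> (Xs w) (Ys w) 0 u (j + int n)) - real (cont_Y \<theta> (\<lambda>_. 0) (\<lambda>_. 0) 0 u (j + int n))\<bar> \<partial>noise)"
        by (intro nn_integral_mono) (auto simp: indicator_def one_ennreal_def[symmetric] ennreal_1[symmetric] simp del: ennreal_1 intro!: ennreal_leI)
      also have "\<dots> \<le> ennreal (cr \<theta> * V w * \<rho> powi (j + int n))"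
        unfolding V_def by (rule cont_merge(2)[OF \<theta>]) (use w n[OF that] in auto)
      finally show ?thesis using V0 r rho by (simp add: MP.emeasure_eq_measure)
    qed
    have "measure noise (\<Union>j\<in>J. ?D j) \<le> (\<Sum>j\<in>J. measure noise (?D j))"
      using J Dm by (intro MP.finite_measure_subadditive_finite) auto
    also have "\<dots> \<le> (\<Sum>j\<in>J. cr \<theta> * V w * \<rho> powi (j + int n))" by (intro sum_mono Dj)
    also have "\<dots> = V w * K * \<rho> ^ n"
      using rho by (simp add: K_def power_int_add sum_distrib_left sum_distrib_right mult_ac)
    finally have U: "measure noise (\<Union>j\<in>J. ?D j) \<le> V w * K * \<rho> ^ n" .
    have Um: "(\<Union>j\<in>J. ?D j) \<in> sets noise" using J Dm by auto
    \<comment> \<open>Both orders of the two paths at once, for a two-sided estimate.\<close>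
    have sub: "A x0 y0 n \<subseteq> A x1 y1 n \<union> (\<Union>j\<in>J. ?D j)" if "(x0, y0, x1, y1) \<in> {(Xs w, Ys w, \<lambda>_. 0, \<lambda>_. 0), (\<lambda>_. 0, \<lambda>_. 0, Xs w, Ys w)}" for x0 y0 x1 y1
      using that by (auto simp: A_def)
    have "measure noise (A x0 y0 n) \<le> measure noise (A x1 y1 n) + measure noise (\<Union>j\<in>J. ?D j)"
      if "(x0, y0, x1, y1) \<in> {(Xs w, Ys w, \<lambda>_. 0, \<lambda>_. 0), (\<lambda>_. 0, \<lambda>_. 0, Xs w, Ys w)}" for x0 y0 x1 y1
      using MP.finite_measure_mono[OF sub[OF that]] Am Um
        measure_Un_le[OF Am Um, of x1 y1 n] by auto
    from this[of "Xs w" "Ys w" "\<lambda>_. 0" "\<lambda>_. 0"] this[of "\<lambda>_. 0" "\<lambda>_. 0" "Xs w" "Ys w"]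
    have "\<bar>g n w - c n\<bar> \<le> V w * K * \<rho> ^ n" using U by (auto simp: g_def c_def)
    moreover have "V w * K * \<rho> ^ n \<le> \<bar>V w * K\<bar> * \<rho> ^ n" using rho by (intro mult_right_mono) auto
    moreover have "\<bar>g n w - c n\<bar> \<le> 1"
      using MP.prob_le_1[of "A (Xs w) (Ys w) n"] MP.prob_le_1[of "A (\<lambda>_. 0) (\<lambda>_. 0) n"]
        measure_nonneg[of noise "A (Xs w) (Ys w) n"] measure_nonneg[of noise "A (\<lambda>_. 0) (\<lambda>_. 0) n"]
      unfolding g_def c_def abs_le_iff by linarith
    ultimately show ?thesis by simp
  qed
  obtain N :: nat where N: "\<And>j. j \<in> J \<Longrightarrow> \<bar>j\<bar> \<le> int N" using finite_int_bound[OF J] by blast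
  have gi: "integrable P (g n)" for n
    by (rule P.integrable_const_bound[where B = 1]) (auto simp: g_def)
  have "(\<lambda>n. c n - measure P ?E) \<longlonglongrightarrow> 0"
  proof (rule Lim_null_comparison)
    show "(\<lambda>n. \<integral>w. min 1 (\<bar>V w * K\<bar> * \<rho> ^ n) \<partial>P) \<longlonglongrightarrow> 0" by (rule truncated_vanish[OF D(1) Vm rho])
    show "\<forall>\<^sub>F n in sequentially. norm (c n - measure P ?E) \<le> (\<integral>w. min 1 (\<bar>V w * K\<bar> * \<rho> ^ n) \<partial>P)"
      using eventually_ge_at_top[of N]
    proof eventually_elim
      case (elim n)
      have "c n - measure P ?E = (\<integral>w. c n - g n w \<partial>P)" using gi E[of n] P.prob_space by simp
      also have "norm \<dots> \<le> (\<integral>w. norm (c n - g n w) \<partial>P)" by (rule integral_norm_bound)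
      also have "\<dots> \<le> (\<integral>w. min 1 (\<bar>V w * K\<bar> * \<rho> ^ n) \<partial>P)"
      proof (rule integral_mono_AE)
        show "integrable P (\<lambda>w. min 1 (\<bar>V w * K\<bar> * \<rho> ^ n))"
          by (rule P.integrable_const_bound[where B = 1]) (use rho in auto)
        show "AE w in P. norm (c n - g n w) \<le> min 1 (\<bar>V w * K\<bar> * \<rho> ^ n)"
          using D(4)
        proof eventually_elim
          case (elim w)
          have "\<bar>g n w - c n\<bar> \<le> min 1 (\<bar>V w * K\<bar> * \<rho> ^ n)"
          proof (rule merge)
            show "\<forall>k. 0 \<le> Xs w k" using elim by blast
            show "0 \<le> j + int n" if "j \<in> J" for j using N[OF that] \<open>N \<le> n\<close> by linarith
          qed
          then show ?case by (simp add: abs_minus_commute)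
        qed
      qed (use gi in auto)
      finally show ?case .
    qed
  qed
  then have "c \<longlonglongrightarrow> measure P ?E" by (rule LIM_zero_cancel)
  then show ?thesis by (simp add: c_def[abs_def] A_def)
qed

section \<open>From observation laws to path laws\<close>

lemma Ys_measurable:
  assumes "sets R = sets path_space" shows "Ys \<in> measurable R obs_space"
  unfolding measurable_cong_sets[OF assms refl] by (intro measurable_PiM_single') (auto simp: space_PiM)

lemma law_Y_unique:
  assumes \<theta>: "adm \<theta>" and P: "stationary_solution p q \<theta> P" and Q: "stationary_solution p q \<theta> Q"
  shows "distr P obs_space Ys = distr Q obs_space Ys"
proof -
  note DP = stationary_solutionD[OF P] and DQ = stationary_solutionD[OF Q]
  interpret P: prob_space P by (rule DP)
  interpret Q: prob_space Q by (rule DQ)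
  show ?thesis
  proof (rule measure_eqI_PiM_infinite)
    fix J :: "int set" and F :: "int \<Rightarrow> nat set" assume J: "finite J"
    have e: "emeasure (distr R obs_space Ys) (prod_emb UNIV (\<lambda>_. count_space UNIV) J (Pi\<^sub>E J F)) =
        emeasure R {w \<in> space R. \<forall>j\<in>J. snd (w j) \<in> F j}" if R: "sets R = sets path_space" for R
    proof (subst emeasure_distr[OF Ys_measurable[OF R]])
      show "prod_emb UNIV (\<lambda>_. count_space UNIV) J (Pi\<^sub>E J F) \<in> sets obs_space"
        using J by (intro sets_PiM_I) auto
      show "emeasure R (Ys -` prod_emb UNIV (\<lambda>_. count_space UNIV) J (Pi\<^sub>E J F) \<inter> space R) = emeasure R {w \<in> space R. \<forall>j\<in>J. snd (w j) \<in> F j}"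
        by (intro arg_cong[where f = "emeasure R"]) (auto simp: prod_emb_def PiE_def Pi_def)
    qed
    have "measure P {w \<in> space P. \<forall>j\<in>J. snd (w j) \<in> F j} = measure Q {w \<in> space Q. \<forall>j\<in>J. snd (w j) \<in> F j}"
      by (rule LIMSEQ_unique[OF window_limit[OF \<theta> P J] window_limit[OF \<theta> Q J]])
    then show "emeasure (distr P obs_space Ys) (prod_emb UNIV (\<lambda>_. count_space UNIV) J (Pi\<^sub>E J F)) =
        emeasure (distr Q obs_space Ys) (prod_emb UNIV (\<lambda>_. count_space UNIV) J (Pi\<^sub>E J F))"
      unfolding e[OF DP(2)] e[OF DQ(2)] by (simp add: P.emeasure_eq_measure Q.emeasure_eq_measure)
  next
    show "finite_measure (distr P obs_space Ys)" by (rule P.finite_measure_distr) (rule Ys_measurable[OF DP(2)])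
  qed simp_all
qed

text \<open>Every solution is the image of its observation law under one map,
  \<open>?\<Psi>\<close>, which is built from the filter and does not depend on the
  solution.\<close>

lemma stationary_solution_unique:
  assumes \<theta>: "adm \<theta>" and P: "stationary_solution p q \<theta> P" and Q: "stationary_solution p q \<theta> Q"
  shows "P = Q"
proof -
  let ?\<Psi> = "\<lambda>y k. (obs_X \<theta> y k, y k)"
  have \<Psi>: "?\<Psi> \<in> measurable obs_space path_space"
    by (rule path_space_meas) (auto intro!: obs_X_measurable)
  have "R = distr (distr R obs_space Ys) path_space ?\<Psi>" if R: "stationary_solution p q \<theta> R" for R
  proof -
    note D = stationary_solutionD[OF R]
    have "distr (distr R obs_space Ys) path_space ?\<Psi> = distr R path_space (\<lambda>w. ?\<Psi> (Ys w))"
      by (subst distr_distr[OF \<Psi> Ys_measurable[OF D(2)]]) (simp add: o_def)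
    also have "\<dots> = distr R R (\<lambda>w. w)"
    proof (rule distr_cong_AE)
      show "AE w in R. ?\<Psi> (Ys w) = w" using solution_X_eq_obs_X[OF \<theta> R]
        by eventually_elim (auto simp: prod_eq_iff)
      show "(\<lambda>w. ?\<Psi> (Ys w)) \<in> measurable R path_space" by (rule measurable_compose[OF Ys_measurable[OF D(2)] \<Psi>])
    qed (use D(2) in auto)
    finally show ?thesis by simp
  qed
  from this[OF P] this[OF Q] law_Y_unique[OF assms] show ?thesis by simp
qed

lemma stat_law_eq:
  assumes "adm \<theta>"
  shows "stationary_solution p q \<theta> (stat_law p q \<theta>)" "stat_law p q \<theta> = distr noise path_space (noise_path \<theta>)"
    "\<exists>!P. stationary_solution p q \<theta> P"
proof -
  note N = noise_stationary_solution[OF assms]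
  show e: "stat_law p q \<theta> = distr noise path_space (noise_path \<theta>)"
    unfolding stat_law_def using N stationary_solution_unique[OF assms] by blast
  show "stationary_solution p q \<theta> (stat_law p q \<theta>)" unfolding e by (rule N)
  show "\<exists>!P. stationary_solution p q \<theta> P" using N stationary_solution_unique[OF assms] by blast
qed

lemma stat_marginal_X_finite_mean:
  assumes "adm \<theta>" shows "(\<integral>\<^sup>+ x. ennreal x \<partial>stat_marginal_X p q \<theta>) < \<infinity>"
proof -
  have "(\<integral>\<^sup>+ x. ennreal x \<partial>stat_marginal_X p q \<theta>) = (\<integral>\<^sup>+ u. ennreal (noise_X \<theta> 0 u) \<partial>noise)"
    unfolding stat_marginal_X_def stat_law_eq(2)[OF assms]
    by (simp add: nn_integral_distr noise_path_def)
  also have "\<dots> \<le> ennreal (om \<theta> / \<eta>)" by (rule noise_X_mean[OF assms])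
  also have "\<dots> < \<infinity>" by simp
  finally show ?thesis .
qed

lemma stat_law_mean_Y:
  assumes \<theta>: "adm \<theta>"
  shows "(\<integral>\<^sup>+ w. ennreal (real (snd (w k))) \<partial>stat_law p q \<theta>) \<le> ennreal (cr \<theta>) * ennreal (om \<theta> / \<eta>)"
proof -
  note r = admD(2)[OF \<theta>]
  have "(\<integral>\<^sup>+ w. ennreal (real (snd (w k))) \<partial>stat_law p q \<theta>) = (\<integral>\<^sup>+ u. ennreal (real (nb_quantile (cr \<theta>) (noise_X \<theta> k u) (u k))) \<partial>noise)"
    unfolding stat_law_eq(2)[OF \<theta>] by (simp add: nn_integral_distr noise_path_def noise_Y_def)
  also have "\<dots> = (\<integral>\<^sup>+ u. (\<Sum>y. ennreal (nb (cr \<theta>) (noise_X \<theta> k u) y) * ennreal (real y)) \<partial>noise)"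
    by (rule nn_integral_noise_quantile[OF r]) (simp_all add: noise_X_nonneg noise_X_upd del: fun_upd_apply)
  also have "\<dots> = ennreal (cr \<theta>) * (\<integral>\<^sup>+ u. ennreal (noise_X \<theta> k u) \<partial>noise)"
    using nb_nn_mean[OF r noise_X_nonneg] r noise_X_nonneg
    by (simp add: ennreal_of_nat_eq_real_of_nat ennreal_mult nn_integral_cmult)
  also have "\<dots> \<le> ennreal (cr \<theta>) * ennreal (om \<theta> / \<eta>)" by (intro mult_left_mono noise_X_mean[OF \<theta>]) simp
  finally show ?thesis .
qed

text \<open>The stationary law is a factor of the noise, so its law of large numbers is inherited.\<close>

lemma stat_law_lln:
  fixes f :: "(int \<Rightarrow> real \<times> nat) \<Rightarrow> real"
  assumes \<theta>: "adm \<theta>" and f: "integrable (stat_law p q \<theta>) f"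
  shows "AE w in stat_law p q \<theta>. (\<lambda>n. (\<Sum>k=1..n. f (\<lambda>j. w (j + int k))) / real n) \<longlonglongrightarrow> (\<integral>w. f w \<partial>stat_law p q \<theta>)"
proof -
  note e = stat_law_eq(2)[OF \<theta>]
  have fm [measurable]: "f \<in> borel_measurable path_space" using borel_measurable_integrable[OF f] by (simp add: e)
  let ?f = "\<lambda>u. f (noise_path \<theta> u)"
  have fi: "integrable noise ?f" using f unfolding e by (subst (asm) integrable_distr_eq) auto
  have shift: "noise_path \<theta> (\<lambda>j. u (j + h)) = (\<lambda>j. noise_path \<theta> u (j + h))" for u h
    by (rule ext) (simp add: noise_path_def noise_X_shift noise_Y_shift)
  \<comment> \<open>Likelihood sums start at \<open>k = 1\<close>, ergodic averages at
    \<open>k = 0\<close>; composing with one shift absorbs the offset.\<close>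
  have fsi: "integrable noise (\<lambda>u. ?f (shift1 u))" using MP.integrable_Tn[OF fi, of 1] by simp
  have "(\<integral>u. ?f (shift1 u) \<partial>noise) = (\<integral>u. ?f u \<partial>noise)" using MP.integral_Tn[of ?f 1] by simp
  also have "\<dots> = (\<integral>w. f w \<partial>stat_law p q \<theta>)" unfolding e by (subst integral_distr) auto
  finally have I: "(\<integral>u. ?f (shift1 u) \<partial>noise) = (\<integral>w. f w \<partial>stat_law p q \<theta>)" .
  have eq: "MP.avg (\<lambda>u. ?f (shift1 u)) n u = (\<Sum>k=1..n. f (\<lambda>j. noise_path \<theta> u (j + int k))) / real n" for n u
  proof -
    have "(\<Sum>k<n. ?f (shift1 ((shift1 ^^ k) u))) = (\<Sum>k<n. f (\<lambda>j. noise_path \<theta> u (j + int (Suc k))))"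
    proof (rule sum.cong)
      fix k
      have "shift1 ((shift1 ^^ k) u) = (\<lambda>j. u (j + int (Suc k)))"
        using funpow_shift1[of "Suc k" u] by simp
      then show "?f (shift1 ((shift1 ^^ k) u)) = f (\<lambda>j. noise_path \<theta> u (j + int (Suc k)))" by (simp only: shift)
    qed simp
    also have "\<dots> = (\<Sum>k=1..n. f (\<lambda>j. noise_path \<theta> u (j + int k)))"
      by (rule sum.reindex_bij_witness[of _ "\<lambda>k. k - 1" Suc]) auto
    finally show ?thesis by (simp add: MP.avg_def)
  qed
  have "AE u in noise. (\<lambda>n. (\<Sum>k=1..n. f (\<lambda>j. noise_path \<theta> u (j + int k))) / real n) \<longlonglongrightarrow> (\<integral>w. f w \<partial>stat_law p q \<theta>)"
    using noise_lln[OF fsi] unfolding MP.lln_def eq I by blast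
  moreover have "(\<lambda>w j. w (j + int k)) \<in> measurable path_space path_space" for k by (rule path_space_shift_meas[OF refl])
  then have [measurable]: "(\<lambda>w. f (\<lambda>j. w (j + int k))) \<in> borel_measurable path_space" for k
    by (rule measurable_compose[OF _ fm])
  have "{w \<in> space path_space. (\<lambda>n. (\<Sum>k=1..n. f (\<lambda>j. w (j + int k))) / real n) \<longlonglongrightarrow> (\<integral>w. f w \<partial>stat_law p q \<theta>)} \<in> sets path_space"
    by measurable
  ultimately show ?thesis unfolding e by (subst AE_distr_iff) auto
qed

end

section \<open>Kullback--Leibler identification\<close>

context garch_orders
begin

text \<open>A stationary envelope: every \<open>X\<close>-path driven by observations close to \<open>y\<close> is a bounded multiple of it.\<close>

definition geo :: "real \<Rightarrow> (int \<Rightarrow> nat) \<Rightarrow> int \<Rightarrow> real" where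
  "geo c y k = (\<Sum>j. \<rho> ^ j * (real (y (k - int j)) + c))"

text \<open>A single event on which the filters of all admissible parameters are finite and obey
  their recursions, so that uncountably many parameters can be treated together.\<close>

definition good :: "(int \<Rightarrow> nat) \<Rightarrow> bool" where
  "good y \<longleftrightarrow> (\<forall>k. summable (\<lambda>j. \<rho> ^ j * real (y (k - int j))))"

lemma good_summable: "good y \<Longrightarrow> summable (\<lambda>j. \<rho> ^ j * (real (y (k - int j)) + c))"
  using rho unfolding good_def distrib_left
  by (intro summable_add summable_mult2 summable_geometric) auto

lemma geo_unfold: "good y \<Longrightarrow> geo c y k = real (y k) + c + \<rho> * geo c y (k - 1)"
proof -
  assume g: "good y"
  have "geo c y k = (\<Sum>j. \<rho> ^ Suc j * (real (y (k - int (Suc j))) + c)) + \<rho> ^ 0 * (real (y (k - int 0)) + c)"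
    unfolding geo_def using suminf_split_head[OF good_summable[OF g, of k c]] by simp
  also have "(\<Sum>j. \<rho> ^ Suc j * (real (y (k - int (Suc j))) + c)) = (\<Sum>j. \<rho> * (\<rho> ^ j * (real (y (k - 1 - int j)) + c)))"
    by (intro suminf_cong) (simp add: algebra_simps)
  also have "\<dots> = \<rho> * geo c y (k - 1)" unfolding geo_def by (rule suminf_mult[OF good_summable[OF g]])
  finally show ?thesis by simp
qed

lemma geo_nonneg: "0 \<le> c \<Longrightarrow> good y \<Longrightarrow> 0 \<le> geo c y k"
  unfolding geo_def using rho by (intro suminf_nonneg good_summable) auto

lemma geo_ge: "0 \<le> c \<Longrightarrow> good y \<Longrightarrow> real (y k) + c \<le> geo c y k"
  using geo_unfold[of y c k] geo_nonneg[of c y "k - 1"] rho by auto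

lemma geo_prev: "0 \<le> c \<Longrightarrow> good y \<Longrightarrow> geo c y (k - 1) \<le> geo c y k / \<rho>"
  using geo_unfold[of y c k] rho by (simp add: field_simps)

lemma geo_shift: "geo c (\<lambda>j. y (j + h)) k = geo c y (k + h)"
  unfolding geo_def by (simp add: algebra_simps)

text \<open>Size of the forcing by \<open>om\<close> and the observations relative to the envelope:
  going back by \<open>i\<close> steps enlarges the envelope by at most
  \<open>1 / \<rho> ^ i\<close>.\<close>

definition force :: "param \<Rightarrow> real" where
  "force \<theta> = om \<theta> + (\<Sum>i=1..q. cb \<theta> i / \<rho> ^ i)"

lemma force_nonneg: "adm \<theta> \<Longrightarrow> 0 \<le> force \<theta>"
  unfolding force_def using admD[of \<theta>] rho by (auto intro!: add_nonneg_nonneg sum_nonneg)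

lemma geo_lag: "0 \<le> c \<Longrightarrow> good y \<Longrightarrow> geo c y (k - int i) \<le> geo c y k / \<rho> ^ i"
  by (rule slow_growth[of "geo c y"]) (rule geo_prev)

text \<open>Since \<open>c \<ge> 1\<close> the envelope is at least 1, which absorbs
  \<open>om \<theta>\<close> and the initial values; \<open>c\<close> also absorbs the deviation of
  \<open>u\<close> from \<open>y\<close>. The envelope then serves as forcing in the comparison
  principle.\<close>

lemma obs_envelope:
  assumes \<theta>: "adm \<theta>" and y: "good y" and c: "1 \<le> c" and u: "\<And>k. real (u k) \<le> real (y k) + c"
    and x1: "0 \<le> x1" "\<And>j. j \<le> m \<Longrightarrow> x j \<le> x1"
    and x: "\<And>k. m < k \<Longrightarrow> x k = garch_step p q \<theta> x u k"
  shows "x k \<le> (force \<theta> / \<eta> + x1) * geo c y k"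
proof -
  have c0: "0 \<le> c" using c by simp
  note g0 = geo_nonneg[OF c0 y] and gge = geo_ge[OF c0 y]
  have g1: "1 \<le> geo c y k" for k using gge[of k] c by linarith
  have init: "x k \<le> (force \<theta> / \<eta> + x1) * geo c y k" if "k \<le> m" for k
  proof -
    have "x k \<le> x1 * 1" using x1(2)[OF that] by simp
    also have "\<dots> \<le> (force \<theta> / \<eta> + x1) * geo c y k"
      using x1(1) g1[of k] force_nonneg[OF \<theta>] eta by (intro mult_mono) auto
    finally show ?thesis .
  qed
  show ?thesis
  proof (cases "k \<le> m")
    case False
    have e: "(force \<theta> / \<eta> + x1) * geo c y k = (force \<theta> + \<eta> * x1) * geo c y k / \<eta>" for k
      using eta by (simp add: field_simps)
    show ?thesis unfolding e
    proof (rule dominate[where d = x and m = m, OF _ _ _ adm_sum_a[OF \<theta>]])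
      show "(force \<theta> + \<eta> * x1) * geo c y (k - 1) \<le> (force \<theta> + \<eta> * x1) * geo c y k / \<rho>" for k
        using mult_left_mono[OF geo_prev[OF c0 y, of k], of "force \<theta> + \<eta> * x1"] force_nonneg[OF \<theta>] x1 eta by simp
      show "0 \<le> (force \<theta> + \<eta> * x1) * geo c y k" for k using force_nonneg[OF \<theta>] x1 eta g0 by simp
      show "x k \<le> (force \<theta> + \<eta> * x1) * geo c y k / \<eta>" if "k \<le> m" for k using init[OF that] e[of k] by simp
      fix k assume k: "m < k"
      have "(\<Sum>i=1..q. cb \<theta> i * real (u (k - int i))) \<le> (\<Sum>i=1..q. cb \<theta> i / \<rho> ^ i * geo c y k)"
      proof (rule sum_mono)
        fix i assume i: "i \<in> {1..q}"
        have "real (u (k - int i)) \<le> geo c y (k - int i)" using u gge order_trans by blast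
        also have "\<dots> \<le> geo c y k / \<rho> ^ i" by (rule geo_lag[OF c0 y])
        finally have "cb \<theta> i * real (u (k - int i)) \<le> cb \<theta> i * (geo c y k / \<rho> ^ i)"
          using admD(4)[OF \<theta>, of i] i by (intro mult_left_mono) auto
        then show "cb \<theta> i * real (u (k - int i)) \<le> cb \<theta> i / \<rho> ^ i * geo c y k" by simp
      qed
      also have "\<dots> = (force \<theta> - om \<theta>) * geo c y k" by (simp add: force_def sum_distrib_right)
      finally have "om \<theta> + (\<Sum>i=1..q. cb \<theta> i * real (u (k - int i))) \<le> force \<theta> * geo c y k"
        using mult_left_mono[OF g1[of k] less_imp_le[OF admD(1)[OF \<theta>]]] by (simp add: left_diff_distrib)
      also have "\<dots> \<le> (force \<theta> + \<eta> * x1) * geo c y k" using x1 eta g0 by (intro mult_right_mono) auto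
      finally show "x k \<le> (\<Sum>i=1..p. ca \<theta> i * x (k - int i)) + (force \<theta> + \<eta> * x1) * geo c y k"
        using x[OF k] by (simp add: garch_step_eq)
    qed (use False admD[OF \<theta>] in auto)
  qed (rule init)
qed

text \<open>The envelope keeps the supremum behind the filter finite, so the recursion passes to the
  limit. The lower bound keeps logarithms away from their singularity at 0.\<close>

lemma obs_X_good:
  assumes \<theta>: "adm \<theta>" and y: "good y"
  shows "obs_X \<theta> y k = garch_step p q \<theta> (obs_X \<theta> y) y k"
    and "obs_X \<theta> y k \<le> force \<theta> / \<eta> * geo 1 y k" and "om \<theta> \<le> obs_X \<theta> y k"
proof -
  let ?z = "path_X p q \<theta> (\<lambda>_. 0) (\<lambda>j _. y j)"
  have le: "?z m k \<le> force \<theta> / \<eta> * geo 1 y k" for m k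
    using obs_envelope[OF \<theta> y, of 1 y 0 m "?z m" k] by (simp add: path_X_init path_X_step)
  have fin: "(SUP m::int. ennreal (?z m k)) < \<infinity>" for k
  proof -
    have "(SUP m::int. ennreal (?z m k)) \<le> ennreal (force \<theta> / \<eta> * geo 1 y k)" by (intro SUP_least ennreal_leI le)
    also have "\<dots> < \<infinity>" by simp
    finally show ?thesis .
  qed
  show r: "obs_X \<theta> y k = garch_step p q \<theta> (obs_X \<theta> y) y k" for k
    using lim_X_recursion[OF \<theta> mono_resp_const fin, of k] by (simp add: obs_X_def[abs_def])
  show "obs_X \<theta> y k \<le> force \<theta> / \<eta> * geo 1 y k"
    unfolding obs_X_def by (rule LIMSEQ_le_const2[OF lim_X_limit(1)[OF \<theta> mono_resp_const fin]]) (use le in auto)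
  show "om \<theta> \<le> obs_X \<theta> y k" by (subst r) (rule garch_step_ge[OF \<theta> obs_X_nonneg])
qed

lemma Ys_coord_measurable:
  assumes "sets P = sets path_space"
  shows "(\<lambda>w. Ys w j) \<in> measurable P (count_space UNIV)" "(\<lambda>w. Xs w j) \<in> borel_measurable P"
  using path_space_coord[of j] by (simp_all add: measurable_cong_sets[OF assms refl])

lemma geo_measurable:
  assumes "\<And>j. (\<lambda>w. f w j) \<in> measurable M (count_space UNIV)"
  shows "(\<lambda>w. geo c (f w) k) \<in> borel_measurable M"
proof -
  have [measurable]: "(\<lambda>w. real (f w j)) \<in> borel_measurable M" for j
    by (rule measurable_compose[OF assms]) simp
  show ?thesis unfolding geo_def by measurable
qed

text \<open>Only the uniform bound on the means of \<open>Y\<close> enters, so the times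
  \<open>s\<close> are arbitrary: they run backwards for the filter and forwards for the effect of
  initial values.\<close>

lemma stat_law_geometric_sum:
  assumes \<theta>: "adm \<theta>"
  shows "0 \<le> c \<Longrightarrow> (\<integral>\<^sup>+ w. (\<Sum>j. ennreal (\<rho> ^ j * (real (Ys w (s j)) + c))) \<partial>stat_law p q \<theta>) < \<infinity>"
    and "AE w in stat_law p q \<theta>. summable (\<lambda>j. \<rho> ^ j * real (Ys w (s j)))"
proof -
  let ?P = "stat_law p q \<theta>"
  note D = stationary_solutionD[OF stat_law_eq(1)[OF \<theta>]]
  interpret P: prob_space ?P by (rule D)
  have Ym [measurable]: "(\<lambda>w. real (Ys w j)) \<in> borel_measurable ?P" for j
    by (rule measurable_compose[OF Ys_coord_measurable(1)[OF D(2)]]) simp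
  show fin: "(\<integral>\<^sup>+ w. (\<Sum>j. ennreal (\<rho> ^ j * (real (Ys w (s j)) + c))) \<partial>?P) < \<infinity>" if c: "0 \<le> c" for c
  proof -
    define B where "B = cr \<theta> * (om \<theta> / \<eta>) + c"
    have B0: "0 \<le> B" using admD[OF \<theta>] eta c by (auto simp: B_def)
    have one: "(\<integral>\<^sup>+ w. ennreal (\<rho> ^ j * (real (Ys w (s j)) + c)) \<partial>?P) \<le> ennreal (B * \<rho> ^ j)" for j
    proof -
      have "(\<integral>\<^sup>+ w. ennreal (\<rho> ^ j * (real (Ys w (s j)) + c)) \<partial>?P)
          = ennreal (\<rho> ^ j) * ((\<integral>\<^sup>+ w. ennreal (real (Ys w (s j))) \<partial>?P) + ennreal c)"
        using rho c P.emeasure_space_1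
        by (simp add: ennreal_mult nn_integral_cmult nn_integral_add ennreal_plus)
      also have "\<dots> \<le> ennreal (\<rho> ^ j) * (ennreal (cr \<theta>) * ennreal (om \<theta> / \<eta>) + ennreal c)"
        by (intro mult_left_mono add_mono stat_law_mean_Y[OF \<theta>]) auto
      also have "\<dots> = ennreal (B * \<rho> ^ j)"
        using admD[OF \<theta>] eta c rho B0 unfolding B_def
        by (simp add: ennreal_mult[symmetric] ennreal_plus[symmetric] mult.commute del: ennreal_plus)
      finally show ?thesis .
    qed
    have "(\<integral>\<^sup>+ w. (\<Sum>j. ennreal (\<rho> ^ j * (real (Ys w (s j)) + c))) \<partial>?P)
        = (\<Sum>j. \<integral>\<^sup>+ w. ennreal (\<rho> ^ j * (real (Ys w (s j)) + c)) \<partial>?P)"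
      by (rule nn_integral_suminf) measurable
    also have "\<dots> \<le> (\<Sum>j. ennreal (B * \<rho> ^ j))" by (intro suminf_le one) auto
    also have "\<dots> = ennreal (\<Sum>j. B * \<rho> ^ j)"
      using rho B0 by (intro suminf_ennreal2 summable_mult summable_geometric) auto
    also have "\<dots> < \<infinity>" by simp
    finally show ?thesis .
  qed
  have "AE w in ?P. (\<Sum>j. ennreal (\<rho> ^ j * (real (Ys w (s j)) + 0))) \<noteq> \<infinity>"
  proof (rule nn_integral_PInf_AE)
    show "(\<integral>\<^sup>+ w. (\<Sum>j. ennreal (\<rho> ^ j * (real (Ys w (s j)) + 0))) \<partial>?P) \<noteq> \<infinity>" using fin[of 0] by auto
  qed measurable
  then show "AE w in ?P. summable (\<lambda>j. \<rho> ^ j * real (Ys w (s j)))"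
  proof eventually_elim
    case (elim w)
    show ?case by (rule summable_suminf_not_top) (use elim rho in \<open>auto simp: top_unique\<close>)
  qed
qed

lemma stat_law_good:
  assumes \<theta>: "adm \<theta>"
  shows "AE w in stat_law p q \<theta>. good (Ys w)"
    and "0 \<le> c \<Longrightarrow> integrable (stat_law p q \<theta>) (\<lambda>w. geo c (Ys w) k)"
proof -
  let ?P = "stat_law p q \<theta>"
  note D = stationary_solutionD[OF stat_law_eq(1)[OF \<theta>]]
  show g: "AE w in ?P. good (Ys w)"
    unfolding good_def AE_all_countable
  proof
    fix k
    show "AE w in ?P. summable (\<lambda>j. \<rho> ^ j * real (Ys w (k - int j)))"
      by (rule stat_law_geometric_sum(2)[OF \<theta>, of "\<lambda>j. k - int j"])
  qed
  show "integrable ?P (\<lambda>w. geo c (Ys w) k)" if c: "0 \<le> c"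
  proof (rule integrableI_bounded)
    show "(\<lambda>w. geo c (Ys w) k) \<in> borel_measurable ?P" by (rule geo_measurable) (rule Ys_coord_measurable[OF D(2)])
    have "(\<integral>\<^sup>+ w. ennreal (norm (geo c (Ys w) k)) \<partial>?P) = (\<integral>\<^sup>+ w. (\<Sum>j. ennreal (\<rho> ^ j * (real (Ys w (k - int j)) + c))) \<partial>?P)"
    proof (rule nn_integral_cong_AE, use g in eventually_elim)
      case (elim w)
      then show ?case using geo_nonneg[OF c elim, of k] rho c
        unfolding geo_def by (subst suminf_ennreal2) (auto intro: good_summable)
    qed
    also have "\<dots> < \<infinity>" by (rule stat_law_geometric_sum(1)[OF \<theta> c])
    finally show "(\<integral>\<^sup>+ w. ennreal (norm (geo c (Ys w) k)) \<partial>?P) < \<infinity>" .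
  qed
qed

section \<open>The expected log-likelihood\<close>

definition obs_loglik :: "param \<Rightarrow> (int \<Rightarrow> nat) \<Rightarrow> int \<Rightarrow> real" where
  "obs_loglik \<theta> y k = ln (nb (cr \<theta>) (obs_X \<theta> y k) (y k))"

lemma obs_loglik_shift: "obs_loglik \<theta> (\<lambda>j. y (j + h)) k = obs_loglik \<theta> y (k + h)"
  by (simp add: obs_loglik_def obs_X_shift)

lemma obs_loglik_measurable:
  assumes "\<And>j. (\<lambda>w. f w j) \<in> measurable M (count_space UNIV)"
  shows "(\<lambda>w. obs_loglik \<theta> (f w) k) \<in> borel_measurable M"
proof -
  have [measurable]: "(\<lambda>w. obs_X \<theta> (f w) k) \<in> borel_measurable M" by (rule obs_X_measurable) (rule assms)
  have [measurable]: "(\<lambda>w. nb (cr \<theta>) (obs_X \<theta> (f w) k) (f w k)) \<in> borel_measurable M"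
    by (rule measurable_compose_countable[OF _ assms]) measurable
  show ?thesis unfolding obs_loglik_def by measurable
qed

lemma stat_law_loglik_integrable:
  assumes \<theta>s: "adm \<theta>s" and \<theta>: "adm \<theta>"
  shows "integrable (stat_law p q \<theta>s) (\<lambda>w. obs_loglik \<theta> (Ys w) 0)"
proof (rule Bochner_Integration.integrable_bound)
  note D = stationary_solutionD[OF stat_law_eq(1)[OF \<theta>s]]
  \<comment> \<open>The coefficients of \<open>Y\<close> and \<open>X\<close> in
    \<open>abs_ln_nb_le\<close> at \<open>c = om \<theta>\<close>, both variables being dominated by
    the envelope.\<close>
  let ?C = "(\<bar>cr \<theta> - 1\<bar> / min (cr \<theta>) 1 + 1 / om \<theta>) + cr \<theta> * (force \<theta> / \<eta>)"
  show "integrable (stat_law p q \<theta>s) (\<lambda>w. ?C * geo 1 (Ys w) 0)"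
    using stat_law_good(2)[OF \<theta>s] by simp
  show "AE w in stat_law p q \<theta>s. norm (obs_loglik \<theta> (Ys w) 0) \<le> norm (?C * geo 1 (Ys w) 0)"
    using stat_law_good(1)[OF \<theta>s]
  proof eventually_elim
    case (elim w)
    let ?y = "Ys w"
    note r = admD[OF \<theta>]
    have "\<bar>obs_loglik \<theta> ?y 0\<bar> \<le> (\<bar>cr \<theta> - 1\<bar> / min (cr \<theta>) 1 + 1 / om \<theta>) * real (?y 0) + cr \<theta> * obs_X \<theta> ?y 0"
      unfolding obs_loglik_def by (rule abs_ln_nb_le[OF r(2,1) obs_X_good(3)[OF \<theta> elim]])
    also have "\<dots> \<le> (\<bar>cr \<theta> - 1\<bar> / min (cr \<theta>) 1 + 1 / om \<theta>) * geo 1 ?y 0 + cr \<theta> * (force \<theta> / \<eta> * geo 1 ?y 0)"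
      using r geo_ge[of 1 ?y 0] elim obs_X_good(2)[OF \<theta> elim, of 0] by (intro add_mono mult_left_mono) auto
    also have "\<dots> = ?C * geo 1 ?y 0" by (simp add: algebra_simps)
    also have "\<dots> \<le> norm (?C * geo 1 ?y 0)" by simp
    finally show ?case by simp
  qed
qed (rule obs_loglik_measurable, rule Ys_coord_measurable, rule stationary_solutionD[OF stat_law_eq(1)[OF \<theta>s]])

lemma stat_law_KL:
  assumes \<theta>s: "adm \<theta>s" and \<theta>: "adm \<theta>"
  defines "l \<equiv> \<lambda>\<theta>. \<integral>w. obs_loglik \<theta> (Ys w) 0 \<partial>stat_law p q \<theta>s"
  shows "l \<theta> \<le> l \<theta>s"
    and "l \<theta> = l \<theta>s \<Longrightarrow> AE w in stat_law p q \<theta>s. \<forall>y. nb (cr \<theta>) (obs_X \<theta> (Ys w) 0) y = nb (cr \<theta>s) (obs_X \<theta>s (Ys w) 0) y"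
proof -
  let ?P = "stat_law p q \<theta>s"
  note S = stat_law_eq(1)[OF \<theta>s]
  note D = stationary_solutionD[OF S]
  interpret P: prob_space ?P by (rule D)
  note r = admD(2)[OF \<theta>] admD(2)[OF \<theta>s]
  let ?F = "past_algebra ?P (\<lambda>k w. fst (w k)) (\<lambda>k w. snd (w k)) 0"
  \<comment> \<open>Likelihood ratio of the two transition laws with the observation as a free
    argument; under the true transition it averages to 1.\<close>
  define t where "t y w = nb (cr \<theta>) (obs_X \<theta> (Ys w) 0) y / nb (cr \<theta>s) (fst (w 0)) y" for y and w :: "int \<Rightarrow> real \<times> nat"
  have oF [measurable]: "(\<lambda>w. obs_X \<theta> (Ys w) 0) \<in> borel_measurable ?F"
    by (rule obs_X_measurable) (rule past_algebra_Y)
  have xF [measurable]: "(\<lambda>w. fst (w 0)) \<in> borel_measurable ?F" by (rule past_algebra_X) simp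
  have tF [measurable]: "t y \<in> borel_measurable ?F" for y unfolding t_def[abs_def] by measurable
  have sub: "subalgebra ?P ?F"
    by (rule past_subalgebra) (use nbin_garch_processD(2,3)[OF D(3)] in auto)
  have Y0: "(\<lambda>w. Ys w 0) \<in> measurable ?P (count_space UNIV)" by (rule Ys_coord_measurable(1)[OF D(2)])
  have tP [measurable]: "t y \<in> borel_measurable ?P" for y by (rule measurable_from_subalg[OF sub tF])
  have tY [measurable]: "(\<lambda>w. t (snd (w 0)) w) \<in> borel_measurable ?P"
    by (rule measurable_compose_countable[where f = t, OF tP Y0])
  have base: "AE w in ?P. good (Ys w) \<and> fst (w 0) = obs_X \<theta>s (Ys w) 0 \<and> 0 < fst (w 0) \<and> 0 < obs_X \<theta> (Ys w) 0"
    using stat_law_good(1)[OF \<theta>s] solution_X_eq_obs_X[OF \<theta>s S]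
  proof eventually_elim
    case (elim w)
    then show ?case
      using obs_X_good(3)[OF \<theta>s, of "Ys w" 0] obs_X_good(3)[OF \<theta>, of "Ys w" 0] admD(1)[OF \<theta>] admD(1)[OF \<theta>s] by auto
  qed
  have "(\<integral>\<^sup>+ w. ennreal (t (snd (w 0)) w) \<partial>?P) = (\<integral>\<^sup>+ w. (\<Sum>y. ennreal (nb (cr \<theta>s) (fst (w 0)) y) * ennreal (t y w)) \<partial>?P)"
    by (rule nbin_garch_transition[OF D(3) r(2), of "\<lambda>y w. ennreal (t y w)"]) measurable
  also have "\<dots> = (\<integral>\<^sup>+ w. 1 \<partial>?P)"
  proof (rule nn_integral_cong_AE, use base in eventually_elim)
    case (elim w)
    have "ennreal (nb (cr \<theta>s) (fst (w 0)) y) * ennreal (t y w) = ennreal (nb (cr \<theta>) (obs_X \<theta> (Ys w) 0) y)" for y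
      using nb_pos[OF r(2), of "fst (w 0)" y] nb_pos[OF r(1), of "obs_X \<theta> (Ys w) 0" y] elim
      by (simp add: t_def ennreal_mult[symmetric])
    then show ?case using nb_nn_sum[OF r(1) obs_X_nonneg] by simp
  qed
  finally have t1: "(\<integral>\<^sup>+ w. ennreal (t (snd (w 0)) w) \<partial>?P) = 1" using P.emeasure_space_1 by simp
  have tpos: "AE w in ?P. 0 < t (snd (w 0)) w"
    using base by eventually_elim (auto simp: t_def intro!: divide_pos_pos nb_pos r)
  have ti: "integrable ?P (\<lambda>w. t (snd (w 0)) w)"
    by (rule integrableI_nonneg) (use tpos t1 in \<open>auto elim: eventually_mono\<close>)
  have tI: "(\<integral>w. t (snd (w 0)) w \<partial>?P) = 1"
    by (subst integral_eq_nn_integral) (use tpos t1 in \<open>auto elim: eventually_mono\<close>)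
  let ?L = "\<lambda>\<theta> w. obs_loglik \<theta> (Ys w) 0"
  have Li: "integrable ?P (?L \<theta>)" "integrable ?P (?L \<theta>s)" by (rule stat_law_loglik_integrable[OF \<theta>s \<theta>] stat_law_loglik_integrable[OF \<theta>s \<theta>s])+
  \<comment> \<open>This is \<open>t - 1 - ln t\<close>. As \<open>t\<close> has mean 1, its
    integral is the gap \<open>l \<theta>s - l \<theta>\<close>.\<close>
  let ?g = "\<lambda>w. t (snd (w 0)) w - 1 - (?L \<theta> w - ?L \<theta>s w)"
  have lnt: "AE w in ?P. ?L \<theta> w - ?L \<theta>s w = ln (t (snd (w 0)) w)"
    using base
  proof eventually_elim
    case (elim w)
    then show ?case
      using nb_pos[OF r(2), of "fst (w 0)" "Ys w 0"] nb_pos[OF r(1), of "obs_X \<theta> (Ys w) 0" "Ys w 0"]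
      by (simp add: t_def obs_loglik_def ln_div)
  qed
  have g0: "AE w in ?P. 0 \<le> ?g w"
    using lnt tpos by eventually_elim (use ln_le_minus_one in force)
  have gi: "integrable ?P ?g" using ti Li by auto
  have gI: "(\<integral>w. ?g w \<partial>?P) = l \<theta>s - l \<theta>" using ti Li tI P.prob_space by (simp add: l_def)
  show "l \<theta> \<le> l \<theta>s" using integral_nonneg_AE[OF g0] gI by simp
  assume eq: "l \<theta> = l \<theta>s"
  then have "AE w in ?P. ?g w = 0" using integral_nonneg_eq_0_iff_AE[OF gi g0] gI by simp
  then have ae: "AE w in ?P. t (snd (w 0)) w = 1"
    using lnt tpos by eventually_elim (auto intro!: ln_eq_minus_one)
  \<comment> \<open>So far \<open>t\<close> equals 1 at the observation that occurs; positivity of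
    all transition probabilities extends this to every \<open>y\<close>.\<close>
  have "AE w in ?P. \<forall>y. t y w = 1"
  proof (rule nbin_garch_transition_AE[OF D(3) r(2), where k = 0])
    show "AE w in ?P. 0 < fst (w 0)" using base by eventually_elim blast
    have sp: "space ?F = space ?P" using sub by (simp add: subalgebra_def)
    show "{w \<in> space ?P. t y w = 1} \<in> sets ?F" for y unfolding sp[symmetric] by measurable
  qed (rule ae)
  then show "AE w in ?P. \<forall>y. nb (cr \<theta>) (obs_X \<theta> (Ys w) 0) y = nb (cr \<theta>s) (obs_X \<theta>s (Ys w) 0) y"
    using base
  proof eventually_elim
    case (elim w)
    show ?case
    proof
      fix y
      have "0 < nb (cr \<theta>s) (fst (w 0)) y" using elim nb_pos[OF r(2)] by blast
      then show "nb (cr \<theta>) (obs_X \<theta> (Ys w) 0) y = nb (cr \<theta>s) (obs_X \<theta>s (Ys w) 0) y"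
        using elim by (simp add: t_def)
    qed
  qed
qed

lemma stationary_AE_shift:
  assumes P: "stationary_solution p q \<theta> P" and ae: "AE w in P. Q w"
  shows "AE w in P. Q (\<lambda>k. w (k + h))"
proof -
  have s: "sets P = sets path_space" and d: "distr P path_space (\<lambda>w k. w (k + h)) = P"
    using P unfolding stationary_solution_def by blast+
  have m: "(\<lambda>w k. w (k + h)) \<in> measurable P path_space"
    by (rule path_space_shift_meas[OF s])
  have "AE w in distr P path_space (\<lambda>w k. w (k + h)). Q w" unfolding d by (rule ae)
  then show ?thesis by (rule AE_distrD[OF m])
qed

lemma stat_law_Y_eqI:
  assumes \<theta>s: "adm \<theta>s" and \<theta>: "adm \<theta>"
    and nb: "AE w in stat_law p q \<theta>s. \<forall>y. nb (cr \<theta>) (obs_X \<theta> (Ys w) 0) y = nb (cr \<theta>s) (obs_X \<theta>s (Ys w) 0) y"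
  shows "stat_law_Y p q \<theta> = stat_law_Y p q \<theta>s"
proof -
  let ?P = "stat_law p q \<theta>s"
  note S = stat_law_eq(1)[OF \<theta>s]
  note D = stationary_solutionD[OF S]
  note r = admD(2)[OF \<theta>] admD(2)[OF \<theta>s]
  interpret P: prob_space ?P by (rule D)
  let ?X = "\<lambda>k w. obs_X \<theta> (Ys w) k" and ?Y = "\<lambda>k w. snd (w k) :: nat"
  have Xm: "?X k \<in> borel_measurable ?P" for k by (rule obs_X_measurable) (rule Ys_coord_measurable(1)[OF D(2)])
  have Ym: "?Y k \<in> measurable ?P (count_space UNIV)" for k by (rule Ys_coord_measurable(1)[OF D(2)])
  have sh: "obs_X \<theta>' (\<lambda>j. Ys w (j + h)) k = obs_X \<theta>' (Ys w) (k + h)" for \<theta>' w h k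
    using obs_X_shift[of \<theta>' "Ys w" h k] by simp
  have nbk: "AE w in ?P. \<forall>y. nb (cr \<theta>) (?X k w) y = nb (cr \<theta>s) (fst (w k)) y" for k
    using stationary_AE_shift[OF S nb, of k] solution_X_eq_obs_X[OF \<theta>s S]
    by eventually_elim (simp add: sh)
  have G: "nbin_garch_process p q \<theta> ?P ?X ?Y"
  proof (rule nbin_garch_processI[OF D(1) Xm Ym r(1)])
    show "AE w in ?P. ?X (k + 1) w = garch_step p q \<theta> (\<lambda>j. ?X j w) (\<lambda>j. ?Y j w) (k + 1)" for k
      using stat_law_good(1)[OF \<theta>s] by eventually_elim (rule obs_X_good(1)[OF \<theta>])
    fix k y A assume A: "A \<in> sets (past_algebra ?P ?X ?Y k)"
    let ?F = "past_algebra ?P (\<lambda>k w. fst (w k)) ?Y k"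
    \<comment> \<open>The filter is a function of past observations, so the past of the new process
      is contained in the true past, and the true transition identity applies to its events.\<close>
    have "(\<lambda>w. w) \<in> measurable ?F (past_algebra ?P ?X ?Y k)"
    proof (rule past_algebra_measurableI)
      show "?X j \<in> borel_measurable ?F" if "j \<le> k" for j
        using that by (intro obs_X_measurable past_algebra_Y) auto
      show "?Y j \<in> measurable ?F (count_space UNIV)" if "j < k" for j by (rule past_algebra_Y[OF that])
    qed (simp add: past_algebra_def space_measure_of_conv)
    from measurable_sets[OF this A] have AF: "A \<inter> space ?F \<in> sets ?F" by simp
    have "A \<subseteq> space ?P" using sets.sets_into_space[OF A] by (simp add: past_algebra_def space_measure_of_conv)
    then have AF: "A \<in> sets ?F" using AF by (simp add: past_algebra_def space_measure_of_conv Int_absorb2)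
    have "(\<integral>\<^sup>+ w. indicator A w * indicator {v \<in> space ?P. ?Y k v = y} w \<partial>?P)
        = (\<integral>\<^sup>+ w. indicator A w * indicator {y} (snd (w k)) \<partial>?P)"
      by (intro nn_integral_cong) (auto simp: indicator_def)
    also have "\<dots> = (\<integral>\<^sup>+ w. (\<Sum>y'. ennreal (nb (cr \<theta>s) (fst (w k)) y') * (indicator A w * indicator {y} y')) \<partial>?P)"
      using AF by (intro nbin_garch_transition[OF D(3) r(2), of "\<lambda>y' w. indicator A w * indicator {y} y'"]) auto
    also have "\<dots> = (\<integral>\<^sup>+ w. indicator A w * ennreal (nb (cr \<theta>s) (fst (w k)) y) \<partial>?P)"
      by (simp only: suminf_indicator_singleton)
    also have "\<dots> = (\<integral>\<^sup>+ w. indicator A w * ennreal (nb (cr \<theta>) (?X k w) y) \<partial>?P)"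
      by (rule nn_integral_cong_AE, use nbk[of k] in eventually_elim) simp
    finally show "(\<integral>\<^sup>+ w. indicator A w * indicator {v \<in> space ?P. ?Y k v = y} w \<partial>?P) =
      (\<integral>\<^sup>+ w. indicator A w * ennreal (nb (cr \<theta>) (?X k w) y) \<partial>?P)" .
  qed (simp add: obs_X_nonneg)
  have \<Phi>: "(\<lambda>w k. (?X k w, ?Y k w)) \<in> measurable ?P path_space" by (rule path_space_meas[OF Xm Ym])
  have "stationary_solution p q \<theta> (distr ?P path_space (\<lambda>w k. (?X k w, ?Y k w)))"
  proof (rule stationary_solutionI[OF G r(1)])
    fix h :: int
    have d: "distr ?P path_space (\<lambda>w k. w (k + h)) = ?P" using S unfolding stationary_solution_def by blast
    have m: "(\<lambda>w k. w (k + h)) \<in> measurable ?P path_space"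
      by (rule path_space_shift_meas[OF D(2)])
    have \<Phi>': "(\<lambda>w k. (?X k w, ?Y k w)) \<in> measurable path_space path_space"
      using \<Phi> unfolding measurable_cong_sets[OF D(2) refl] .
    have "distr ?P path_space (\<lambda>w k. (?X k w, ?Y k w)) = distr (distr ?P path_space (\<lambda>w k. w (k + h))) path_space (\<lambda>w k. (?X k w, ?Y k w))"
      unfolding d ..
    also have "\<dots> = distr ?P path_space (\<lambda>w k. (?X (k + h) w, ?Y (k + h) w))"
      by (subst distr_distr[OF \<Phi>' m]) (simp add: o_def sh)
    finally show "distr ?P path_space (\<lambda>w k. (?X (k + h) w, ?Y (k + h) w)) = distr ?P path_space (\<lambda>w k. (?X k w, ?Y k w))" ..
  qed
  then have e: "stat_law p q \<theta> = distr ?P path_space (\<lambda>w k. (?X k w, ?Y k w))"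
    using stationary_solution_unique[OF \<theta>] stat_law_eq(1)[OF \<theta>] by blast
  show ?thesis
    unfolding stat_law_Y_def e
    by (subst distr_distr[OF Ys_measurable[OF refl] \<Phi>]) (simp add: o_def)
qed

end

section \<open>Consistency\<close>

context garch_orders
begin

abbreviation cond_path :: "param \<Rightarrow> real \<Rightarrow> nat \<Rightarrow> (int \<Rightarrow> nat) \<Rightarrow> int \<Rightarrow> real" where
  "cond_path \<theta> x1 y1 y \<equiv> cond_X p q \<theta> (\<lambda>_. x1) (extend_obs (\<lambda>_. y1) y)"

lemma cond_path_init: "k \<le> 0 \<Longrightarrow> cond_path \<theta> x1 y1 y k = x1"
  by (simp add: cond_X.simps)

lemma cond_path_step: "0 < k \<Longrightarrow> cond_path \<theta> x1 y1 y k = garch_step p q \<theta> (cond_path \<theta> x1 y1 y) (extend_obs (\<lambda>_. y1) y) k"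
  by (subst cond_X.simps) simp

lemma cond_path_nonneg: "adm \<theta> \<Longrightarrow> 0 \<le> x1 \<Longrightarrow> 0 \<le> cond_path \<theta> x1 y1 y k"
  unfolding cond_X_eq_path_X by (rule path_X_nonneg) auto

lemma cond_path_ge: "adm \<theta> \<Longrightarrow> 0 \<le> x1 \<Longrightarrow> 0 < k \<Longrightarrow> om \<theta> \<le> cond_path \<theta> x1 y1 y k"
  by (subst cond_path_step) (auto intro: garch_step_ge cond_path_nonneg)

text \<open>The constant absorbs the value \<open>y1\<close> that fills the negative times; the
  extra 1 keeps the envelope at least 1.\<close>

lemma extend_obs_le: "real (extend_obs (\<lambda>_. y1) y k) \<le> real (y k) + (real y1 + 1)"
  by (simp add: extend_obs_def)

lemma cond_path_merge:
  assumes \<theta>: "adm \<theta>" and y: "good y" and x1: "0 \<le> x1"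
  shows "\<exists>M\<ge>0. \<forall>k>0. \<bar>cond_path \<theta> x1 y1 y (int k) - obs_X \<theta> y (int k)\<bar> \<le> M * \<rho> ^ k"
proof -
  let ?x = "cond_path \<theta> x1 y1 y" and ?x' = "obs_X \<theta> y"
  \<comment> \<open>Up to time \<open>q\<close> the recursion may still read artificial
    observations, so merging starts there. The window \<open>[-p, q]\<close> contains the
    \<open>p\<close> values that it starts from and the times before it.\<close>
  let ?I = "{int q - int (p + q)..int q}"
  define M where "M = (\<Sum>j\<in>?I. \<bar>?x j - ?x' j\<bar>)"
  have M0: "0 \<le> M" unfolding M_def by (rule sum_nonneg) simp
  have M: "\<bar>?x j - ?x' j\<bar> \<le> M" if "j \<in> ?I" for j
    unfolding M_def by (rule member_le_sum) (use that in auto)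
  have "\<bar>?x k - ?x' k\<bar> \<le> M * \<rho> powi (k - int q)" if k: "0 < k" for k
  proof (cases "k \<le> int q")
    case True
    have "\<bar>?x k - ?x' k\<bar> \<le> M * 1" using M[of k] k True by simp
    also have "\<dots> \<le> M * \<rho> powi (k - int q)" using powi_init[of "k - int q"] True M0 by (intro mult_left_mono) auto
    finally show ?thesis .
  next
    case False
    show ?thesis
    proof (rule same_obs_merge[OF \<theta>, where u = "extend_obs (\<lambda>_. y1) y" and u' = y])
      show "?x j = garch_step p q \<theta> ?x (extend_obs (\<lambda>_. y1) y) j" if "int q < j" for j
        using that by (intro cond_path_step) simp
      show "?x' j = garch_step p q \<theta> ?x' y j" for j by (rule obs_X_good(1)[OF \<theta> y])
      show "extend_obs (\<lambda>_. y1) y j = y j" if "int q - int q < j" for j using that by (simp add: extend_obs_def)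
      show "\<bar>?x j - ?x' j\<bar> \<le> M" if "int q - int p < j" "j \<le> int q" for j using that by (intro M) auto
    qed (use M0 False in auto)
  qed
  then have "\<bar>?x (int k) - ?x' (int k)\<bar> \<le> M * \<rho> powi (int k - int q)" if "0 < k" for k using that by simp
  moreover have "M * \<rho> powi (int k - int q) = (M / \<rho> ^ q) * \<rho> ^ k" for k using rho by (simp add: power_int_diff)
  ultimately have "\<bar>?x (int k) - ?x' (int k)\<bar> \<le> (M / \<rho> ^ q) * \<rho> ^ k" if "0 < k" for k using that by simp
  then show ?thesis using M0 rho by (intro exI[of _ "M / \<rho> ^ q"]) auto
qed

lemma cond_path_envelope:
  assumes "adm \<theta>" "good y" "0 \<le> x1"
  shows "cond_path \<theta> x1 y1 y k \<le> (force \<theta> / \<eta> + x1) * geo (real y1 + 1) y k"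
  by (rule obs_envelope[OF assms(1,2), of _ "extend_obs (\<lambda>_. y1) y" x1 0])
     (use extend_obs_le[of y1 y] assms(3) in \<open>auto simp: cond_path_init intro: cond_path_step\<close>)

lemma cond_loglik_eq:
  "adm \<theta> \<Longrightarrow> cond_loglik p q (\<lambda>_. x1) (\<lambda>_. y1) n y \<theta> =
    (\<Sum>k=1..n. ln (nb (cr \<theta>) (cond_path \<theta> x1 y1 y (int k)) (y (int k)))) / real n"
  using admD(2)[of \<theta>] by (simp add: cond_loglik_def nbin_pmf_nb)

text \<open>
  The estimator need not be measurable, so the exceptional null sets have to be found on the space of
  observations itself.
\<close>

lemma stat_law_Y_AE:
  assumes "{y \<in> space obs_space. Q y} \<in> sets obs_space" "AE w in stat_law p q \<theta>. Q (Ys w)" "adm \<theta>"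
  shows "AE y in stat_law_Y p q \<theta>. Q y"
proof -
  have "sets (stat_law p q \<theta>) = sets path_space" by (rule stationary_solutionD(2)[OF stat_law_eq(1)[OF assms(3)]])
  from AE_distr_iff[OF Ys_measurable[OF this] assms(1)] assms(2) show ?thesis unfolding stat_law_Y_def by blast
qed

lemma stat_law_Y_good:
  assumes "adm \<theta>"
  shows "AE y in stat_law_Y p q \<theta>. good y \<and> summable (\<lambda>j. \<rho> ^ j * real (y (int j)))"
proof (rule stat_law_Y_AE[OF _ _ assms])
  show "{y \<in> space obs_space. good y \<and> summable (\<lambda>j. \<rho> ^ j * real (y (int j)))} \<in> sets obs_space"
  proof -
    \<comment> \<open>As finiteness of an \<open>ennreal\<close> sum, summability becomes a
      measurable condition.\<close>
    have "summable (\<lambda>j. \<rho> ^ j * real (z j)) \<longleftrightarrow> (\<Sum>j. ennreal (\<rho> ^ j * real (z j))) \<noteq> top" for z :: "nat \<Rightarrow> nat"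
    proof
      assume "summable (\<lambda>j. \<rho> ^ j * real (z j))"
      then show "(\<Sum>j. ennreal (\<rho> ^ j * real (z j))) \<noteq> top" using rho by (subst suminf_ennreal2) auto
    qed (use rho in \<open>auto intro: summable_suminf_not_top\<close>)
    then show ?thesis unfolding good_def by (simp only:) measurable
  qed
  show "AE w in stat_law p q \<theta>. good (Ys w) \<and> summable (\<lambda>j. \<rho> ^ j * real (Ys w (int j)))"
    using stat_law_good(1)[OF assms] stat_law_geometric_sum(2)[OF assms, of int] by eventually_elim blast
qed

lemma stat_law_Y_lln:
  fixes f :: "(int \<Rightarrow> nat) \<Rightarrow> int \<Rightarrow> real"
  assumes \<theta>: "adm \<theta>" and f: "integrable (stat_law p q \<theta>) (\<lambda>w. f (Ys w) 0)"
    and shift: "\<And>y h k. f (\<lambda>j. y (j + h)) k = f y (k + h)"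
    and m: "\<And>k. (\<lambda>y. f y k) \<in> borel_measurable obs_space"
  shows "AE y in stat_law_Y p q \<theta>. (\<lambda>n. (\<Sum>k=1..n. f y (int k)) / real n) \<longlonglongrightarrow> (\<integral>w. f (Ys w) 0 \<partial>stat_law p q \<theta>)"
proof (rule stat_law_Y_AE[OF _ _ \<theta>])
  note [measurable] = m
  show "{y \<in> space obs_space. (\<lambda>n. (\<Sum>k=1..n. f y (int k)) / real n) \<longlonglongrightarrow> (\<integral>w. f (Ys w) 0 \<partial>stat_law p q \<theta>)} \<in> sets obs_space"
    by measurable
  have "f (\<lambda>j. Ys w (j + int k)) 0 = f (Ys w) (int k)" for w k using shift[of "Ys w" "int k" 0] by simp
  then show "AE w in stat_law p q \<theta>. (\<lambda>n. (\<Sum>k=1..n. f (Ys w) (int k)) / real n) \<longlonglongrightarrow> (\<integral>w. f (Ys w) 0 \<partial>stat_law p q \<theta>)"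
    using stat_law_lln[OF \<theta> f] by simp
qed

lemma obs_coord_measurable: "(\<lambda>y. y j) \<in> measurable obs_space (count_space UNIV)"
  by measurable

text \<open>The summands for the chosen initial values and those for the filter differ by a summable
  sequence, which division by \<open>n\<close> removes; the stationary version obeys the law of
  large numbers.\<close>

lemma loglik_converges:
  assumes \<theta>s: "adm \<theta>s" and \<theta>: "adm \<theta>" and x1: "0 \<le> x1"
  shows "AE y in stat_law_Y p q \<theta>s. (\<lambda>n. cond_loglik p q (\<lambda>_. x1) (\<lambda>_. y1) n y \<theta>)
    \<longlonglongrightarrow> (\<integral>w. obs_loglik \<theta> (Ys w) 0 \<partial>stat_law p q \<theta>s)"
  using stat_law_Y_lln[OF \<theta>s stat_law_loglik_integrable[OF \<theta>s \<theta>] obs_loglik_shift obs_loglik_measurable[OF obs_coord_measurable]]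
    stat_law_Y_good[OF \<theta>s]
proof eventually_elim
    case (elim y)
    have good: "good y" and fwd: "summable (\<lambda>j. \<rho> ^ j * real (y (int j)))" using elim(2) by auto
    note r = admD(2)[OF \<theta>] and o = admD(1)[OF \<theta>]
    obtain M where M: "0 \<le> M" "\<And>k. 0 < k \<Longrightarrow> \<bar>cond_path \<theta> x1 y1 y (int k) - obs_X \<theta> y (int k)\<bar> \<le> M * \<rho> ^ k"
      using cond_path_merge[OF \<theta> good x1, of y1] by blast
    \<comment> \<open>The second term pairs the observation at \<open>k\<close> with the decaying
      path difference; the forward sum in \<open>stat_law_Y_good\<close> makes it summable.\<close>
    define b where "b k = cr \<theta> * M * \<rho> ^ k + M / (om \<theta>)\<^sup>2 * (\<rho> ^ k * real (y (int k)))" for k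
    have b0: "0 \<le> b k" for k using r o M(1) rho by (auto simp: b_def)
    have bs: "summable b" unfolding b_def using rho fwd by (intro summable_add summable_mult summable_geometric) auto
    have tm: "\<bar>ln (nb (cr \<theta>) (cond_path \<theta> x1 y1 y (int k)) (y (int k))) - obs_loglik \<theta> y (int k)\<bar> \<le> b k" if k: "0 < k" for k
    proof -
      let ?x = "cond_path \<theta> x1 y1 y (int k)" and ?x' = "obs_X \<theta> y (int k)" and ?n = "real (y (int k))"
      have "\<bar>ln (nb (cr \<theta>) ?x (y (int k))) - ln (nb (cr \<theta>) ?x' (y (int k)))\<bar> \<le>
          ?n * (\<bar>cr \<theta> - cr \<theta>\<bar> / cr \<theta>) + \<bar>cr \<theta> - cr \<theta>\<bar> * ?x + cr \<theta> * \<bar>?x - ?x'\<bar> + ?n * min (1 / om \<theta>) (\<bar>?x - ?x'\<bar> / (om \<theta>)\<^sup>2)"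
        by (rule ln_nb_diff_le) (use r o k cond_path_ge[OF \<theta> x1] obs_X_good(3)[OF \<theta> good] in auto)
      also have "\<dots> \<le> cr \<theta> * \<bar>?x - ?x'\<bar> + ?n * (\<bar>?x - ?x'\<bar> / (om \<theta>)\<^sup>2)"
      proof -
        have "?n * min (1 / om \<theta>) (\<bar>?x - ?x'\<bar> / (om \<theta>)\<^sup>2) \<le> ?n * (\<bar>?x - ?x'\<bar> / (om \<theta>)\<^sup>2)"
          by (intro mult_left_mono min.cobounded2) simp
        then show ?thesis by simp
      qed
      also have "\<dots> \<le> cr \<theta> * (M * \<rho> ^ k) + ?n * (M * \<rho> ^ k / (om \<theta>)\<^sup>2)"
        using M(2)[OF k] r by (intro add_mono mult_left_mono divide_right_mono) auto
      also have "\<dots> = b k" by (simp add: b_def mult_ac)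
      finally show ?thesis by (simp add: obs_loglik_def)
    qed
    have "(\<lambda>n. cond_loglik p q (\<lambda>_. x1) (\<lambda>_. y1) n y \<theta> - (\<Sum>k=1..n. obs_loglik \<theta> y (int k)) / real n) \<longlonglongrightarrow> 0"
    proof (rule Lim_null_comparison)
      show "(\<lambda>n. (\<Sum>k. b k) / real n) \<longlonglongrightarrow> 0" by (rule lim_const_over_n)
      show "\<forall>\<^sub>F n in sequentially. norm (cond_loglik p q (\<lambda>_. x1) (\<lambda>_. y1) n y \<theta> - (\<Sum>k=1..n. obs_loglik \<theta> y (int k)) / real n) \<le> (\<Sum>k. b k) / real n"
      proof (rule always_eventually, rule allI)
        fix n
        have "\<bar>\<Sum>k=1..n. ln (nb (cr \<theta>) (cond_path \<theta> x1 y1 y (int k)) (y (int k))) - obs_loglik \<theta> y (int k)\<bar> \<le> (\<Sum>k=1..n. b k)"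
          by (rule order_trans[OF sum_abs], rule sum_mono) (auto intro: tm)
        also have "\<dots> \<le> (\<Sum>k. b k)" by (rule sum_le_suminf[OF bs]) (auto simp: b0)
        finally show "norm (cond_loglik p q (\<lambda>_. x1) (\<lambda>_. y1) n y \<theta> - (\<Sum>k=1..n. obs_loglik \<theta> y (int k)) / real n) \<le> (\<Sum>k. b k) / real n"
          unfolding cond_loglik_eq[OF \<theta>] diff_divide_distrib[symmetric] sum_subtractf[symmetric]
          by (simp add: divide_right_mono)
      qed
    qed
    from tendsto_add[OF this elim(1)] show ?case by simp
  qed

section \<open>The likelihood uniformly near a parameter\<close>

definition box :: "param \<Rightarrow> real \<Rightarrow> param set" where
  "box \<theta>0 \<delta> = {\<theta>. \<bar>om \<theta> - om \<theta>0\<bar> < \<delta> \<and> (\<forall>i\<in>{1..p}. \<bar>ca \<theta> i - ca \<theta>0 i\<bar> < \<delta>) \<and>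
     (\<forall>i\<in>{1..q}. \<bar>cb \<theta> i - cb \<theta>0 i\<bar> < \<delta>) \<and> \<bar>cr \<theta> - cr \<theta>0\<bar> < \<delta>}"

lemma (in -) param_coord_continuous:
  "continuous_on UNIV (\<lambda>\<theta>::param. om \<theta>)" "continuous_on UNIV (\<lambda>\<theta>::param. cr \<theta>)"
  "continuous_on UNIV (\<lambda>\<theta>::param. ca \<theta> i)" "continuous_on UNIV (\<lambda>\<theta>::param. cb \<theta> i)"
proof -
  show "continuous_on UNIV (\<lambda>\<theta>::param. ca \<theta> i)"
    by (rule continuous_on_product_then_coordinatewise) (intro continuous_intros)
  show "continuous_on UNIV (\<lambda>\<theta>::param. cb \<theta> i)"
    by (rule continuous_on_product_then_coordinatewise) (intro continuous_intros)
qed (intro continuous_intros)+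

text \<open>Only finitely many coordinates are constrained, which makes the box open in the product
  topology.\<close>

lemma open_box: "open (box \<theta>0 \<delta>)"
proof -
  have o: "open {\<theta>. \<bar>f \<theta> - c\<bar> < \<delta>}" if "continuous_on UNIV f" for f :: "param \<Rightarrow> real" and c
    using that by (intro open_Collect_less continuous_intros)
  have "box \<theta>0 \<delta> = {\<theta>. \<bar>om \<theta> - om \<theta>0\<bar> < \<delta>} \<inter> (\<Inter>i\<in>{1..p}. {\<theta>. \<bar>ca \<theta> i - ca \<theta>0 i\<bar> < \<delta>}) \<inter>
     (\<Inter>i\<in>{1..q}. {\<theta>. \<bar>cb \<theta> i - cb \<theta>0 i\<bar> < \<delta>}) \<inter> {\<theta>. \<bar>cr \<theta> - cr \<theta>0\<bar> < \<delta>}"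
    by (auto simp: box_def)
  then show ?thesis using o[OF param_coord_continuous(1)] o[OF param_coord_continuous(2)]
      o[OF param_coord_continuous(3)] o[OF param_coord_continuous(4)]
    by (auto intro!: open_Int open_INT)
qed

text \<open>Lipschitz constant of the path in the parameter, per unit of envelope. The summands stem
  from \<open>om\<close>, from the \<open>p\<close> coefficients \<open>ca\<close> acting on the
  path of \<open>\<theta>0\<close>, and from the \<open>q\<close> coefficients \<open>cb\<close>
  acting on observations; \<open>1 / \<eta>\<close> is the price of the comparison
  principle.\<close>

definition drift :: "param \<Rightarrow> real \<Rightarrow> real" where
  "drift \<theta>0 x1 = (1 + real p * ((force \<theta>0 / \<eta> + x1) / \<rho> ^ p) + real q / \<rho> ^ q) / \<eta>"

lemma cond_path_perturb:
  fixes y1 :: nat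
  assumes \<theta>: "adm \<theta>" and \<theta>0: "adm \<theta>0" and y: "good y" and x1: "0 \<le> x1" and box: "\<theta> \<in> box \<theta>0 \<delta>" and k: "- int p < k"
  defines "S \<equiv> geo (real y1 + 1) y"
  shows "\<bar>cond_path \<theta> x1 y1 y k - cond_path \<theta>0 x1 y1 y k\<bar> \<le> \<delta> * drift \<theta>0 x1 * S k"
proof -
  let ?x = "cond_path \<theta> x1 y1 y" and ?z = "cond_path \<theta>0 x1 y1 y" and ?u = "extend_obs (\<lambda>_. y1) y"
  let ?A = "force \<theta>0 / \<eta> + x1"
  have c: "(0::real) \<le> real y1 + 1" by simp
  have \<delta>: "0 \<le> \<delta>" using box by (auto simp: box_def)
  have S0: "0 \<le> S k" for k unfolding S_def by (rule geo_nonneg[OF c y])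
  have S1: "real (?u k) \<le> S k" "1 \<le> S k" for k
    using geo_ge[OF c y, of k] extend_obs_le[of y1 y k] unfolding S_def by auto
  have A0: "0 \<le> ?A" using force_nonneg[OF \<theta>0] eta x1 by simp
  have z: "0 \<le> ?z k" "?z k \<le> ?A * S k" for k
    unfolding S_def by (rule cond_path_nonneg[OF \<theta>0 x1], rule cond_path_envelope[OF \<theta>0 y x1])
  have lag: "S (k - int i) \<le> S k / \<rho> ^ N" if "i \<le> N" for k i N
  proof -
    have "S (k - int i) \<le> S k / \<rho> ^ i" unfolding S_def by (rule geo_lag[OF c y])
    also have "\<dots> \<le> S k / \<rho> ^ N" using S0 rho that
      by (intro divide_left_mono power_decreasing mult_pos_pos) auto
    finally show ?thesis .
  qed
  have e: "\<delta> * drift \<theta>0 x1 * S k = \<delta> * (\<eta> * drift \<theta>0 x1) * S k / \<eta>" for k using eta by simp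
  have d0: "0 \<le> \<delta> * (\<eta> * drift \<theta>0 x1)" using \<delta> A0 rho eta by (auto simp: drift_def)
  show ?thesis unfolding e
  proof (rule dominate[where d = "\<lambda>k. \<bar>?x k - ?z k\<bar>" and m = 0, OF _ _ _ adm_sum_a[OF \<theta>]])
    show "\<delta> * (\<eta> * drift \<theta>0 x1) * S (k - 1) \<le> \<delta> * (\<eta> * drift \<theta>0 x1) * S k / \<rho>" for k
      using mult_left_mono[OF geo_prev[OF c y, of k] d0] by (simp add: S_def)
    show "0 \<le> \<delta> * (\<eta> * drift \<theta>0 x1) * S k" for k using d0 S0 by simp
    then have "0 \<le> \<delta> * (\<eta> * drift \<theta>0 x1) * S k / \<eta>" for k using eta by (intro divide_nonneg_pos) auto
    then show "\<bar>?x k - ?z k\<bar> \<le> \<delta> * (\<eta> * drift \<theta>0 x1) * S k / \<eta>" if "k \<le> 0" for k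
      by (simp only: cond_path_init[OF that] diff_self abs_zero)
    fix k :: int assume k: "0 < k"
    let ?B = "\<Sum>i=1..p. (ca \<theta> i - ca \<theta>0 i) * ?z (k - int i)"
    let ?C = "\<Sum>i=1..q. (cb \<theta> i - cb \<theta>0 i) * real (?u (k - int i))"
    let ?D = "\<Sum>i=1..p. ca \<theta> i * (?x (k - int i) - ?z (k - int i))"
    \<comment> \<open>Coefficient differences multiply the path of the centre
      \<open>\<theta>0\<close>, so all constants depend on \<open>\<theta>0\<close> alone;
      \<open>ca \<theta>\<close> multiplies the path difference, which the comparison principle
      handles.\<close>
    have eq: "?x k - ?z k = ?D + (om \<theta> - om \<theta>0) + ?B + ?C"
      unfolding cond_path_step[OF k] garch_step_eq
      by (simp add: sum_subtractf algebra_simps)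
    have D: "\<bar>?D\<bar> \<le> (\<Sum>i=1..p. ca \<theta> i * \<bar>?x (k - int i) - ?z (k - int i)\<bar>)"
      by (rule order_trans[OF sum_abs], rule sum_mono) (use admD[OF \<theta>] in \<open>auto simp: abs_mult\<close>)
    have "\<bar>?B\<bar> \<le> (\<Sum>i=1..p. \<delta> * (?A * (S k / \<rho> ^ p)))"
    proof (rule order_trans[OF sum_abs], rule sum_mono)
      fix i assume i: "i \<in> {1..p}"
      have "?z (k - int i) \<le> ?A * (S k / \<rho> ^ p)"
        using i by (intro order_trans[OF z(2)] mult_left_mono lag A0) auto
      then show "\<bar>(ca \<theta> i - ca \<theta>0 i) * ?z (k - int i)\<bar> \<le> \<delta> * (?A * (S k / \<rho> ^ p))"
        unfolding abs_mult using box i z(1) \<delta> by (intro mult_mono) (auto simp: box_def less_imp_le)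
    qed
    then have B: "\<bar>?B\<bar> \<le> \<delta> * (real p * (?A / \<rho> ^ p)) * S k" by (simp add: mult_ac)
    have "\<bar>?C\<bar> \<le> (\<Sum>i=1..q. \<delta> * (S k / \<rho> ^ q))"
    proof (rule order_trans[OF sum_abs], rule sum_mono)
      fix i assume i: "i \<in> {1..q}"
      have "real (?u (k - int i)) \<le> S k / \<rho> ^ q" using i by (intro order_trans[OF S1(1)] lag) auto
      then show "\<bar>(cb \<theta> i - cb \<theta>0 i) * real (?u (k - int i))\<bar> \<le> \<delta> * (S k / \<rho> ^ q)"
        unfolding abs_mult using box i \<delta> by (intro mult_mono) (auto simp: box_def less_imp_le)
    qed
    then have C: "\<bar>?C\<bar> \<le> \<delta> * (real q / \<rho> ^ q) * S k" by (simp add: mult_ac)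
    have "\<bar>om \<theta> - om \<theta>0\<bar> \<le> \<delta> * 1" using box by (auto simp: box_def)
    also have "\<dots> \<le> \<delta> * S k" using S1 \<delta> by (intro mult_left_mono) auto
    finally have O: "\<bar>om \<theta> - om \<theta>0\<bar> \<le> \<delta> * S k" .
    have "\<delta> * (\<eta> * drift \<theta>0 x1) * S k = \<delta> * S k + \<delta> * (real p * (?A / \<rho> ^ p)) * S k + \<delta> * (real q / \<rho> ^ q) * S k"
    proof -
      have "\<eta> * drift \<theta>0 x1 = 1 + real p * (?A / \<rho> ^ p) + real q / \<rho> ^ q" using eta by (simp add: drift_def)
      then show ?thesis by (simp only: distrib_left distrib_right mult_1_right)
    qed
    with D B C O show "\<bar>?x k - ?z k\<bar> \<le> (\<Sum>i=1..p. ca \<theta> i * \<bar>?x (k - int i) - ?z (k - int i)\<bar>) + \<delta> * (\<eta> * drift \<theta>0 x1) * S k"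
      unfolding eq by linarith
  qed (use k admD[OF \<theta>] in auto)
qed

text \<open>
  Bound for the oscillation of the log-likelihood over a box, as the average of an integrable function along
  the path.
\<close>

definition osc :: "param \<Rightarrow> real \<Rightarrow> nat \<Rightarrow> real \<Rightarrow> (int \<Rightarrow> nat) \<Rightarrow> int \<Rightarrow> real" where
  "osc \<theta>0 x1 y1 \<delta> y k =
     \<delta> * ((2 / cr \<theta>0 + (force \<theta>0 / \<eta> + x1) + (cr \<theta>0 + 1) * drift \<theta>0 x1) * geo (real y1 + 1) y k)
     + real (y k) * min (2 / om \<theta>0) (\<delta> * (drift \<theta>0 x1 * (4 / (om \<theta>0)\<^sup>2) * geo (real y1 + 1) y k))"

lemma loglik_osc:
  assumes \<theta>: "adm \<theta>" and \<theta>0: "adm \<theta>0" and y: "good y" and x1: "0 \<le> x1" and box: "\<theta> \<in> box \<theta>0 \<delta>"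
    and \<delta>: "\<delta> \<le> 1" "\<delta> \<le> cr \<theta>0 / 2" "\<delta> \<le> om \<theta>0 / 2" and k: "0 < k"
  shows "\<bar>ln (nb (cr \<theta>0) (cond_path \<theta>0 x1 y1 y k) (y k)) - ln (nb (cr \<theta>) (cond_path \<theta> x1 y1 y k) (y k))\<bar> \<le> osc \<theta>0 x1 y1 \<delta> y k"
proof -
  let ?x = "cond_path \<theta> x1 y1 y k" and ?z = "cond_path \<theta>0 x1 y1 y k" and ?n = "real (y k)"
  let ?A = "force \<theta>0 / \<eta> + x1" and ?S = "geo (real y1 + 1) y k" and ?d = "drift \<theta>0 x1"
  have c: "(0::real) \<le> real y1 + 1" by simp
  have \<delta>0: "0 \<le> \<delta>" using box by (auto simp: box_def)
  have b: "\<bar>cr \<theta>0 - cr \<theta>\<bar> \<le> \<delta>" "\<bar>om \<theta>0 - om \<theta>\<bar> \<le> \<delta>" using box by (auto simp: box_def)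
  note r = admD(2)[OF \<theta>0] and o = admD(1)[OF \<theta>0]
  have S0: "0 \<le> ?S" "?n \<le> ?S" using geo_nonneg[OF c y] geo_ge[OF c y, of k] by auto
  have A0: "0 \<le> ?A" using force_nonneg[OF \<theta>0] eta x1 by simp
  have d0: "0 \<le> ?d" using A0 rho eta by (auto simp: drift_def)
  have z: "0 \<le> ?z" "?z \<le> ?A * ?S"
    by (rule cond_path_nonneg[OF \<theta>0 x1], rule cond_path_envelope[OF \<theta>0 y x1])
  have per: "\<bar>?z - ?x\<bar> \<le> \<delta> * ?d * ?S"
    using cond_path_perturb[OF \<theta> \<theta>0 y x1 box, of k y1] k by (simp add: abs_minus_commute)
  have "\<bar>ln (nb (cr \<theta>0) ?z (y k)) - ln (nb (cr \<theta>) ?x (y k))\<bar> \<le>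
      ?n * (\<bar>cr \<theta>0 - cr \<theta>\<bar> / (cr \<theta>0 / 2)) + \<bar>cr \<theta>0 - cr \<theta>\<bar> * ?z + cr \<theta> * \<bar>?z - ?x\<bar>
      + ?n * min (1 / (om \<theta>0 / 2)) (\<bar>?z - ?x\<bar> / (om \<theta>0 / 2)\<^sup>2)"
  \<comment> \<open>Half of \<open>cr \<theta>0\<close> and half of \<open>om \<theta>0\<close> are
    lower bounds for every parameter in the box; \<open>\<delta> \<le> 1\<close> gives
    \<open>cr \<theta> \<le> cr \<theta>0 + 1\<close> in the next estimate.\<close>
  proof (rule ln_nb_diff_le)
    show "om \<theta>0 / 2 \<le> ?z" using cond_path_ge[OF \<theta>0 x1 k, of y1 y] o by simp
    show "om \<theta>0 / 2 \<le> ?x" using cond_path_ge[OF \<theta> x1 k, of y1 y] b(2) \<delta>(3) by linarith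
  qed (use r o b \<delta> in auto)
  also have "\<dots> \<le> ?S * (\<delta> / (cr \<theta>0 / 2)) + \<delta> * (?A * ?S) + (cr \<theta>0 + 1) * (\<delta> * ?d * ?S)
      + ?n * min (1 / (om \<theta>0 / 2)) (\<delta> * ?d * ?S / (om \<theta>0 / 2)\<^sup>2)"
    using b \<delta> \<delta>0 S0 z per r admD(2)[OF \<theta>]
    by (intro add_mono mult_mono divide_right_mono mult_left_mono min.mono) auto
  also have "\<dots> = osc \<theta>0 x1 y1 \<delta> y k"
    using r by (simp add: osc_def power_divide field_simps)
  finally show ?thesis .
qed

lemma osc_shift: "osc \<theta>0 x1 y1 \<delta> (\<lambda>j. y (j + h)) k = osc \<theta>0 x1 y1 \<delta> y (k + h)"
  by (simp add: osc_def geo_shift)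

lemma osc_measurable:
  assumes "\<And>j. (\<lambda>w. f w j) \<in> measurable M (count_space UNIV)"
  shows "(\<lambda>w. osc \<theta>0 x1 y1 \<delta> (f w) k) \<in> borel_measurable M"
proof -
  have [measurable]: "(\<lambda>w. real (f w k)) \<in> borel_measurable M"
    by (rule measurable_compose[OF assms]) simp
  note [measurable] = geo_measurable[OF assms]
  show ?thesis unfolding osc_def by measurable
qed

text \<open>The product of an observation with the envelope may have infinite mean. The constant
  branch of the \<open>min\<close> supplies an integrable majorant, the other branch the pointwise
  limit 0.\<close>

lemma osc_small:
  assumes \<theta>s: "adm \<theta>s" and \<theta>0: "adm \<theta>0" and x1: "0 \<le> x1"
  shows "0 < \<delta> \<Longrightarrow> \<delta> \<le> 1 \<Longrightarrow> integrable (stat_law p q \<theta>s) (\<lambda>w. osc \<theta>0 x1 y1 \<delta> (Ys w) 0)"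
    and "(\<lambda>m. \<integral>w. osc \<theta>0 x1 y1 (1 / real (Suc m)) (Ys w) 0 \<partial>stat_law p q \<theta>s) \<longlonglongrightarrow> 0"
proof -
  let ?P = "stat_law p q \<theta>s"
  note D = stationary_solutionD[OF stat_law_eq(1)[OF \<theta>s]]
  let ?C = "2 / cr \<theta>0 + (force \<theta>0 / \<eta> + x1) + (cr \<theta>0 + 1) * drift \<theta>0 x1"
  let ?E = "drift \<theta>0 x1 * (4 / (om \<theta>0)\<^sup>2)"
  let ?S = "\<lambda>w. geo (real y1 + 1) (Ys w) 0"
  have A0: "0 \<le> force \<theta>0 / \<eta> + x1" using force_nonneg[OF \<theta>0] eta x1 by simp
  have d0: "0 \<le> drift \<theta>0 x1" using A0 rho eta by (auto simp: drift_def)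
  have C0: "0 \<le> ?C" using A0 d0 admD(2)[OF \<theta>0] by auto
  have E0: "0 \<le> ?E" using d0 by auto
  have om: "0 < om \<theta>0" by (rule admD(1)[OF \<theta>0])
  have m: "(\<lambda>w. osc \<theta>0 x1 y1 \<delta> (Ys w) 0) \<in> borel_measurable ?P" for \<delta>
    by (rule osc_measurable) (rule Ys_coord_measurable(1)[OF D(2)])
  have Bi: "integrable ?P (\<lambda>w. (?C + 2 / om \<theta>0) * ?S w)" using stat_law_good(2)[OF \<theta>s] by simp
  have bound: "AE w in ?P. norm (osc \<theta>0 x1 y1 \<delta> (Ys w) 0) \<le> (?C + 2 / om \<theta>0) * ?S w" if \<delta>: "0 < \<delta>" "\<delta> \<le> 1" for \<delta>
    using stat_law_good(1)[OF \<theta>s]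
  proof eventually_elim
    case (elim w)
    have S: "0 \<le> ?S w" "real (Ys w 0) \<le> ?S w"
      using geo_nonneg[of "real y1 + 1" "Ys w" 0] geo_ge[of "real y1 + 1" "Ys w" 0] elim by auto
    have "0 \<le> \<delta> * (?E * ?S w)" using \<delta> by (intro mult_nonneg_nonneg E0 S(1)) auto
    then have m0: "0 \<le> min (2 / om \<theta>0) (\<delta> * (?E * ?S w))" using om by simp
    have 1: "0 \<le> real (Ys w 0) * min (2 / om \<theta>0) (\<delta> * (?E * ?S w))"
      "real (Ys w 0) * min (2 / om \<theta>0) (\<delta> * (?E * ?S w)) \<le> ?S w * (2 / om \<theta>0)"
      by (intro mult_nonneg_nonneg of_nat_0_le_iff m0) (intro mult_mono S m0 min.cobounded1)
    have 2: "0 \<le> \<delta> * (?C * ?S w)" using \<delta> C0 S by (intro mult_nonneg_nonneg) auto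
    have "\<delta> * (?C * ?S w) \<le> 1 * (?C * ?S w)" using \<delta> C0 S by (intro mult_right_mono mult_nonneg_nonneg) auto
    moreover have "(?C + 2 / om \<theta>0) * ?S w = 1 * (?C * ?S w) + ?S w * (2 / om \<theta>0)"
      by (simp only: distrib_right[of ?C] mult_1 mult.commute[of "?S w" "2 / om \<theta>0"])
    ultimately show ?case using 1 2 unfolding osc_def real_norm_def
      by (subst abs_of_nonneg) linarith+
  qed
  show "integrable ?P (\<lambda>w. osc \<theta>0 x1 y1 \<delta> (Ys w) 0)" if \<delta>: "0 < \<delta>" "\<delta> \<le> 1" for \<delta>
  proof (rule Bochner_Integration.integrable_bound[OF Bi m])
    show "AE w in ?P. norm (osc \<theta>0 x1 y1 \<delta> (Ys w) 0) \<le> norm ((?C + 2 / om \<theta>0) * ?S w)"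
      using bound[OF \<delta>] by eventually_elim auto
  qed
  have "(\<lambda>m. \<integral>w. osc \<theta>0 x1 y1 (1 / real (Suc m)) (Ys w) 0 \<partial>?P) \<longlonglongrightarrow> (\<integral>w. 0 \<partial>?P)"
  proof (rule integral_dominated_convergence[OF _ m Bi])
    show "AE w in ?P. (\<lambda>m. osc \<theta>0 x1 y1 (1 / real (Suc m)) (Ys w) 0) \<longlonglongrightarrow> 0"
    proof (rule AE_I2)
      fix w
      have l: "(\<lambda>m. 1 / real (Suc m)) \<longlonglongrightarrow> 0" using LIMSEQ_inverse_real_of_nat by (simp add: inverse_eq_divide)
      have "(\<lambda>m. osc \<theta>0 x1 y1 (1 / real (Suc m)) (Ys w) 0) \<longlonglongrightarrow>
          0 * (?C * ?S w) + real (Ys w 0) * min (2 / om \<theta>0) (0 * (?E * ?S w))"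
        unfolding osc_def by (intro tendsto_intros l)
      then show "(\<lambda>m. osc \<theta>0 x1 y1 (1 / real (Suc m)) (Ys w) 0) \<longlonglongrightarrow> 0" using om by simp
    qed
    show "AE w in ?P. norm (osc \<theta>0 x1 y1 (1 / real (Suc m)) (Ys w) 0) \<le> (?C + 2 / om \<theta>0) * ?S w" for m
      by (rule bound) auto
  qed simp
  then show "(\<lambda>m. \<integral>w. osc \<theta>0 x1 y1 (1 / real (Suc m)) (Ys w) 0 \<partial>?P) \<longlonglongrightarrow> 0" by simp
qed

text \<open>One oscillation function serves all parameters in the box, so one null set suffices
  although the box is uncountable; its mean is below \<open>e\<close> once the radius is
  small.\<close>

lemma loglik_local_sup:
  assumes \<theta>s: "adm \<theta>s" and \<theta>0: "adm \<theta>0" and x1: "0 \<le> x1" and e: "0 < e"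
  obtains \<delta> where "0 < \<delta>" and "AE y in stat_law_Y p q \<theta>s. \<forall>\<^sub>F n in sequentially. \<forall>\<theta>. adm \<theta> \<longrightarrow> \<theta> \<in> box \<theta>0 \<delta> \<longrightarrow>
    cond_loglik p q (\<lambda>_. x1) (\<lambda>_. y1) n y \<theta> \<le> cond_loglik p q (\<lambda>_. x1) (\<lambda>_. y1) n y \<theta>0 + e"
proof -
  let ?P = "stat_law p q \<theta>s" and ?Q = "stat_law_Y p q \<theta>s"
  note r = admD(1,2)[OF \<theta>0]
  have "(\<lambda>m. 1 / real (Suc m)) \<longlonglongrightarrow> 0" using LIMSEQ_inverse_real_of_nat by (simp add: inverse_eq_divide)
  moreover have "0 < min (cr \<theta>0 / 2) (om \<theta>0 / 2)" using r by simp
  ultimately have "\<forall>\<^sub>F m in sequentially. 1 / real (Suc m) < min (cr \<theta>0 / 2) (om \<theta>0 / 2)" by (rule order_tendstoD(2))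
  from eventually_conj[OF this order_tendstoD(2)[OF osc_small(2)[OF \<theta>s \<theta>0 x1] e, of y1]]
  have "\<forall>\<^sub>F m in sequentially. 1 / real (Suc m) < min (cr \<theta>0 / 2) (om \<theta>0 / 2) \<and> (\<integral>w. osc \<theta>0 x1 y1 (1 / real (Suc m)) (Ys w) 0 \<partial>?P) < e"
    .
  then obtain m where m: "1 / real (Suc m) < min (cr \<theta>0 / 2) (om \<theta>0 / 2)" "(\<integral>w. osc \<theta>0 x1 y1 (1 / real (Suc m)) (Ys w) 0 \<partial>?P) < e"
    by (auto simp: eventually_sequentially)
  define \<delta> where "\<delta> = 1 / real (Suc m)"
  have \<delta>: "0 < \<delta>" "\<delta> \<le> 1" "\<delta> \<le> cr \<theta>0 / 2" "\<delta> \<le> om \<theta>0 / 2" using m(1) by (auto simp: \<delta>_def)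
  have "AE y in ?Q. \<forall>\<^sub>F n in sequentially. \<forall>\<theta>. adm \<theta> \<longrightarrow> \<theta> \<in> box \<theta>0 \<delta> \<longrightarrow>
    cond_loglik p q (\<lambda>_. x1) (\<lambda>_. y1) n y \<theta> \<le> cond_loglik p q (\<lambda>_. x1) (\<lambda>_. y1) n y \<theta>0 + e"
    using stat_law_Y_lln[OF \<theta>s osc_small(1)[OF \<theta>s \<theta>0 x1 \<delta>(1,2), of y1] osc_shift osc_measurable[OF obs_coord_measurable]]
      stat_law_Y_good[OF \<theta>s]
  proof eventually_elim
    case (elim y)
    then have good: "good y" by blast
    have "\<forall>\<^sub>F n in sequentially. (\<Sum>k=1..n. osc \<theta>0 x1 y1 \<delta> y (int k)) / real n < e"
      using order_tendstoD(2)[OF elim(1)] m(2) by (simp add: \<delta>_def)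
    then show ?case
    proof eventually_elim
      case (elim n)
      show ?case
      proof (intro allI impI)
        fix \<theta> assume \<theta>: "adm \<theta>" and box: "\<theta> \<in> box \<theta>0 \<delta>"
        have "(\<Sum>k=1..n. ln (nb (cr \<theta>) (cond_path \<theta> x1 y1 y (int k)) (y (int k)))) \<le>
          (\<Sum>k=1..n. ln (nb (cr \<theta>0) (cond_path \<theta>0 x1 y1 y (int k)) (y (int k))) + osc \<theta>0 x1 y1 \<delta> y (int k))"
        proof (rule sum_mono)
          fix k assume "k \<in> {1..n}"
          then have "0 < int k" by simp
          from loglik_osc[OF \<theta> \<theta>0 good x1 box \<delta>(2,3,4) this, of y1]
          show "ln (nb (cr \<theta>) (cond_path \<theta> x1 y1 y (int k)) (y (int k))) \<le>
            ln (nb (cr \<theta>0) (cond_path \<theta>0 x1 y1 y (int k)) (y (int k))) + osc \<theta>0 x1 y1 \<delta> y (int k)" by linarith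
        qed
        then have "cond_loglik p q (\<lambda>_. x1) (\<lambda>_. y1) n y \<theta> \<le>
            cond_loglik p q (\<lambda>_. x1) (\<lambda>_. y1) n y \<theta>0 + (\<Sum>k=1..n. osc \<theta>0 x1 y1 \<delta> y (int k)) / real n"
          unfolding cond_loglik_eq[OF \<theta>] cond_loglik_eq[OF \<theta>0] sum.distrib add_divide_distrib[symmetric]
          by (intro divide_right_mono) auto
        then show "cond_loglik p q (\<lambda>_. x1) (\<lambda>_. y1) n y \<theta> \<le> cond_loglik p q (\<lambda>_. x1) (\<lambda>_. y1) n y \<theta>0 + e"
          using elim by linarith
      qed
    qed
  qed
  then show ?thesis by (rule that[OF \<delta>(1)])
qed

text \<open>Near each point of \<open>K\<close> the likelihood eventually stays below that of
  \<open>\<theta>s\<close>. Finitely many boxes cover \<open>K\<close>, and none of them can then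
  contain a maximiser that lies in \<open>\<Theta>\<close>.\<close>

lemma mle_eventually_outside:
  assumes adm: "\<And>\<theta>. \<theta> \<in> \<Theta> \<Longrightarrow> adm \<theta>" and \<theta>s: "\<theta>s \<in> \<Theta>" and x1: "0 \<le> x1"
    and mle: "cond_mle p q \<Theta> (\<lambda>_. x1) (\<lambda>_. y1) \<theta>hat"
    and K: "compact K" "K \<subseteq> \<Theta>" "K \<inter> param_class p q \<Theta> \<theta>s = {}"
  shows "AE y in stat_law_Y p q \<theta>s. \<forall>\<^sub>F n in sequentially. \<theta>hat n y \<notin> K"
proof -
  let ?P = "stat_law p q \<theta>s" and ?Q = "stat_law_Y p q \<theta>s"
  let ?l = "\<lambda>\<theta>. \<integral>w. obs_loglik \<theta> (Ys w) 0 \<partial>?P"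
  let ?L = "\<lambda>n y \<theta>. cond_loglik p q (\<lambda>_. x1) (\<lambda>_. y1) n y \<theta>"
  note a = adm[OF \<theta>s]
  have gap: "?l \<theta>0 < ?l \<theta>s" if "\<theta>0 \<in> K" for \<theta>0
  proof -
    have \<theta>0: "\<theta>0 \<in> \<Theta>" using that K by blast
    have "?l \<theta>0 \<noteq> ?l \<theta>s"
    proof
      assume "?l \<theta>0 = ?l \<theta>s"
      from stat_law_Y_eqI[OF a adm[OF \<theta>0] stat_law_KL(2)[OF a adm[OF \<theta>0] this]]
      have "\<theta>0 \<in> param_class p q \<Theta> \<theta>s" using \<theta>0 by (simp add: param_class_def)
      then show False using that K by blast
    qed
    with stat_law_KL(1)[OF a adm[OF \<theta>0]] show ?thesis by simp
  qed
  have "\<exists>\<delta>>0. AE y in ?Q. \<forall>\<^sub>F n in sequentially. \<forall>\<theta>\<in>\<Theta> \<inter> box \<theta>0 \<delta>. ?L n y \<theta> < ?L n y \<theta>s" if "\<theta>0 \<in> K" for \<theta>0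
  proof -
    have \<theta>0: "\<theta>0 \<in> \<Theta>" using that K by blast
    \<comment> \<open>A third of the gap each for the oscillation over the box, the convergence at
      \<open>\<theta>0\<close> and the convergence at \<open>\<theta>s\<close>.\<close>
    define e where "e = (?l \<theta>s - ?l \<theta>0) / 3"
    have e: "0 < e" using gap[OF that] by (simp add: e_def)
    obtain \<delta> where \<delta>: "0 < \<delta>" and loc: "AE y in ?Q. \<forall>\<^sub>F n in sequentially. \<forall>\<theta>. adm \<theta> \<longrightarrow> \<theta> \<in> box \<theta>0 \<delta> \<longrightarrow> ?L n y \<theta> \<le> ?L n y \<theta>0 + e"
      by (rule loglik_local_sup[OF a adm[OF \<theta>0] x1 e])
    have "AE y in ?Q. \<forall>\<^sub>F n in sequentially. \<forall>\<theta>\<in>\<Theta> \<inter> box \<theta>0 \<delta>. ?L n y \<theta> < ?L n y \<theta>s"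
      using loc loglik_converges[OF a adm[OF \<theta>0] x1, of y1] loglik_converges[OF a a x1, of y1]
    proof eventually_elim
      case (elim y)
      have "\<forall>\<^sub>F n in sequentially. ?L n y \<theta>0 < ?l \<theta>0 + e" "\<forall>\<^sub>F n in sequentially. ?l \<theta>s - e < ?L n y \<theta>s"
        using e by (auto intro: order_tendstoD(2)[OF elim(2)] order_tendstoD(1)[OF elim(3)])
      with elim(1) show ?case
      proof eventually_elim
        case (elim n)
        show ?case
        proof
          fix \<theta> assume "\<theta> \<in> \<Theta> \<inter> box \<theta>0 \<delta>"
          then have "?L n y \<theta> \<le> ?L n y \<theta>0 + e" using elim(1) adm by blast
          moreover have "3 * e = ?l \<theta>s - ?l \<theta>0" by (simp add: e_def)
          ultimately show "?L n y \<theta> < ?L n y \<theta>s" using elim(2,3) by linarith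
        qed
      qed
    qed
    then show ?thesis using \<delta> by blast
  qed
  then have "\<forall>\<theta>0\<in>K. \<exists>\<delta>>0. AE y in ?Q. \<forall>\<^sub>F n in sequentially. \<forall>\<theta>\<in>\<Theta> \<inter> box \<theta>0 \<delta>. ?L n y \<theta> < ?L n y \<theta>s" by (rule ballI)
  from bchoice[OF this] obtain \<delta> where \<delta>': "\<forall>\<theta>0\<in>K. 0 < \<delta> \<theta>0 \<and> (AE y in ?Q. \<forall>\<^sub>F n in sequentially. \<forall>\<theta>\<in>\<Theta> \<inter> box \<theta>0 (\<delta> \<theta>0). ?L n y \<theta> < ?L n y \<theta>s)" ..
  have \<delta>: "0 < \<delta> \<theta>0" "AE y in ?Q. \<forall>\<^sub>F n in sequentially. \<forall>\<theta>\<in>\<Theta> \<inter> box \<theta>0 (\<delta> \<theta>0). ?L n y \<theta> < ?L n y \<theta>s" if "\<theta>0 \<in> K" for \<theta>0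
    using bspec[OF \<delta>' that] by (rule conjunct1, rule conjunct2)
  have cover: "K \<subseteq> (\<Union>\<theta>0\<in>K. box \<theta>0 (\<delta> \<theta>0))" using \<delta>(1) by (auto simp: box_def)
  obtain I where I: "I \<subseteq> K" "finite I" "K \<subseteq> (\<Union>\<theta>0\<in>I. box \<theta>0 (\<delta> \<theta>0))"
    by (rule compactE_image[OF K(1) open_box cover]) (rule that)
  have "AE y in ?Q. \<forall>\<theta>0\<in>I. \<forall>\<^sub>F n in sequentially. \<forall>\<theta>\<in>\<Theta> \<inter> box \<theta>0 (\<delta> \<theta>0). ?L n y \<theta> < ?L n y \<theta>s"
    using I \<delta>(2) by (intro AE_finite_allI) auto
  then show ?thesis
  proof eventually_elim
    case (elim y)
    then have "\<forall>\<^sub>F n in sequentially. \<forall>\<theta>0\<in>I. \<forall>\<theta>\<in>\<Theta> \<inter> box \<theta>0 (\<delta> \<theta>0). ?L n y \<theta> < ?L n y \<theta>s"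
      using I(2) by (simp add: eventually_ball_finite)
    then show ?case using eventually_ge_at_top[of 1]
    proof eventually_elim
      case (elim n)
      show ?case
      proof
        assume "\<theta>hat n y \<in> K"
        then have "?L n y (\<theta>hat n y) < ?L n y \<theta>s" using I(3) K(2) elim(1) by blast
        moreover have "is_arg_max (cond_loglik p q (\<lambda>_. x1) (\<lambda>_. y1) n y) (\<lambda>\<theta>. \<theta> \<in> \<Theta>) (\<theta>hat n y)"
          using mle elim(2) unfolding cond_mle_def by blast
        ultimately show False using \<theta>s unfolding is_arg_max_def by blast
      qed
    qed
  qed
qed

end

section \<open>Identifiability\<close>

text \<open>The polynomial evaluated at the forward shift. Products become compositions
  (\<open>lag_op_mult\<close>), so elimination between linear recursions is polynomial
  algebra.\<close>

definition lag_op :: "complex poly \<Rightarrow> (int \<Rightarrow> complex) \<Rightarrow> int \<Rightarrow> complex" where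
  "lag_op R s k = (\<Sum>i\<le>degree R. coeff R i * s (k + int i))"

lemma lag_op_bound: "degree R \<le> N \<Longrightarrow> lag_op R s k = (\<Sum>i\<le>N. coeff R i * s (k + int i))"
  unfolding lag_op_def by (rule sum.mono_neutral_left) (auto simp: coeff_eq_0)

lemma lag_op_0 [simp]: "lag_op 0 s k = 0"
  by (simp add: lag_op_def)

lemma lag_op_add: "lag_op (R + S) s k = lag_op R s k + lag_op S s k"
proof -
  let ?N = "max (degree R) (degree S)"
  have "degree (R + S) \<le> ?N" by (rule degree_add_le) auto
  then show ?thesis
    by (simp add: lag_op_bound[of _ ?N] sum.distrib distrib_right)
qed

lemma lag_op_smult: "lag_op (smult c R) s k = c * lag_op R s k"
  by (simp add: lag_op_bound[OF degree_smult_le] lag_op_def sum_distrib_left mult.assoc)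

lemma lag_op_minus: "lag_op (- R) s k = - lag_op R s k"
  using lag_op_smult[of "-1" R s k] by simp

lemma lag_op_diff: "lag_op (R - S) s k = lag_op R s k - lag_op S s k"
  using lag_op_add[of R "- S" s k] by (simp add: lag_op_minus)

lemma lag_op_pCons: "lag_op (pCons a R) s k = a * s k + lag_op R s (k + 1)"
proof -
  have "lag_op (pCons a R) s k = (\<Sum>i\<le>Suc (degree R). coeff (pCons a R) i * s (k + int i))"
    by (rule lag_op_bound) (simp add: degree_pCons_le)
  also have "\<dots> = a * s k + (\<Sum>i\<le>degree R. coeff R i * s (k + int (Suc i)))"
    by (subst sum.atMost_Suc_shift) simp
  finally show ?thesis unfolding lag_op_def[of R] by (simp add: algebra_simps)
qed

lemma lag_op_mult: "lag_op (R * S) s k = lag_op R (lag_op S s) k"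
proof (induction R arbitrary: k)
  case (pCons a R)
  then show ?case by (simp add: lag_op_add lag_op_smult lag_op_pCons)
qed simp

lemma lag_op_monom: "lag_op (monom c n) s k = c * s (k + int n)"
proof (induction n arbitrary: k)
  case (Suc n)
  then show ?case by (simp add: monom_Suc lag_op_pCons algebra_simps)
qed (simp add: monom_0 lag_op_pCons)

lemma lag_op_sum: "finite I \<Longrightarrow> lag_op (\<Sum>i\<in>I. f i) s k = (\<Sum>i\<in>I. lag_op (f i) s k)"
  by (induction I rule: finite_induct) (auto simp: lag_op_add)

lemma lag_op_linear: "lag_op R (\<lambda>k. s k + t k) k = lag_op R s k + lag_op R t k"
  by (simp add: lag_op_def sum.distrib distrib_left)

lemma lag_op_const: "lag_op R (\<lambda>_. c) k = lag_op R (\<lambda>_. c) 0"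
  by (simp add: lag_op_def)

lemma lag_op_shift: "lag_op R (\<lambda>k. s (k + h)) k = lag_op R s (k + h)"
  by (simp add: lag_op_def algebra_simps)

lemma lag_op_P_poly:
  "lag_op (P_poly p a) s k = s (k + int p) - (\<Sum>i=1..p. complex_of_real (a i) * s (k + int p - int i))"
  unfolding P_poly_def
  by (simp add: lag_op_diff lag_op_sum lag_op_monom of_nat_diff algebra_simps)

lemma lag_op_Q_poly:
  assumes "1 \<le> q"
  shows "lag_op (Q_poly q b) s k = (\<Sum>i=1..q. complex_of_real (b i) * s (k + int q - int i))"
proof -
  have "lag_op (Q_poly q b) s k = (\<Sum>j=0..q-1. complex_of_real (b (j + 1)) * s (k + int (q - 1 - j)))"
    unfolding Q_poly_def by (simp add: lag_op_sum lag_op_monom)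
  also have "\<dots> = (\<Sum>i=1..q. complex_of_real (b i) * s (k + int q - int i))"
    by (rule sum.reindex_bij_witness[of _ "\<lambda>i. i - 1" Suc])
       (use assms in \<open>auto simp: of_nat_diff algebra_simps\<close>)
  finally show ?thesis .
qed

lemma coeff_Q_poly:
  assumes "1 \<le> i" "i \<le> q" shows "coeff (Q_poly q b) (q - i) = complex_of_real (b i)"
proof -
  have "coeff (Q_poly q b) (q - i) = (\<Sum>j=0..q-1. if j = i - 1 then complex_of_real (b (j + 1)) else 0)"
    unfolding Q_poly_def coeff_sum coeff_monom using assms by (intro sum.cong) auto
  then show ?thesis using assms by simp
qed

lemma degree_Q_poly: "degree (Q_poly q b) \<le> q - 1"
  unfolding Q_poly_def by (rule degree_sum_le) (auto intro: order_trans[OF degree_monom_le])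

lemma degree_P_poly: "1 \<le> p \<Longrightarrow> degree (P_poly p a) = p" "P_poly p a \<noteq> 0"
proof -
  have c: "coeff (P_poly p a) p = 1"
    unfolding P_poly_def coeff_diff coeff_sum coeff_monom by (subst sum.neutral) auto
  then show "P_poly p a \<noteq> 0" by auto
  have "degree (P_poly p a) \<le> p"
    unfolding P_poly_def
    by (intro degree_diff_le degree_sum_le) (auto intro: order_trans[OF degree_monom_le])
  then show "degree (P_poly p a) = p" using le_degree[of "P_poly p a" p] c by simp
qed

text \<open>A complex root of \<open>P\<close> is not a root of \<open>Q\<close>, so it is one of
  \<open>A\<close>; cancelling the linear factor lowers the degree of \<open>P\<close>.\<close>

lemma dvd_mult_no_common_root:
  fixes P Q A :: "complex poly"
  assumes "P \<noteq> 0" "\<not> (\<exists>z. poly P z = 0 \<and> poly Q z = 0)" "P dvd A * Q"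
  shows "P dvd A"
  using assms
proof (induction "degree P" arbitrary: P A)
  case 0
  then show ?case by (metis is_unit_iff_degree unit_imp_dvd)
next
  case (Suc n)
  have "\<not> constant (poly P)" using Suc.hyps(2) by (simp add: constant_degree)
  then obtain z where z: "poly P z = 0" using fundamental_theorem_of_algebra by blast
  then obtain P' where P': "P = [:- z, 1:] * P'" using poly_eq_0_iff_dvd by (blast elim: dvdE)
  obtain c where c: "A * Q = P * c" using Suc.prems(3) by (rule dvdE)
  have "poly (A * Q) z = 0" unfolding c using z by simp
  then have "poly A z = 0" using Suc.prems(2) z by auto
  then obtain A' where A': "A = [:- z, 1:] * A'" using poly_eq_0_iff_dvd by (blast elim: dvdE)
  have P0: "P' \<noteq> 0" using P' Suc.prems(1) by auto
  have "[:- z, 1:] * P' dvd [:- z, 1:] * (A' * Q)" using Suc.prems(3) unfolding P' A' by (simp only: mult.assoc)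
  then have 1: "P' dvd A' * Q" by (subst (asm) dvd_mult_cancel_left) simp
  have 2: "n = degree P'" using Suc.hyps(2) P0 unfolding P' by (subst (asm) degree_mult_eq) auto
  have 3: "\<not> (\<exists>z. poly P' z = 0 \<and> poly Q z = 0)" using Suc.prems(2) unfolding P' by auto
  have "P' dvd A'" by (rule Suc.hyps(1)[OF 2 P0 3 1])
  then show ?case unfolding P' A' by (rule mult_dvd_mono[OF dvd_refl])
qed

context garch_orders
begin

section \<open>Consequences of equal observation laws\<close>

lemma stat_law_loglik_Y:
  assumes "adm \<theta>s"
  shows "(\<integral>w. obs_loglik \<theta> (Ys w) 0 \<partial>stat_law p q \<theta>s) = (\<integral>y. obs_loglik \<theta> y 0 \<partial>stat_law_Y p q \<theta>s)"
  unfolding stat_law_Y_def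
  by (rule integral_distr[symmetric, OF Ys_measurable[OF stationary_solutionD(2)[OF stat_law_eq(1)[OF assms]]]])
     (rule obs_loglik_measurable[OF obs_coord_measurable])

text \<open>The expected log-likelihood depends only on the law of the observations, so equal laws
  give the comparison in both directions, hence equality; \<open>nb_inject\<close> then identifies
  shape and filter.\<close>

lemma same_class_same_X:
  assumes \<theta>s: "adm \<theta>s" and \<theta>: "adm \<theta>" and eq: "stat_law_Y p q \<theta> = stat_law_Y p q \<theta>s"
  shows "cr \<theta> = cr \<theta>s" and "AE w in stat_law p q \<theta>s. \<forall>k. obs_X \<theta> (Ys w) k = fst (w k)"
proof -
  let ?P = "stat_law p q \<theta>s"
  note S = stat_law_eq(1)[OF \<theta>s]
  interpret P: prob_space ?P by (rule stationary_solutionD(1)[OF S])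
  have "(\<integral>w. obs_loglik \<theta> (Ys w) 0 \<partial>?P) = (\<integral>w. obs_loglik \<theta>s (Ys w) 0 \<partial>?P)"
    using stat_law_KL(1)[OF \<theta>s \<theta>] stat_law_KL(1)[OF \<theta> \<theta>s]
    unfolding stat_law_loglik_Y[OF \<theta>s] stat_law_loglik_Y[OF \<theta>] eq by simp
  from stat_law_KL(2)[OF \<theta>s \<theta> this]
  have nb: "AE w in ?P. \<forall>y. nb (cr \<theta>) (obs_X \<theta> (Ys w) 0) y = nb (cr \<theta>s) (obs_X \<theta>s (Ys w) 0) y" .
  have inj: "AE w in ?P. cr \<theta> = cr \<theta>s \<and> obs_X \<theta> (Ys w) 0 = obs_X \<theta>s (Ys w) 0"
    using nb stat_law_good(1)[OF \<theta>s]
  proof eventually_elim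
    case (elim w)
    have "0 < obs_X \<theta> (Ys w) 0" "0 < obs_X \<theta>s (Ys w) 0"
      using obs_X_good(3)[OF \<theta> elim(2), of 0] obs_X_good(3)[OF \<theta>s elim(2), of 0] admD(1)[OF \<theta>] admD(1)[OF \<theta>s] by auto
    then show ?case
      using nb_inject[OF admD(2)[OF \<theta>] admD(2)[OF \<theta>s], of "obs_X \<theta> (Ys w) 0" "obs_X \<theta>s (Ys w) 0"] elim(1) by blast
  qed
  then show "cr \<theta> = cr \<theta>s" using P.AE_const by (auto elim: eventually_mono)
  have "AE w in ?P. obs_X \<theta> (Ys w) k = obs_X \<theta>s (Ys w) k" for k
    using stationary_AE_shift[OF S inj, of k]
  proof eventually_elim
    case (elim w)
    then show ?case using obs_X_shift[of \<theta> "Ys w" k 0] obs_X_shift[of \<theta>s "Ys w" k 0] by simp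
  qed
  then have "AE w in ?P. \<forall>k. obs_X \<theta> (Ys w) k = obs_X \<theta>s (Ys w) k" by (subst AE_all_countable) auto
  then show "AE w in ?P. \<forall>k. obs_X \<theta> (Ys w) k = fst (w k)"
    using solution_X_eq_obs_X[OF \<theta>s S] by eventually_elim simp
qed

text \<open>Solved for its latest observation, a nontrivial relation would determine that
  observation from the past, whereas 0 and 1 are both possible.\<close>

lemma no_linear_relation:
  assumes \<theta>s: "adm \<theta>s" and rel: "AE w in stat_law p q \<theta>s. \<forall>k. lag_op C (\<lambda>k. of_nat (Ys w k)) k = c0"
  shows "C = 0"
proof (rule ccontr)
  assume C: "C \<noteq> 0"
  let ?P = "stat_law p q \<theta>s"
  note S = stat_law_eq(1)[OF \<theta>s]
  note D = stationary_solutionD[OF S]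
  interpret P: prob_space ?P by (rule D)
  let ?F = "past_algebra ?P (\<lambda>k w. fst (w k)) (\<lambda>k w. snd (w k)) 0"
  define d where "d = degree C"
  define R where "R w = (\<Sum>i<d. coeff C i * of_nat (Ys w (- int d + int i)))" for w :: "int \<Rightarrow> real \<times> nat"
  have lc: "coeff C d \<noteq> 0" using C by (simp add: d_def)
  have ae: "AE w in ?P. coeff C d * of_nat (snd (w 0)) + R w = c0"
    using rel
  proof eventually_elim
    case (elim w)
    \<comment> \<open>At this time the leading term is the observation at 0, and all others lie in
      the past.\<close>
    from elim[rule_format, of "- int d"] show ?case
      by (simp add: lag_op_def R_def d_def[symmetric] lessThan_Suc_atMost[symmetric] add.commute)
  qed
  have Rm [measurable]: "R \<in> borel_measurable ?F"
    unfolding R_def[abs_def]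
  proof (intro borel_measurable_sum borel_measurable_times borel_measurable_const)
    fix i assume "i \<in> {..<d}"
    then have "(\<lambda>w. snd (w (- int d + int i))) \<in> measurable ?F (count_space UNIV)" by (intro past_algebra_Y) auto
    then show "(\<lambda>w. of_nat (Ys w (- int d + int i)) :: complex) \<in> borel_measurable ?F"
      by (rule measurable_compose) simp
  qed
  have "AE w in ?P. \<forall>y. coeff C d * of_nat y + R w = c0"
  proof (rule nbin_garch_transition_AE[where k = 0 and Q = "\<lambda>y w. coeff C d * of_nat y + R w = c0", OF D(3) admD(2)[OF \<theta>s] _ _ ae])
    show "AE w in ?P. 0 < fst (w 0)"
      using stat_law_good(1)[OF \<theta>s] solution_X_eq_obs_X[OF \<theta>s S]
    proof eventually_elim
      case (elim w)
      then show ?case using obs_X_good(3)[OF \<theta>s, of "Ys w" 0] admD(1)[OF \<theta>s] by auto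
    qed
    have sp: "space ?F = space ?P" by (simp add: past_algebra_def space_measure_of_conv)
    show "{w \<in> space ?P. coeff C d * of_nat y + R w = c0} \<in> sets ?F" for y unfolding sp[symmetric] by measurable
  qed
  then have "AE w in ?P. False"
  proof eventually_elim
    case (elim w)
    from elim[rule_format, of 0] elim[rule_format, of 1] lc show False by simp
  qed
  then show False using P.AE_const by simp
qed

lemma class_singleton:
  assumes \<theta>s: "adm \<theta>s" "\<theta>s \<in> param_space p q" and \<theta>: "adm \<theta>" "\<theta> \<in> param_space p q"
    and eq: "stat_law_Y p q \<theta> = stat_law_Y p q \<theta>s"
    and roots: "\<not> (\<exists>z. poly (P_poly p (ca \<theta>s)) z = 0 \<and> poly (Q_poly q (cb \<theta>s)) z = 0)"
  shows "\<theta> = \<theta>s"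
proof -
  let ?P = "P_poly p (ca \<theta>s)" and ?Q = "Q_poly q (cb \<theta>s)"
  \<comment> \<open>\<open>Q_poly p\<close> of the coefficient differences has degree below
    \<open>p\<close>, so divisibility by \<open>?P\<close> will force \<open>A = 0\<close>.\<close>
  define A where "A = Q_poly p (\<lambda>i. ca \<theta> i - ca \<theta>s i)"
  define B where "B = Q_poly q (\<lambda>i. cb \<theta> i - cb \<theta>s i)"
  define g where "g = complex_of_real (om \<theta> - om \<theta>s)"
  define c0 where "c0 = - (lag_op A (\<lambda>_. of_real (om \<theta>s)) 0 + lag_op ?P (\<lambda>_. g) 0)"
  note S = stat_law_eq(1)[OF \<theta>s(1)]
  interpret M: prob_space "stat_law p q \<theta>s" by (rule stationary_solutionD(1)[OF S])
  have rel: "AE w in stat_law p q \<theta>s. \<forall>k.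
      om \<theta> - om \<theta>s + (\<Sum>i=1..p. (ca \<theta> i - ca \<theta>s i) * fst (w (k - int i))) + (\<Sum>i=1..q. (cb \<theta> i - cb \<theta>s i) * real (snd (w (k - int i)))) = 0 \<and>
      fst (w k) = om \<theta>s + (\<Sum>i=1..p. ca \<theta>s i * fst (w (k - int i))) + (\<Sum>i=1..q. cb \<theta>s i * real (snd (w (k - int i))))"
    using stat_law_good(1)[OF \<theta>s(1)] same_class_same_X(2)[OF \<theta>s(1) \<theta>(1) eq] stationary_solutionD(4)[OF S]
  proof eventually_elim
    case (elim w)
    show ?case
    proof
      fix k
      have o: "obs_X \<theta> (Ys w) = Xs w" using elim(2) by auto
      have 1: "fst (w k) = garch_step p q \<theta> (Xs w) (Ys w) k"
        using obs_X_good(1)[OF \<theta>(1) elim(1), of k] unfolding o .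
      have 2: "fst (w k) = garch_step p q \<theta>s (Xs w) (Ys w) k" using elim(3) by blast
      show "om \<theta> - om \<theta>s + (\<Sum>i=1..p. (ca \<theta> i - ca \<theta>s i) * fst (w (k - int i))) + (\<Sum>i=1..q. (cb \<theta> i - cb \<theta>s i) * real (snd (w (k - int i)))) = 0 \<and>
        fst (w k) = om \<theta>s + (\<Sum>i=1..p. ca \<theta>s i * fst (w (k - int i))) + (\<Sum>i=1..q. cb \<theta>s i * real (snd (w (k - int i))))"
        using 1 2 unfolding garch_step_eq by (simp add: left_diff_distrib sum_subtractf)
    qed
  qed
  have "AE w in stat_law p q \<theta>s. \<forall>k. lag_op (A * ?Q + B * ?P) (\<lambda>k. of_nat (Ys w k)) k = c0"
    using rel
  proof eventually_elim
    case (elim w)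
    let ?X = "\<lambda>k. complex_of_real (fst (w k))" and ?Y = "\<lambda>k. of_nat (Ys w k) :: complex"
    \<comment> \<open>The \<open>P\<close> operator reads the recursion at time
      \<open>k + p\<close>, the \<open>Q\<close> operator at \<open>k + q\<close>; this offset
      aligns them.\<close>
    let ?h = "int p - int q"
    have PX: "lag_op ?P ?X k = of_real (om \<theta>s) + lag_op ?Q ?Y (k + ?h)" for k
    proof -
      have "?X (k + int p) = complex_of_real (om \<theta>s + (\<Sum>i=1..p. ca \<theta>s i * fst (w (k + int p - int i))) + (\<Sum>i=1..q. cb \<theta>s i * real (snd (w (k + int p - int i)))))"
        using elim[rule_format, of "k + int p"] by presburger
      then show ?thesis by (simp add: lag_op_P_poly lag_op_Q_poly[OF q1])
    qed
    have AX: "lag_op A ?X k + lag_op B ?Y (k + ?h) + g = 0" for k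
    proof -
      have "complex_of_real (om \<theta> - om \<theta>s + (\<Sum>i=1..p. (ca \<theta> i - ca \<theta>s i) * fst (w (k + int p - int i))) + (\<Sum>i=1..q. (cb \<theta> i - cb \<theta>s i) * real (snd (w (k + int p - int i))))) = 0"
        using elim[rule_format, of "k + int p"] by simp
      then show ?thesis unfolding A_def B_def g_def
        by (simp add: lag_op_Q_poly[OF q1] lag_op_Q_poly[OF p1] algebra_simps)
    qed
    show ?case
    proof
      fix k
      define j where "j = k - ?h"
      \<comment> \<open>Apply \<open>?P\<close> to the difference relation, commute it past
        \<open>A\<close>, and express \<open>?P\<close> acting on \<open>X\<close> through
        observations: \<open>X\<close> is eliminated.\<close>
      have "0 = lag_op ?P (\<lambda>k. lag_op A ?X k + lag_op B ?Y (k + ?h) + g) j" unfolding AX by (simp add: lag_op_def)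
      also have "\<dots> = lag_op ?P (lag_op A ?X) j + lag_op ?P (\<lambda>k. lag_op B ?Y (k + ?h)) j + lag_op ?P (\<lambda>_. g) j"
        by (simp only: lag_op_linear)
      also have "lag_op ?P (lag_op A ?X) j = lag_op A (lag_op ?P ?X) j"
        by (simp add: lag_op_mult[symmetric] mult.commute)
      also have "lag_op ?P ?X = (\<lambda>k. of_real (om \<theta>s) + lag_op ?Q ?Y (k + ?h))" by (rule ext) (rule PX)
      also have "lag_op A (\<lambda>k. of_real (om \<theta>s) + lag_op ?Q ?Y (k + ?h)) j = lag_op A (\<lambda>_. of_real (om \<theta>s)) j + lag_op (A * ?Q) ?Y k"
        by (simp add: lag_op_linear lag_op_shift lag_op_mult j_def)
      also have "lag_op ?P (\<lambda>k. lag_op B ?Y (k + ?h)) j = lag_op (B * ?P) ?Y k"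
        by (simp add: lag_op_shift lag_op_mult[symmetric] mult.commute j_def)
      also have "lag_op A (\<lambda>_. of_real (om \<theta>s)) j = lag_op A (\<lambda>_. of_real (om \<theta>s)) 0" by (rule lag_op_const)
      also have "lag_op ?P (\<lambda>_. g) j = lag_op ?P (\<lambda>_. g) 0" by (rule lag_op_const)
      finally have "lag_op (A * ?Q) ?Y k + lag_op (B * ?P) ?Y k + (lag_op A (\<lambda>_. of_real (om \<theta>s)) 0 + lag_op ?P (\<lambda>_. g) 0) = 0"
        by (simp only: ac_simps)
      then show "lag_op (A * ?Q + B * ?P) ?Y k = c0" by (simp only: lag_op_add c0_def eq_neg_iff_add_eq_0)
    qed
  qed
  from no_linear_relation[OF \<theta>s(1) this] have zero: "A * ?Q + B * ?P = 0" .
  have "?P dvd A * ?Q" using zero by (metis dvd_triv_right dvd_minus_iff eq_neg_iff_add_eq_0)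
  then have dvd: "?P dvd A"
    by (rule dvd_mult_no_common_root[OF degree_P_poly(2) roots])
  have A0: "A = 0"
  proof (rule ccontr)
    assume "A \<noteq> 0"
    then have "p \<le> degree A" using dvd_imp_degree_le[OF dvd] degree_P_poly(1)[OF p1] by simp
    then show False using degree_Q_poly[of p "\<lambda>i. ca \<theta> i - ca \<theta>s i"] p1 by (simp add: A_def)
  qed
  then have B0: "B = 0" using zero degree_P_poly(2) by simp
  have ca: "ca \<theta> i = ca \<theta>s i" if "i \<in> {1..p}" for i
    using coeff_Q_poly[of i p "\<lambda>i. ca \<theta> i - ca \<theta>s i"] A0 that by (simp add: A_def)
  have cb: "cb \<theta> i = cb \<theta>s i" if "i \<in> {1..q}" for i
    using coeff_Q_poly[of i q "\<lambda>i. cb \<theta> i - cb \<theta>s i"] B0 that by (simp add: B_def)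
  have "AE w in stat_law p q \<theta>s. om \<theta> = om \<theta>s"
    using rel
  proof eventually_elim
    case (elim w)
    from elim[rule_format, of 0] ca cb show ?case by simp
  qed
  then have om: "om \<theta> = om \<theta>s" using M.AE_const by simp
  have PiE: "ca \<theta>' \<in> {1..p} \<rightarrow>\<^sub>E {0..}" "cb \<theta>' \<in> {1..q} \<rightarrow>\<^sub>E {0..}" if "\<theta>' \<in> param_space p q" for \<theta>'
    using that by (simp_all add: param_space_def mem_Times_iff)
  \<comment> \<open>Agreement on the index range is equality of functions because parameters are
    extensional.\<close>
  have "ca \<theta> = ca \<theta>s" by (rule PiE_ext[OF PiE(1)[OF \<theta>(2)] PiE(1)[OF \<theta>s(2)] ca])
  moreover have "cb \<theta> = cb \<theta>s" by (rule PiE_ext[OF PiE(2)[OF \<theta>(2)] PiE(2)[OF \<theta>s(2)] cb])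
  moreover have "cr \<theta> = cr \<theta>s" by (rule same_class_same_X(1)[OF \<theta>s(1) \<theta>(1) eq])
  ultimately show ?thesis using om by (simp add: prod_eq_iff)
qed

end

text \<open>By compactness the contraction sums stay below some \<open>c < 1\<close>; the remaining
  margin is shared between the geometric weights and \<open>\<eta>\<close>.\<close>

lemma common_rate:
  fixes \<Theta> :: "param set"
  assumes p: "1 \<le> p" and q: "1 \<le> q" and sub: "\<Theta> \<subseteq> param_space p q" and comp: "compact \<Theta>"
    and con: "\<forall>(\<omega>, a, b, r) \<in> \<Theta>. (\<Sum>k=1..p. a k) + r * (\<Sum>k=1..q. b k) < 1"
  shows "\<exists>\<rho> \<eta>. garch_orders p q \<rho> \<eta> \<and> (\<forall>\<theta>\<in>\<Theta>. garch_orders.adm p q \<rho> \<eta> \<theta>)"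
proof -
  let ?c = "\<lambda>\<theta>::param. (\<Sum>k=1..p. ca \<theta> k) + cr \<theta> * (\<Sum>k=1..q. cb \<theta> k)"
  have cont: "continuous_on \<Theta> ?c"
    using param_coord_continuous by (intro continuous_intros) (auto intro: continuous_on_subset)
  obtain c where c: "0 \<le> c" "c < 1" "\<And>\<theta>. \<theta> \<in> \<Theta> \<Longrightarrow> ?c \<theta> \<le> c"
  proof (cases "\<Theta> = {}")
    case False
    then obtain \<theta>m where m: "\<theta>m \<in> \<Theta>" "\<And>\<theta>. \<theta> \<in> \<Theta> \<Longrightarrow> ?c \<theta> \<le> ?c \<theta>m"
      using continuous_attains_sup[OF comp False cont] by blast
    have "0 \<le> ?c \<theta>m"
      using m(1) sub by (auto simp: param_space_def PiE_def Pi_def intro!: add_nonneg_nonneg mult_nonneg_nonneg sum_nonneg)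
    moreover have "?c \<theta>m < 1" using con m(1) by (auto simp: split_beta)
    ultimately show ?thesis using m by (intro that[of "?c \<theta>m"]) auto
  qed (use that[of 0] in auto)
  \<comment> \<open>Here \<open>1 - \<eta> = d\<close> and \<open>\<rho> ^ i \<ge> d\<close> for all
    lags up to \<open>p + q\<close>. The weighted sum is at most \<open>c / d\<close>, and
    \<open>c \<le> d\<^sup>2\<close> because
    \<open>d\<^sup>2 - c = ((1 - c) / 2)\<^sup>2\<close>.\<close>
  define \<eta> where "\<eta> = (1 - c) / 2"
  define d where "d = (1 + c) / 2"
  define \<rho> where "\<rho> = root (p + q) d"
  have d: "0 < d" "d < 1" using c by (auto simp: d_def)
  have N: "0 < p + q" using p by simp
  have \<rho>: "0 < \<rho>" "\<rho> < 1" "\<rho> ^ (p + q) = d" using d N by (auto simp: \<rho>_def real_root_lt_1_iff)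
  have \<eta>: "0 < \<eta>" "\<eta> < 1" using c by (auto simp: \<eta>_def)
  interpret garch_orders p q \<rho> \<eta> by unfold_locales (use p q \<rho> \<eta> in auto)
  have "adm \<theta>" if \<theta>: "\<theta> \<in> \<Theta>" for \<theta>
  proof -
    have s: "0 < om \<theta>" "0 < cr \<theta>" "\<And>i. i \<in> {1..p} \<Longrightarrow> 0 \<le> ca \<theta> i" "\<And>i. i \<in> {1..q} \<Longrightarrow> 0 \<le> cb \<theta> i"
      using \<theta> sub by (auto simp: param_space_def PiE_def Pi_def)
    have w: "x / \<rho> ^ i \<le> x / d" if "0 \<le> x" "i \<le> p + q" for x :: real and i
    proof (rule divide_left_mono)
      show "d \<le> \<rho> ^ i" unfolding \<rho>(3)[symmetric] using \<rho> that by (intro power_decreasing) auto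
    qed (use that \<rho> d in auto)
    have "(\<Sum>i=1..p. ca \<theta> i / \<rho> ^ i) + cr \<theta> * (\<Sum>i=1..q. cb \<theta> i / \<rho> ^ i) \<le>
        (\<Sum>i=1..p. ca \<theta> i / d) + cr \<theta> * (\<Sum>i=1..q. cb \<theta> i / d)"
      using s by (intro add_mono mult_left_mono sum_mono w) auto
    also have "\<dots> = ?c \<theta> / d" by (simp add: sum_divide_distrib[symmetric] add_divide_distrib)
    also have "\<dots> \<le> c / d" using c(3)[OF \<theta>] d by (intro divide_right_mono) auto
    also have "\<dots> \<le> 1 - \<eta>"
    proof -
      have "c \<le> (1 - \<eta>) * d" using sum_power2_ge_zero[of "1 - c" 0] by (simp add: \<eta>_def d_def field_simps power2_eq_square)
      then show ?thesis using d by (simp add: pos_divide_le_eq)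
    qed
    finally show ?thesis using s unfolding adm_def by blast
  qed
  then show ?thesis using garch_orders_axioms by blast
qed

theorem theorem5:
  fixes p q :: nat
    and \<Theta> :: "param set"
    and \<Delta> :: "param \<Rightarrow> param \<Rightarrow> real"
  assumes p: "1 \<le> p" and q: "1 \<le> q"
    and Theta_sub: "\<Theta> \<subseteq> param_space p q"
    and Theta_compact: "compact \<Theta>"
    and Delta_metric: "Metric_space \<Theta> \<Delta>"
    and Delta_topology: "Metric_space.mtopology \<Theta> \<Delta> = top_of_set \<Theta>"
    and contraction: "\<forall>(\<omega>, a, b, r) \<in> \<Theta>. (\<Sum>k=1..p. a k) + r * (\<Sum>k=1..q. b k) < 1"
  shows
    "(\<forall>\<theta>\<in>\<Theta>. (\<exists>!P. stationary_solution p q \<theta> P)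
         \<and> (\<integral>\<^sup>+ x. ennreal x \<partial>stat_marginal_X p q \<theta>) < \<infinity>)
     \<and> (\<forall>(x1::real) (y1::nat) \<theta>hat. 0 < x1 \<longrightarrow> cond_mle p q \<Theta> (\<lambda>_. x1) (\<lambda>_. y1) \<theta>hat \<longrightarrow>
         (\<forall>\<theta>s\<in>\<Theta>. AE Y in stat_law_Y p q \<theta>s.
            (\<lambda>n. dist_to_set \<Delta> (\<theta>hat n Y) (param_class p q \<Theta> \<theta>s)) \<longlonglongrightarrow> 0))
     \<and> (\<forall>(x1::real) (y1::nat) \<theta>hat. 0 < x1 \<longrightarrow> cond_mle p q \<Theta> (\<lambda>_. x1) (\<lambda>_. y1) \<theta>hat \<longrightarrow>
         (\<forall>(\<omega>s, as, bs, rs)\<in>\<Theta>.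
            \<not> (\<exists>z::complex. poly (P_poly p as) z = 0 \<and> poly (Q_poly q bs) z = 0) \<longrightarrow>
            (AE Y in stat_law_Y p q (\<omega>s, as, bs, rs).
              (\<lambda>n. \<Delta> (\<theta>hat n Y) (\<omega>s, as, bs, rs)) \<longlonglongrightarrow> 0)))"
proof -
  obtain \<rho> \<eta> where "garch_orders p q \<rho> \<eta>" and adm': "\<forall>\<theta>\<in>\<Theta>. garch_orders.adm p q \<rho> \<eta> \<theta>"
    using common_rate[OF p q Theta_sub Theta_compact contraction] by blast
  then interpret garch_orders p q \<rho> \<eta> by simp
  interpret D: Metric_space \<Theta> \<Delta> by (rule Delta_metric)
  have adm: "adm \<theta>" if "\<theta> \<in> \<Theta>" for \<theta> using adm' that by blast
  have cls: "AE Y in stat_law_Y p q \<theta>s. (\<lambda>n. dist_to_set \<Delta> (\<theta>hat n Y) (param_class p q \<Theta> \<theta>s)) \<longlonglongrightarrow> 0"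
    if x1: "0 < x1" and mle: "cond_mle p q \<Theta> (\<lambda>_. x1) (\<lambda>_. y1) \<theta>hat" and \<theta>s: "\<theta>s \<in> \<Theta>"
    for x1 :: real and y1 :: nat and \<theta>hat \<theta>s
  proof -
    let ?C = "param_class p q \<Theta> \<theta>s"
    have "\<theta>s \<in> ?C" using \<theta>s by (simp add: param_class_def)
    moreover have "?C \<subseteq> \<Theta>" unfolding param_class_def by (rule Collect_restrict)
    ultimately have C: "?C \<subseteq> \<Theta>" "?C \<noteq> {}" by blast+
    \<comment> \<open>A union of balls is relatively open by \<open>Delta_topology\<close>, so its
      complement in \<open>\<Theta>\<close> is compact and the estimator eventually avoids
      it.\<close>
    define U where "U e = (\<Union>\<theta>\<in>?C. D.mball \<theta> e)" for e
    have ev: "AE Y in stat_law_Y p q \<theta>s. \<forall>\<^sub>F n in sequentially. \<theta>hat n Y \<notin> \<Theta> - U e" if e: "0 < e" for e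
    proof (rule mle_eventually_outside[OF adm \<theta>s less_imp_le[OF x1] mle])
      have "openin D.mtopology (U e)" unfolding U_def by (intro openin_Union) (auto simp: D.openin_mball)
      then obtain T where T: "open T" "U e = \<Theta> \<inter> T" unfolding Delta_topology openin_open by blast
      have "\<Theta> - U e = \<Theta> - T" using T by auto
      then show "compact (\<Theta> - U e)" using compact_diff[OF Theta_compact T(1)] by simp
      show "(\<Theta> - U e) \<inter> ?C = {}" using C e by (auto simp: U_def)
    qed auto
    \<comment> \<open>Countably many radii keep the exceptional set null.\<close>
    have "AE Y in stat_law_Y p q \<theta>s. \<forall>m. \<forall>\<^sub>F n in sequentially. \<theta>hat n Y \<notin> \<Theta> - U (1 / real (Suc m))"
      unfolding AE_all_countable by (intro allI ev) simp
    then show ?thesis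
    proof eventually_elim
      case (elim Y)
      have nn: "0 \<le> dist_to_set \<Delta> \<theta> ?C" for \<theta>
        unfolding dist_to_set_def using C by (intro cINF_greatest) auto
      show ?case
      proof (rule tendstoI)
        fix e :: real assume "0 < e"
        then obtain m where m: "1 / real (Suc m) < e" using reals_Archimedean[of e] by (auto simp: inverse_eq_divide)
        show "\<forall>\<^sub>F n in sequentially. dist (dist_to_set \<Delta> (\<theta>hat n Y) ?C) 0 < e"
          using elim[rule_format, of m] eventually_ge_at_top[of 1]
        proof eventually_elim
          case (elim n)
          have "\<theta>hat n Y \<in> \<Theta>" using mle elim(2) unfolding cond_mle_def is_arg_max_def by blast
          then obtain \<theta>' where \<theta>': "\<theta>' \<in> ?C" "\<Delta> \<theta>' (\<theta>hat n Y) < 1 / real (Suc m)"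
            using elim(1) by (auto simp: U_def)
          have "dist_to_set \<Delta> (\<theta>hat n Y) ?C \<le> \<Delta> (\<theta>hat n Y) \<theta>'"
            unfolding dist_to_set_def by (rule cINF_lower[OF _ \<theta>'(1)]) (auto intro!: bdd_belowI[of _ 0])
          then show ?case using \<theta>' m nn[of "\<theta>hat n Y"] D.commute[of \<theta>' "\<theta>hat n Y"] by (simp add: dist_real_def)
        qed
      qed
    qed
  qed
  have single: "AE Y in stat_law_Y p q \<theta>s. (\<lambda>n. \<Delta> (\<theta>hat n Y) \<theta>s) \<longlonglongrightarrow> 0"
    if "0 < x1" "cond_mle p q \<Theta> (\<lambda>_. x1) (\<lambda>_. y1) \<theta>hat" and \<theta>s: "\<theta>s \<in> \<Theta>"
      and roots: "\<not> (\<exists>z. poly (P_poly p (ca \<theta>s)) z = 0 \<and> poly (Q_poly q (cb \<theta>s)) z = 0)"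
    for x1 :: real and y1 :: nat and \<theta>hat \<theta>s
  proof -
    have "\<theta> = \<theta>s" if "\<theta> \<in> param_class p q \<Theta> \<theta>s" for \<theta>
    proof -
      have "\<theta> \<in> \<Theta>" "stat_law_Y p q \<theta> = stat_law_Y p q \<theta>s" using that by (simp_all add: param_class_def)
      then show ?thesis using class_singleton[OF adm[OF \<theta>s] _ adm _ _ roots] Theta_sub \<theta>s by blast
    qed
    moreover have "\<theta>s \<in> param_class p q \<Theta> \<theta>s" using \<theta>s by (simp add: param_class_def)
    ultimately have "param_class p q \<Theta> \<theta>s = {\<theta>s}" by blast
    then show ?thesis using cls[OF that(1,2) \<theta>s] by (simp add: dist_to_set_def)
  qed
  show ?thesis
  proof (intro conjI allI impI ballI)
    fix x1 :: real and y1 :: nat and \<theta>hat and \<theta> :: param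
    assume a: "0 < x1" "cond_mle p q \<Theta> (\<lambda>_. x1) (\<lambda>_. y1) \<theta>hat" "\<theta> \<in> \<Theta>"
    obtain \<omega>s as bs rs where e: "\<theta> = (\<omega>s, as, bs, rs)" by (cases \<theta>)
    from single[OF a] show "case \<theta> of (\<omega>s, as, bs, rs) \<Rightarrow>
      \<not> (\<exists>z::complex. poly (P_poly p as) z = 0 \<and> poly (Q_poly q bs) z = 0) \<longrightarrow>
      (AE Y in stat_law_Y p q (\<omega>s, as, bs, rs). (\<lambda>n. \<Delta> (\<theta>hat n Y) (\<omega>s, as, bs, rs)) \<longlonglongrightarrow> 0)"
      unfolding e prod.case fst_conv snd_conv by blast
  qed (use stat_law_eq(3)[OF adm] stat_marginal_X_finite_mean[OF adm] cls in auto)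
qed

end
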